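(* Let $E$ be an arbitrary directed graph, $K$ a field, and $L=L_K(E)$ the Leavitt path algebra. Suppose $$I=P_1^{r_1}\cdots P_m^{r_m}=Q_1^{s_1}\cdots Q_n^{s_n}$$ are two representations of an ideal $I$ of $L$, each as an irredundant product of powers of distinct prime ideals (that is, $P_1,\dots,P_m$ are distinct prime ideals, $Q_1,\dots,Q_n$ are distinct prime ideals, and the $r_i,s_j$ are positive integers). Then $m=n$ and $\{P_1^{r_1},\dots,P_m^{r_m}\}=\{Q_1^{s_1},\dots,Q_n^{s_n}\}$.
   Context: A directed graph $E=(E^0,E^1,r,s)$ consists of sets $E^0$ (vertices), $E^1$ (edges) and maps $r,s:E^1\to E^0$; no finiteness or countability is assumed. A vertex is regular if it emits a nonempty finite set of edges. $L_K(E)$ is the (not necessarily unital) $K$-algebra generated by pairwise orthogonal idempotents $v\in E^0$ and elements $e,e^*$ ($e\in E^1$) subject to: $s(e)e=e=er(e)$; $r(e)e^*=e^*=e^*s(e)$; $e^*e=r(e)$ and $e^*f=0$ for edges $e\neq f$; $v=\sum_{s(e)=v}ee^*$ for every regular vertex $v$. "Ideal" means two-sided ideal; prime ideals are proper. (Multiplication of ideals in $L_K(E)$ is commutative.) A product $I=A_1\cdots A_k$ of distinct ideals is irredundant if $I$ is not the product of any proper subset of the ideals $\{A_1,\dots,A_k\}$; here the factors are the prime powers $P_i^{r_i}$ (respectively $Q_j^{s_j}$). *)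

theory Defs
  imports
    "HOL-Algebra.QuotRing"
    "HOL-Algebra.Ideal_Product"
    "HOL-Library.Poly_Mapping"
    "Graph_Theory.Digraph"
begin

section \<open>Free algebras and presentations by generators and relations\<close>

text \<open>Words form the free monoid. The monoid operation is written additively because the
  convolution product on \<^typ>\<open>'a \<Rightarrow>\<^sub>0 'b\<close> asks for a key type of class \<^class>\<open>monoid_add\<close>; with
  words as keys, that product is concatenation of words extended bilinearly.\<close>

datatype 'x fword = FWord (letters: "'x list")

instantiation fword :: (type) monoid_add
begin

definition zero_fword :: "'a fword" where
  "0 = FWord []"

definition plus_fword :: "'a fword \<Rightarrow> 'a fword \<Rightarrow> 'a fword" where
  "u + w = FWord (letters u @ letters w)"

instance
  by standard (simp_all add: zero_fword_def plus_fword_def)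

end

type_synonym ('x, 'k) free_elem = "'x fword \<Rightarrow>\<^sub>0 'k"

definition gen :: "'x \<Rightarrow> ('x, 'k::comm_ring_1) free_elem" where
  "gen x = Poly_Mapping.single (FWord [x]) 1"

text \<open>The unital free algebra \<open>K\<langle>X\<rangle>\<close> on a set \<open>X\<close> of generators.\<close>

definition free_algebra :: "'x set \<Rightarrow> ('x, 'k::comm_ring_1) free_elem ring" where
  "free_algebra X = \<lparr>
     carrier = {p. \<forall>w \<in> Poly_Mapping.keys p. set (letters w) \<subseteq> X},
     mult = (\<lambda>p q. p * q),
     one = 1,
     zero = 0,
     add = (\<lambda>p q. p + q)\<rparr>"

text \<open>The elements of \<open>K\<langle>X\<rangle>\<close> without constant term: the free non-unital algebra on \<open>X\<close>.\<close>

definition free_augmentation :: "'x set \<Rightarrow> ('x, 'k::comm_ring_1) free_elem set" where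
  "free_augmentation X = {p \<in> carrier (free_algebra X). Poly_Mapping.lookup p 0 = 0}"

text \<open>The non-unital algebra generated by \<open>X\<close> subject to the relations \<open>p = 0\<close> for \<open>p \<in> S\<close>, where
  \<open>S\<close> consists of elements without constant term. The ideal of \<open>K\<langle>X\<rangle>\<close> generated by such an \<open>S\<close> has
  no constant terms and coincides with the algebra ideal that \<open>S\<close> generates in the free non-unital
  algebra, so the quotient by it can be formed inside the unital ring \<open>K\<langle>X\<rangle> / \<langle>S\<rangle>\<close>. The field
  \<^const>\<open>one\<close> of the resulting record is the unit of that larger ring, which is not in the carrier.\<close>

definition nonunital_presentation ::
  "'x set \<Rightarrow> ('x, 'k::comm_ring_1) free_elem set \<Rightarrow> ('x, 'k) free_elem set ring" where
  "nonunital_presentation X S =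
     (let F = free_algebra X; N = genideal F S
      in (F Quot N)\<lparr>carrier := (\<lambda>p. N +>\<^bsub>F\<^esub> p) ` free_augmentation X\<rparr>)"

lemma free_algebra_simps [simp]:
  "mult (free_algebra X) p q = p * q"
  "one (free_algebra X) = 1"
  "zero (free_algebra X) = 0"
  "add (free_algebra X) p q = p + q"
  by (simp_all add: free_algebra_def)

lemma mem_carrier_free_algebra:
  "p \<in> carrier (free_algebra X) \<longleftrightarrow>
    (\<forall>w \<in> Poly_Mapping.keys p. set (letters w) \<subseteq> X)"
  by (simp add: free_algebra_def)

lemma ring_free_algebra: "ring (free_algebra X :: ('x, 'k::comm_ring_1) free_elem ring)"
proof (rule ringI)
  let ?F = "free_algebra X :: ('x, 'k) free_elem ring"
  have uminus: "- p \<in> carrier ?F" if "p \<in> carrier ?F" for p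
    using that by (simp add: mem_carrier_free_algebra)
  show "abelian_group ?F"
  proof (rule abelian_groupI)
    fix p q :: "('x, 'k) free_elem" assume "p \<in> carrier ?F" "q \<in> carrier ?F"
    then show "p \<oplus>\<^bsub>?F\<^esub> q \<in> carrier ?F"
      using Poly_Mapping.keys_add[of p q] by (auto simp: mem_carrier_free_algebra)
  next
    fix p assume "p \<in> carrier ?F"
    then show "\<exists>q \<in> carrier ?F. q \<oplus>\<^bsub>?F\<^esub> p = \<zero>\<^bsub>?F\<^esub>"
      using uminus by (intro bexI[of _ "- p"]) simp_all
  qed (simp_all add: mem_carrier_free_algebra algebra_simps)
  show "monoid ?F"
  proof (rule monoidI)
    fix p q :: "('x, 'k) free_elem" assume "p \<in> carrier ?F" "q \<in> carrier ?F"
    then show "p \<otimes>\<^bsub>?F\<^esub> q \<in> carrier ?F"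
      using Poly_Mapping.keys_mult[of p q]
      by (fastforce simp: mem_carrier_free_algebra plus_fword_def)
  qed (simp_all add: mem_carrier_free_algebra zero_fword_def algebra_simps)
qed (simp_all add: algebra_simps)


section \<open>Leavitt path algebras\<close>

text \<open>A directed graph \<open>(E\<^sup>0, E\<^sup>1, r, s)\<close> is a \<^const>\<open>wf_digraph\<close> with \<^const>\<open>verts\<close>, \<^const>\<open>arcs\<close>,
  \<^const>\<open>head\<close> and \<^const>\<open>tail\<close>: the range of an edge is its head, the source its tail.\<close>

datatype ('v, 'e) lpa_gen = Vertex 'v | Edge 'e | Ghost 'e

type_synonym ('v, 'e, 'k) lpa_elem = "(('v, 'e) lpa_gen, 'k) free_elem set"

definition lpa_gens :: "('v, 'e) pre_digraph \<Rightarrow> ('v, 'e) lpa_gen set" where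
  "lpa_gens E = Vertex ` verts E \<union> Edge ` arcs E \<union> Ghost ` arcs E"

definition regular_vertex :: "('v, 'e) pre_digraph \<Rightarrow> 'v \<Rightarrow> bool" where
  "regular_vertex E v \<longleftrightarrow> v \<in> verts E \<and> out_arcs E v \<noteq> {} \<and> finite (out_arcs E v)"

abbreviation "vtx v \<equiv> gen (Vertex v)"
abbreviation "edg e \<equiv> gen (Edge e)"
abbreviation "gst e \<equiv> gen (Ghost e)"

inductive_set lpa_relations ::
  "('v, 'e) pre_digraph \<Rightarrow> (('v, 'e) lpa_gen, 'k::field) free_elem set" for E where
  idem: "v \<in> verts E \<Longrightarrow> vtx v * vtx v - vtx v \<in> lpa_relations E"
| orth: "\<lbrakk>v \<in> verts E; w \<in> verts E; v \<noteq> w\<rbrakk> \<Longrightarrow> vtx v * vtx w \<in> lpa_relations E"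
| edge_source: "e \<in> arcs E \<Longrightarrow> vtx (tail E e) * edg e - edg e \<in> lpa_relations E"
| edge_range: "e \<in> arcs E \<Longrightarrow> edg e * vtx (head E e) - edg e \<in> lpa_relations E"
| ghost_range: "e \<in> arcs E \<Longrightarrow> vtx (head E e) * gst e - gst e \<in> lpa_relations E"
| ghost_source: "e \<in> arcs E \<Longrightarrow> gst e * vtx (tail E e) - gst e \<in> lpa_relations E"
| CK1_same: "e \<in> arcs E \<Longrightarrow> gst e * edg e - vtx (head E e) \<in> lpa_relations E"
| CK1_diff: "\<lbrakk>e \<in> arcs E; f \<in> arcs E; e \<noteq> f\<rbrakk> \<Longrightarrow> gst e * edg f \<in> lpa_relations E"
| CK2: "regular_vertex E v \<Longrightarrow>
    vtx v - (\<Sum>e \<in> out_arcs E v. edg e * gst e) \<in> lpa_relations E"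

lemma lpa_relations_subset_augmentation:
  "lpa_relations E \<subseteq> (free_augmentation (lpa_gens E) :: (('v, 'e) lpa_gen, 'k::field) free_elem set)"
  if "wf_digraph E"
proof
  let ?A = "free_augmentation (lpa_gens E) :: (('v, 'e) lpa_gen, 'k) free_elem set"
  interpret wf_digraph E by (fact that)
  have mem [simp]: "Vertex v \<in> lpa_gens E \<longleftrightarrow> v \<in> verts E" "Edge e \<in> lpa_gens E \<longleftrightarrow> e \<in> arcs E"
    "Ghost e \<in> lpa_gens E \<longleftrightarrow> e \<in> arcs E" for v e
    by (auto simp: lpa_gens_def)
  have gen: "gen x \<in> ?A" if "x \<in> lpa_gens E" for x
    using that by (simp add: free_augmentation_def mem_carrier_free_algebra gen_def
        lookup_single zero_fword_def)
  have prod: "gen x * gen y \<in> ?A" if "x \<in> lpa_gens E" "y \<in> lpa_gens E" for x y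
    using that by (simp add: free_augmentation_def mem_carrier_free_algebra gen_def
        mult_single plus_fword_def lookup_single zero_fword_def)
  have diff: "p - q \<in> ?A" if "p \<in> ?A" "q \<in> ?A" for p q
    using that Poly_Mapping.keys_diff[of p q]
    by (auto simp: free_augmentation_def mem_carrier_free_algebra lookup_minus)
  have add: "p + q \<in> ?A" if "p \<in> ?A" "q \<in> ?A" for p q
    using that Poly_Mapping.keys_add[of p q]
    by (auto simp: free_augmentation_def mem_carrier_free_algebra lookup_add)
  have zero: "0 \<in> ?A"
    by (simp add: free_augmentation_def mem_carrier_free_algebra)
  have sum: "(\<Sum>e \<in> C. f e) \<in> ?A" if "\<And>e. e \<in> C \<Longrightarrow> f e \<in> ?A" for C and f :: "'e \<Rightarrow> _"
    using that by (induction C rule: infinite_finite_induct) (simp_all add: zero add)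
  fix p :: "(('v, 'e) lpa_gen, 'k) free_elem"
  assume "p \<in> lpa_relations E"
  then show "p \<in> ?A"
    by cases (auto intro!: diff prod gen sum simp: regular_vertex_def)
qed

definition leavitt_path_algebra ::
  "('v, 'e) pre_digraph \<Rightarrow> ('v, 'e, 'k::field) lpa_elem ring" where
  "leavitt_path_algebra E = nonunital_presentation (lpa_gens E) (lpa_relations E)"


section \<open>Ideals of non-unital rings\<close>

text \<open>The locales \<^locale>\<open>ideal\<close> and \<^locale>\<open>primeideal\<close> of the library presuppose a unital ring,
  respectively a commutative one.\<close>

definition two_sided_ideal :: "'a set \<Rightarrow> ('a, 'b) ring_scheme \<Rightarrow> bool" where
  "two_sided_ideal I R \<longleftrightarrow> additive_subgroup I R \<and>
     (\<forall>a \<in> I. \<forall>x \<in> carrier R. x \<otimes>\<^bsub>R\<^esub> a \<in> I \<and> a \<otimes>\<^bsub>R\<^esub> x \<in> I)"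

definition prime_ideal :: "'a set \<Rightarrow> ('a, 'b) ring_scheme \<Rightarrow> bool" where
  "prime_ideal P R \<longleftrightarrow> two_sided_ideal P R \<and> P \<noteq> carrier R \<and>
     (\<forall>A B. two_sided_ideal A R \<longrightarrow> two_sided_ideal B R \<longrightarrow> ideal_prod R A B \<subseteq> P \<longrightarrow>
        A \<subseteq> P \<or> B \<subseteq> P)"

text \<open>The value at the empty list is only a convention; below, lists of factors are nonempty and
  exponents are positive.\<close>

fun ideal_list_prod :: "('a, 'b) ring_scheme \<Rightarrow> 'a set list \<Rightarrow> 'a set" where
  "ideal_list_prod R [] = carrier R"
| "ideal_list_prod R [A] = A"
| "ideal_list_prod R (A # B # As) = ideal_prod R A (ideal_list_prod R (B # As))"

definition ideal_power :: "('a, 'b) ring_scheme \<Rightarrow> 'a set \<Rightarrow> nat \<Rightarrow> 'a set" where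
  "ideal_power R P k = ideal_list_prod R (replicate k P)"

text \<open>Irredundance of a product of distinct ideals: no proper subset of the factors has the same
  product. Ideal multiplication in a Leavitt path algebra is commutative, so the order in which a
  subset is enumerated is immaterial there.\<close>

definition irredundant_product :: "('a, 'b) ring_scheme \<Rightarrow> 'a set list \<Rightarrow> bool" where
  "irredundant_product R As \<longleftrightarrow> distinct As \<and>
     (\<forall>Bs. Bs \<noteq> [] \<longrightarrow> distinct Bs \<longrightarrow> set Bs \<subset> set As \<longrightarrow>
        ideal_list_prod R Bs \<noteq> ideal_list_prod R As)"

definition prime_power_rep ::
  "('a, 'b) ring_scheme \<Rightarrow> 'a set \<Rightarrow> nat \<Rightarrow> (nat \<Rightarrow> 'a set) \<Rightarrow> (nat \<Rightarrow> nat) \<Rightarrow> bool" where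
  "prime_power_rep R I m P r \<longleftrightarrow>
     m \<ge> 1 \<and>
     (\<forall>i \<in> {1..m}. prime_ideal (P i) R \<and> r i \<ge> 1) \<and>
     inj_on P {1..m} \<and>
     (let As = map (\<lambda>i. ideal_power R (P i) (r i)) [1..<Suc m]
      in I = ideal_list_prod R As \<and> irredundant_product R As)"

end

theory Submission
  imports Defs "HOL-Computational_Algebra.Polynomial"
begin

text \<open>Call an ideal \<open>M\<close> pure if every \<open>x \<in> M\<close> satisfies \<open>u x = x = x u'\<close> for some \<open>u, u' \<in> M\<close>; then
  \<open>M X = X = X M\<close> for every ideal \<open>X \<subseteq> M\<close>. The key fact is that every prime \<open>P\<close> lies in a pure ideal
  \<open>M\<close> contained in all ideals strictly above \<open>P\<close>. If \<open>P\<close> is not itself pure, then some element of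
  \<open>P\<close> reduces to a polynomial in a cycle whose exits lie in \<open>P\<close>, and the corner at that cycle is
  \<open>K[x, x\<^sup>-\<^sup>1]\<close> modulo the pure part of \<open>P\<close>, where nonzero primes are maximal.

  Hence, if primes \<open>P\<^sub>i \<subset> P\<^sub>j\<close> occur in one product, the factor \<open>P\<^sub>j\<close> is redundant, so the primes of
  an irredundant product are incomparable, and they are the minimal primes over the product. If
  \<open>A P\<^sup>k B \<subseteq> P\<^sup>k\<^sup>+\<^sup>1\<close> with \<open>A, B\<close> not inside \<open>P\<close>, then \<open>M \<subseteq> A + P\<close> and \<open>M \<subseteq> B + P\<close>, so
  \<open>P\<^sup>k = M P\<^sup>k M \<subseteq> P\<^sup>k\<^sup>+\<^sup>1\<close>: different exponents of \<open>P\<close> can only occur when the powers agree.\<close>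

section \<open>Ideals in a subring of a ring type\<close>

text \<open>The pure ideal \<open>M\<close> above a prime \<open>P\<close> is the
  \<open>core\<close> of the intersection \<open>J\<close> of all ideals strictly above
  \<open>P\<close>. It lies in each of them by construction; the work is to show that it contains
  \<open>P\<close>. Otherwise an element of \<open>P\<close> outside \<open>core J\<close> reduces
  to some \<open>b\<close> in \<open>P\<close>, still outside \<open>core J\<close>, in the corner
  at a vertex \<open>w\<close> of a cycle. The polynomial argument places \<open>V w\<close> in
  every ideal strictly above \<open>P\<close>, so in \<open>J\<close> and in its core, and
  \<open>b = V w * b\<close> follows it there: a contradiction. Reducing against
  \<open>core J\<close> instead of \<open>core P\<close> lets one argument serve every prime. Two
  obstacles shape the rest. The algebra has no unit, so local units made of commuting range
  projections replace 1; even closure of ideals under scalars rests on them. And it is a record of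
  cosets, not a type, so the ideal theory is done on a subset \<open>R\<close> of a ring type and
  carried over along an injective homomorphism. Monomials carry a middle factor \<open>q v F\<close>
  because at a vertex with infinitely many edges an ideal may contain \<open>q v F\<close> without
  being generated by its vertices.\<close>

inductive_set iprod :: "'a::ring set \<Rightarrow> 'a set \<Rightarrow> 'a set" for A B where
  prod: "a \<in> A \<Longrightarrow> b \<in> B \<Longrightarrow> a * b \<in> iprod A B"
| add: "x \<in> iprod A B \<Longrightarrow> y \<in> iprod A B \<Longrightarrow> x + y \<in> iprod A B"

lemma iprod_mono:
  assumes "A \<subseteq> A'" "B \<subseteq> B'"
  shows "iprod A B \<subseteq> iprod A' B'"
proof
  fix x assume "x \<in> iprod A B"
  then show "x \<in> iprod A' B'"
  proof induction
    case (prod a b)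
    then show ?case using assms by (intro iprod.prod) auto
  qed (rule iprod.add)
qed

lemma iprod_assoc: "iprod (iprod A B) C = iprod A (iprod B C)"
proof (intro equalityI subsetI)
  fix x assume "x \<in> iprod (iprod A B) C"
  then show "x \<in> iprod A (iprod B C)"
  proof induction
    case (prod x c)
    from this(1) show ?case
    proof induction
      case (prod a b)
      then show ?case using \<open>c \<in> C\<close> by (simp add: mult.assoc iprod.prod)
    qed (simp add: distrib_right iprod.add)
  qed (rule iprod.add)
next
  fix x assume "x \<in> iprod A (iprod B C)"
  then show "x \<in> iprod (iprod A B) C"
  proof induction
    case (prod a x)
    from this(2) show ?case
    proof induction
      case (prod b c)
      then show ?case using \<open>a \<in> A\<close> by (simp add: mult.assoc[symmetric] iprod.prod)
    qed (simp add: distrib_left iprod.add)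
  qed (rule iprod.add)
qed

locale ideals_in =
  fixes R :: "'a::ring set"
  assumes R_zero: "0 \<in> R"
    and R_add: "x \<in> R \<Longrightarrow> y \<in> R \<Longrightarrow> x + y \<in> R"
    and R_uminus: "x \<in> R \<Longrightarrow> - x \<in> R"
    and R_mult: "x \<in> R \<Longrightarrow> y \<in> R \<Longrightarrow> x * y \<in> R"
begin

definition is_ideal :: "'a set \<Rightarrow> bool" where
  "is_ideal J \<longleftrightarrow> J \<subseteq> R \<and> 0 \<in> J \<and> (\<forall>x\<in>J. \<forall>y\<in>J. x + y \<in> J) \<and> (\<forall>x\<in>J. - x \<in> J) \<and>
     (\<forall>x\<in>J. \<forall>r\<in>R. r * x \<in> J \<and> x * r \<in> J)"

definition pure :: "'a set \<Rightarrow> bool" where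
  "pure M \<longleftrightarrow> is_ideal M \<and> (\<forall>x\<in>M. (\<exists>u\<in>M. u * x = x) \<and> (\<exists>u\<in>M. x * u = x))"

definition is_prime :: "'a set \<Rightarrow> bool" where
  "is_prime P \<longleftrightarrow> is_ideal P \<and> P \<noteq> R \<and>
     (\<forall>A B. is_ideal A \<longrightarrow> is_ideal B \<longrightarrow> iprod A B \<subseteq> P \<longrightarrow> A \<subseteq> P \<or> B \<subseteq> P)"

text \<open>Starting the fold from \<open>R\<close> leaves a trailing factor \<open>R\<close> that
  \<open>ideal_list_prod\<close> does not have; once \<open>R\<close> is pure,
  \<open>iprod_R\<close> removes it.\<close>

definition lprod :: "'a set list \<Rightarrow> 'a set" where
  "lprod As = foldr iprod As R"

definition pw :: "'a set \<Rightarrow> nat \<Rightarrow> 'a set" where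
  "pw P k = lprod (replicate k P)"

lemma is_idealD:
  assumes "is_ideal J"
  shows "J \<subseteq> R" "0 \<in> J" "x \<in> J \<Longrightarrow> y \<in> J \<Longrightarrow> x + y \<in> J" "x \<in> J \<Longrightarrow> - x \<in> J"
    "x \<in> J \<Longrightarrow> y \<in> J \<Longrightarrow> x - y \<in> J"
    "x \<in> J \<Longrightarrow> r \<in> R \<Longrightarrow> r * x \<in> J" "x \<in> J \<Longrightarrow> r \<in> R \<Longrightarrow> x * r \<in> J"
proof -
  have *: "J \<subseteq> R" "0 \<in> J" "\<And>x y. x \<in> J \<Longrightarrow> y \<in> J \<Longrightarrow> x + y \<in> J" "\<And>x. x \<in> J \<Longrightarrow> - x \<in> J"
    "\<And>x r. x \<in> J \<Longrightarrow> r \<in> R \<Longrightarrow> r * x \<in> J" "\<And>x r. x \<in> J \<Longrightarrow> r \<in> R \<Longrightarrow> x * r \<in> J"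
    using assms by (simp_all add: is_ideal_def)
  show "J \<subseteq> R" "0 \<in> J" "x \<in> J \<Longrightarrow> y \<in> J \<Longrightarrow> x + y \<in> J" "x \<in> J \<Longrightarrow> - x \<in> J"
    "x \<in> J \<Longrightarrow> r \<in> R \<Longrightarrow> r * x \<in> J" "x \<in> J \<Longrightarrow> r \<in> R \<Longrightarrow> x * r \<in> J"
    by (fact *)+
  show "x - y \<in> J" if "x \<in> J" "y \<in> J"
    using *(3)[OF that(1) *(4)[OF that(2)]] by simp
qed

lemma is_ideal_R: "is_ideal R"
  by (auto simp: is_ideal_def R_zero R_add R_uminus R_mult)

lemma is_ideal_sum: "is_ideal J \<Longrightarrow> (\<And>i. i \<in> I \<Longrightarrow> f i \<in> J) \<Longrightarrow> sum f I \<in> J"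
  by (induction I rule: infinite_finite_induct) (simp_all add: is_idealD(2,3))

lemma is_ideal_iprod:
  assumes A: "is_ideal A" and B: "is_ideal B"
  shows "is_ideal (iprod A B)" "iprod A B \<subseteq> A" "iprod A B \<subseteq> B"
proof -
  have "x \<in> A \<and> x \<in> B" if "x \<in> iprod A B" for x
    using that
  proof induction
    case (prod a b)
    then show ?case using is_idealD(1,7)[OF A] is_idealD(1,6)[OF B] by blast
  next
    case (add x y)
    then show ?case using is_idealD(3)[OF A] is_idealD(3)[OF B] by blast
  qed
  then show sub: "iprod A B \<subseteq> A" "iprod A B \<subseteq> B" by auto
  have "- x \<in> iprod A B" if "x \<in> iprod A B" for x
    using that
  proof induction
    case (prod a b)
    then have "(- a) * b \<in> iprod A B" by (intro iprod.prod is_idealD(4)[OF A])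
    then show ?case by simp
  next
    case (add x y)
    then have "- x + - y \<in> iprod A B" by (intro iprod.add)
    then show ?case by (simp add: algebra_simps)
  qed
  moreover have "r * x \<in> iprod A B \<and> x * r \<in> iprod A B" if "x \<in> iprod A B" "r \<in> R" for x r
    using that
  proof induction
    case (prod a b)
    then show ?case
      using iprod.prod[of "r * a" A b B] iprod.prod[of a A "b * r" B]
        is_idealD(6)[OF A] is_idealD(7)[OF B] by (simp add: mult.assoc)
  qed (auto simp: distrib_left distrib_right iprod.add)
  moreover have "0 \<in> iprod A B"
    using iprod.prod[OF is_idealD(2)[OF A] is_idealD(2)[OF B]] by simp
  ultimately show "is_ideal (iprod A B)"
    using sub is_idealD(1)[OF A] by (simp add: is_ideal_def iprod.add subset_trans[of _ A R])
qed

lemma is_ideal_lprod: "(\<And>A. A \<in> set As \<Longrightarrow> is_ideal A) \<Longrightarrow> is_ideal (lprod As)"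
  by (induction As) (auto simp: lprod_def is_ideal_R is_ideal_iprod)

lemma lprod_Nil [simp]: "lprod [] = R"
  and lprod_Cons [simp]: "lprod (A # As) = iprod A (lprod As)"
  by (auto simp: lprod_def)

lemma is_ideal_pw: "is_ideal P \<Longrightarrow> is_ideal (pw P k)"
  unfolding pw_def by (auto intro: is_ideal_lprod)

lemma pw_0 [simp]: "pw P 0 = R"
  and pw_Suc: "pw P (Suc k) = iprod P (pw P k)"
  by (auto simp: pw_def)

lemma pure_iprod:
  assumes "pure M" "is_ideal X" "X \<subseteq> M"
  shows "iprod M X = X" "iprod X M = X"
proof -
  have M: "is_ideal M" using assms by (simp add: pure_def)
  show "iprod M X = X"
  proof
    show "X \<subseteq> iprod M X"
    proof
      fix x assume x: "x \<in> X"
      then obtain u where "u \<in> M" "u * x = x" using assms by (auto simp: pure_def)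
      then show "x \<in> iprod M X" using iprod.prod[of u M x X] x by simp
    qed
  qed (use is_ideal_iprod[OF M assms(2)] in auto)
  show "iprod X M = X"
  proof
    show "X \<subseteq> iprod X M"
    proof
      fix x assume x: "x \<in> X"
      then obtain u where "u \<in> M" "x * u = x" using assms by (auto simp: pure_def)
      then show "x \<in> iprod X M" using iprod.prod[of x X u M] x by simp
    qed
  qed (use is_ideal_iprod[OF assms(2) M] in auto)
qed

text \<open>Since \<open>X = M X\<close> and \<open>M\<close> lies in \<open>P\<close>, one more
  factor \<open>P\<close> can be inserted beside \<open>X\<close>, again and again. Both sides are
  stated because a redundant factor may stand to the left or to the right of the factor that absorbs
  it.\<close>

lemma pw_pure_subset:
  assumes "pure M" "M \<subseteq> P" "is_ideal X" "X \<subseteq> M"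
  shows "X \<subseteq> iprod (pw P k) X" "X \<subseteq> iprod X (pw P k)"
proof -
  have R: "X \<subseteq> iprod R X \<and> X \<subseteq> iprod X R"
  proof -
    have "M \<subseteq> R" using assms by (simp add: pure_def is_idealD)
    then have "iprod M X \<subseteq> iprod R X" "iprod X M \<subseteq> iprod X R"
      by (simp_all add: iprod_mono)
    then show ?thesis using pure_iprod[OF assms(1,3,4)] by simp
  qed
  show "X \<subseteq> iprod (pw P k) X"
  proof (induction k)
    case (Suc k)
    have "X \<subseteq> iprod M X" using pure_iprod[OF assms(1,3,4)] by simp
    also have "\<dots> \<subseteq> iprod P (iprod (pw P k) X)" using assms(2) Suc by (rule iprod_mono)
    finally show ?case by (simp add: pw_Suc iprod_assoc)
  qed (use R in simp)
  show "X \<subseteq> iprod X (pw P k)"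
  proof (induction k)
    case (Suc k)
    have "X \<subseteq> iprod X (pw P k)" by fact
    also have "\<dots> = iprod (iprod X M) (pw P k)" using pure_iprod[OF assms(1,3,4)] by simp
    also have "\<dots> \<subseteq> iprod (iprod X P) (pw P k)" using assms(2) by (intro iprod_mono) auto
    finally show ?case by (simp add: pw_Suc iprod_assoc)
  qed (use R in simp)
qed

definition prime_rep :: "'a set \<Rightarrow> nat \<Rightarrow> (nat \<Rightarrow> 'a set) \<Rightarrow> (nat \<Rightarrow> nat) \<Rightarrow> bool" where
  "prime_rep I m P r \<longleftrightarrow> (\<forall>i\<in>{1..m}. is_prime (P i) \<and> r i \<ge> 1) \<and> inj_on P {1..m} \<and>
     (let As = map (\<lambda>i. pw (P i) (r i)) [1..<Suc m]
      in I = lprod As \<and> distinct As \<and>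
         (\<forall>Bs. Bs \<noteq> [] \<longrightarrow> distinct Bs \<longrightarrow> set Bs \<subset> set As \<longrightarrow> lprod Bs \<noteq> lprod As))"

lemma is_primeD: "is_prime P \<Longrightarrow> is_ideal P" "is_prime P \<Longrightarrow> P \<noteq> R"
  "is_prime P \<Longrightarrow> is_ideal A \<Longrightarrow> is_ideal B \<Longrightarrow> iprod A B \<subseteq> P \<Longrightarrow> A \<subseteq> P \<or> B \<subseteq> P"
  by (auto simp: is_prime_def)

lemma is_prime_lprod:
  assumes "is_prime P" "\<And>A. A \<in> set As \<Longrightarrow> is_ideal A" "lprod As \<subseteq> P"
  shows "\<exists>A\<in>set As. A \<subseteq> P"
  using assms(2,3)
proof (induction As)
  case Nil
  \<comment> \<open>The empty product is \<open>R\<close>, and a prime is proper.\<close>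
  then show ?case using is_primeD(1,2)[OF assms(1)] is_idealD(1)[of P] by auto
next
  case (Cons A As)
  then have "A \<subseteq> P \<or> lprod As \<subseteq> P"
    using is_primeD(3)[OF assms(1), of A "lprod As"] is_ideal_lprod[of As] by auto
  then show ?case using Cons by auto
qed

lemma is_prime_pw:
  assumes "is_prime P" "is_ideal Q" "pw Q k \<subseteq> P"
  shows "Q \<subseteq> P"
  using is_prime_lprod[of P "replicate k Q"] assms by (auto simp: pw_def)

lemma lprod_subset:
  assumes "\<And>A. A \<in> set As \<Longrightarrow> is_ideal A" "A \<in> set As"
  shows "lprod As \<subseteq> A"
  using assms
proof (induction As)
  case (Cons B As)
  have *: "is_ideal B" "is_ideal (lprod As)" using Cons.prems by (auto intro: is_ideal_lprod)
  show ?case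
    using is_ideal_iprod(2,3)[OF *] Cons by fastforce
qed simp

lemma pw_subset: "is_ideal P \<Longrightarrow> k \<ge> 1 \<Longrightarrow> pw P k \<subseteq> P"
  unfolding pw_def by (rule lprod_subset) auto

lemma pw_antimono:
  assumes "is_ideal P" "k \<le> l"
  shows "pw P l \<subseteq> pw P k"
  using assms(2)
proof (induction l rule: dec_induct)
  case (step n)
  have "pw P (Suc n) \<subseteq> pw P n"
    using is_ideal_iprod(3)[OF assms(1) is_ideal_pw[OF assms(1)]] by (simp add: pw_Suc)
  then show ?case using step by simp
qed simp

text \<open>The item about \<open>Q\<close> links two representations: a prime above
  \<open>I\<close> contains one of the factors, and primeness strips its exponent.\<close>

lemma prime_repD:
  assumes "prime_rep I m P r"
  shows "i \<in> {1..m} \<Longrightarrow> is_prime (P i)" "i \<in> {1..m} \<Longrightarrow> is_ideal (P i)" "i \<in> {1..m} \<Longrightarrow> r i \<ge> 1" 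
    "inj_on P {1..m}" "I = lprod (map (\<lambda>i. pw (P i) (r i)) [1..<Suc m])"
    "is_prime Q \<Longrightarrow> I \<subseteq> Q \<Longrightarrow> \<exists>i\<in>{1..m}. P i \<subseteq> Q"
    "i \<in> {1..m} \<Longrightarrow> I \<subseteq> pw (P i) (r i)"
    "i \<in> {1..m} \<Longrightarrow> I \<subseteq> P i"
proof -
  let ?As = "map (\<lambda>i. pw (P i) (r i)) [1..<Suc m]"
  show is_prime: "is_prime (P i)" and r: "r i \<ge> 1" and is_ideal: "is_ideal (P i)" if "i \<in> {1..m}" for i
    using that assms is_primeD(1) by (auto simp: prime_rep_def)
  show "inj_on P {1..m}" and I: "I = lprod ?As"
    using assms by (auto simp: prime_rep_def Let_def)
  have *: "is_ideal A" if "A \<in> set ?As" for A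
    using that is_ideal is_ideal_pw by auto
  show "\<exists>i\<in>{1..m}. P i \<subseteq> Q" if "is_prime Q" "I \<subseteq> Q"
  proof -
    obtain A where "A \<in> set ?As" "A \<subseteq> Q"
      using is_prime_lprod[OF \<open>is_prime Q\<close> *] \<open>I \<subseteq> Q\<close> I by blast
    moreover from this obtain i where "i \<in> set [1..<Suc m]" "A = pw (P i) (r i)"
      unfolding set_map by blast
    ultimately have i: "i \<in> {1..m}" "pw (P i) (r i) \<subseteq> Q" by auto
    then show ?thesis using is_prime_pw[OF \<open>is_prime Q\<close> is_ideal] by blast
  qed
  show 1: "I \<subseteq> pw (P i) (r i)" if "i \<in> {1..m}" for i
  proof -
    have "i \<in> set [1..<Suc m]" using that by auto
    then have "pw (P i) (r i) \<in> set ?As" unfolding set_map by (rule imageI)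
    then show ?thesis unfolding I by (intro lprod_subset[OF *])
  qed
  show "I \<subseteq> P i" if "i \<in> {1..m}" 
    using 1[OF that] pw_subset[OF is_ideal[OF that] r[OF that]] by blast
qed

end

text \<open>The assumption \<open>minimal_over_prime\<close> says that either a prime is pure or there is a pure ideal
  whose image modulo the prime is the least nonzero ideal.\<close>

locale pure_ideals_in = ideals_in +
  assumes R_pure: "pure R"
    and minimal_over_prime:
      "is_prime P \<Longrightarrow> \<exists>M. pure M \<and> P \<subseteq> M \<and> (\<forall>A. is_ideal A \<longrightarrow> P \<subset> A \<longrightarrow> M \<subseteq> A)"
begin

lemma iprod_R: "is_ideal X \<Longrightarrow> iprod R X = X" "is_ideal X \<Longrightarrow> iprod X R = X"
  using pure_iprod[OF R_pure] is_idealD(1) by auto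

text \<open>The trailing \<open>R\<close> of the first product meets the second product and is
  absorbed, because \<open>R\<close> is pure.\<close>

lemma lprod_append:
  "(\<And>A. A \<in> set Bs \<Longrightarrow> is_ideal A) \<Longrightarrow> lprod (As @ Bs) = iprod (lprod As) (lprod Bs)"
  by (induction As) (auto simp: iprod_assoc iprod_R is_ideal_lprod)

lemma is_ideal_plus:
  assumes "is_ideal A" "is_ideal B"
  shows "is_ideal {a + b | a b. a \<in> A \<and> b \<in> B}" (is "is_ideal ?S")
proof -
  have "?S \<subseteq> R" using assms is_idealD(1) R_add by blast
  moreover have "0 \<in> ?S" using assms is_idealD(2) by (auto intro!: exI[of _ 0])
  moreover have "x + y \<in> ?S" if "x \<in> ?S" "y \<in> ?S" for x y
  proof -
    from that obtain a b a' b' where "x = a + b" "y = a' + b'" "a \<in> A" "a' \<in> A" "b \<in> B" "b' \<in> B"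
      by auto
    then have "x + y = (a + a') + (b + b')" "a + a' \<in> A" "b + b' \<in> B"
      using is_idealD(3) assms by auto
    then show ?thesis by blast
  qed
  moreover have "- x \<in> ?S" if "x \<in> ?S" for x
  proof -
    from that obtain a b where "x = a + b" "a \<in> A" "b \<in> B" by auto
    then have "- x = - a + - b" "- a \<in> A" "- b \<in> B" using is_idealD(4) assms by auto
    then show ?thesis by blast
  qed
  moreover have "r * x \<in> ?S \<and> x * r \<in> ?S" if "x \<in> ?S" "r \<in> R" for x r
  proof -
    from that obtain a b where "x = a + b" "a \<in> A" "b \<in> B" by auto
    moreover from this have "r * a \<in> A" "r * b \<in> B" "a * r \<in> A" "b * r \<in> B"
      using is_idealD(6,7) assms \<open>r \<in> R\<close> by auto
    ultimately show ?thesis by (auto simp: distrib_left distrib_right)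
  qed
  ultimately show ?thesis by (simp add: is_ideal_def)
qed

section \<open>Uniqueness of irredundant products of prime powers\<close>

lemma prime_rep_incomparable:
  assumes rep: "prime_rep I m P r" and i: "i \<in> {1..m}" and j: "j \<in> {1..m}" and le: "P i \<subseteq> P j"
  shows "i = j"
proof (rule ccontr)
  assume ij: "i \<noteq> j"
  let ?f = "\<lambda>i. pw (P i) (r i)"
  let ?As = "map ?f [1..<Suc m]"
  note D = prime_repD[OF rep]
  have "P i \<noteq> P j" using inj_onD[OF D(4) _ i j] ij by blast
  then have "P i \<subset> P j" using le by blast
  moreover obtain M where M: "pure M" "P i \<subseteq> M" "\<forall>A. is_ideal A \<longrightarrow> P i \<subset> A \<longrightarrow> M \<subseteq> A"
    using minimal_over_prime[OF D(1)[OF i]] by (elim exE conjE)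
  \<comment> \<open>\<open>P j\<close> is itself one of the ideals strictly above
    \<open>P i\<close>, so \<open>M\<close> is squeezed between the two primes.\<close>
  ultimately have "M \<subseteq> P j" using D(2)[OF j] by simp
  note M = M(1,2) this
  have "j \<in> set [1..<Suc m]" using j by auto
  then obtain us ws where split: "[1..<Suc m] = us @ j # ws" by (meson split_list)
  let ?Xs = "map ?f us" and ?Ys = "map ?f ws"
  have mem: "set us \<subseteq> {1..m}" "set ws \<subseteq> {1..m}"
  proof -
    have "set (us @ j # ws) = {1..m}" using split[symmetric] by auto
    then show "set us \<subseteq> {1..m}" "set ws \<subseteq> {1..m}" by auto
  qed
  have iuw: "i \<in> set us \<or> i \<in> set ws"
  proof -
    have "i \<in> set (us @ j # ws)" using i split[symmetric] by auto
    then show ?thesis using ij by auto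
  qed
  have idlX: "is_ideal A" if "A \<in> set ?Xs" for A using that D(2) mem is_ideal_pw by auto
  have idlY: "is_ideal A" if "A \<in> set ?Ys" for A using that D(2) mem is_ideal_pw by auto
  have X: "is_ideal (lprod ?Xs)" and Y: "is_ideal (lprod ?Ys)" by (rule is_ideal_lprod[OF idlX] is_ideal_lprod[OF idlY], assumption)+
  have fj: "is_ideal (?f j)" using D(2)[OF j] is_ideal_pw by auto
  have As: "?As = ?Xs @ ?f j # ?Ys" using split by simp
  have pAs: "lprod ?As = iprod (lprod ?Xs) (iprod (?f j) (lprod ?Ys))"
  proof -
    have "is_ideal A" if "A \<in> set (?f j # ?Ys)" for A using set_ConsD[OF that] idlY fj by blast
    from lprod_append[of "?f j # ?Ys" ?Xs, OF this] show ?thesis unfolding As lprod_Cons .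
  qed
  have pBs: "lprod (?Xs @ ?Ys) = iprod (lprod ?Xs) (lprod ?Ys)"
    by (rule lprod_append[OF idlY])
  have fi: "?f i \<subseteq> M" using pw_subset[OF D(2)[OF i] D(3)[OF i]] M(2) by blast
  \<comment> \<open>The block containing the factor for \<open>i\<close> lies inside
    \<open>M\<close>, so it can take back the missing factor for \<open>j\<close>. The cases tell on
    which side of \<open>j\<close> this block stands.\<close>
  have "lprod (?Xs @ ?Ys) \<subseteq> lprod ?As"
  proof (cases "i \<in> set us")
    case True
    then have "?f i \<in> set ?Xs" unfolding set_map by (rule imageI)
    then have "lprod ?Xs \<subseteq> ?f i" using lprod_subset[OF idlX] by blast
    then have "lprod ?Xs \<subseteq> iprod (lprod ?Xs) (?f j)"
      using pw_pure_subset(2)[OF M(1,3) X] fi by auto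
    then have "iprod (lprod ?Xs) (lprod ?Ys) \<subseteq> iprod (iprod (lprod ?Xs) (?f j)) (lprod ?Ys)"
      by (intro iprod_mono) auto
    then show ?thesis unfolding pAs pBs by (simp add: iprod_assoc)
  next
    case False
    then have "i \<in> set ws" using iuw by auto
    then have "?f i \<in> set ?Ys" unfolding set_map by (rule imageI)
    then have "lprod ?Ys \<subseteq> ?f i" using lprod_subset[OF idlY] by blast
    then have "lprod ?Ys \<subseteq> iprod (?f j) (lprod ?Ys)"
      using pw_pure_subset(1)[OF M(1,3) Y] fi by auto
    then show ?thesis unfolding pAs pBs by (intro iprod_mono) auto
  qed
  moreover have "lprod ?As \<subseteq> lprod (?Xs @ ?Ys)"
    unfolding pAs pBs using is_ideal_iprod(3)[OF fj Y] by (intro iprod_mono) auto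
  ultimately have eq: "lprod (?Xs @ ?Ys) = lprod ?As" by auto
  have dist: "distinct ?As" and
    irr: "\<And>Bs. Bs \<noteq> [] \<Longrightarrow> distinct Bs \<Longrightarrow> set Bs \<subset> set ?As \<Longrightarrow> lprod Bs \<noteq> lprod ?As"
    using rep by (auto simp: prime_rep_def Let_def)
  have "?f j \<notin> set (?Xs @ ?Ys)" "distinct (?Xs @ ?Ys)" using dist unfolding As by auto
  moreover have "set ?As = insert (?f j) (set (?Xs @ ?Ys))" unfolding As by auto
  \<comment> \<open>Irredundance speaks of nonempty subproducts; the factor for \<open>i\<close>
    keeps this one nonempty.\<close>
  moreover have "?Xs @ ?Ys \<noteq> []" using iuw by auto
  ultimately show False using irr[of "?Xs @ ?Ys"] eq by blast
qed

lemma pw_stable: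
  assumes P: "is_prime P" and A: "is_ideal A" "\<not> A \<subseteq> P" and B: "is_ideal B" "\<not> B \<subseteq> P"
    and sub: "iprod A (iprod (pw P k) B) \<subseteq> pw P (Suc k)" and "k \<ge> 1"
  shows "pw P k \<subseteq> pw P (Suc k)"
proof -
  note P' = is_primeD(1)[OF P]
  obtain M where M: "pure M" "P \<subseteq> M" "\<forall>A. is_ideal A \<longrightarrow> P \<subset> A \<longrightarrow> M \<subseteq> A"
    using minimal_over_prime[OF P] by (elim exE conjE)
  \<comment> \<open>\<open>C + P\<close> is an ideal strictly above \<open>P\<close>, so it contains
    the cover \<open>M\<close>.\<close>
  have *: "M \<subseteq> {a + b | a b. a \<in> C \<and> b \<in> P}" if C: "is_ideal C" "\<not> C \<subseteq> P" for C
  proof (rule M(3)[rule_format, OF is_ideal_plus[OF C(1) P']])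
    have "P \<subseteq> {a + b | a b. a \<in> C \<and> b \<in> P}" using is_idealD(2)[OF C(1)] by force
    moreover have "C \<subseteq> {a + b | a b. a \<in> C \<and> b \<in> P}" using is_idealD(2)[OF P'] by force
    ultimately show "P \<subset> {a + b | a b. a \<in> C \<and> b \<in> P}" using C(2) by blast
  qed
  let ?K = "pw P k" and ?S = "pw P (Suc k)"
  have K: "is_ideal ?K" "is_ideal ?S" using is_ideal_pw P' by auto
  have PK: "p * x \<in> ?S" if "p \<in> P" "x \<in> ?K" for p x
    using that by (simp add: pw_Suc iprod.prod)
  have comm: "iprod (pw P l) P = pw P (Suc l)" for l
  proof (induction l)
    case 0
    then show ?case by (simp add: iprod_R P' pw_Suc)
  next
    case (Suc l)
    then show ?case by (metis pw_Suc iprod_assoc)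
  qed
  have KP: "x * p \<in> ?S" if "p \<in> P" "x \<in> ?K" for p x
    using that comm[of k] iprod.prod[of x ?K p P] by simp
  \<comment> \<open>The hypothesis on \<open>A\<close> and \<open>B\<close> handles
    \<open>a * x * b\<close>; every other term has a factor from \<open>P\<close> next to
    \<open>x\<close>.\<close>
  have key: "u * x * v \<in> ?S" if "u \<in> M" "x \<in> ?K" "v \<in> M" for u x v
  proof -
    obtain a p where u: "u = a + p" "a \<in> A" "p \<in> P" using *[OF A] \<open>u \<in> M\<close> by blast
    obtain b p' where v: "v = b + p'" "b \<in> B" "p' \<in> P" using *[OF B] \<open>v \<in> M\<close> by blast
    have R: "a \<in> R" "b \<in> R" "p \<in> R" "p' \<in> R" using u v A B P' is_idealD(1) by blast+
    have "a * (x * b) \<in> ?S" using sub u v that by (blast intro: iprod.prod)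
    moreover have "a * (x * p') \<in> ?S" using KP[OF v(3) that(2)] R is_idealD(6)[OF K(2)] by blast
    moreover have "p * x * v \<in> ?S" using PK[OF u(3) that(2)] R v is_idealD(7)[OF K(2)] R_add by blast
    moreover have "u * x * v = a * (x * b) + a * (x * p') + p * x * v"
      unfolding u v by (simp add: algebra_simps)
    ultimately show ?thesis using is_idealD(3)[OF K(2)] by metis
  qed
  show ?thesis
  proof
    fix x assume x: "x \<in> ?K"
    \<comment> \<open>\<open>k \<ge> 1\<close> puts the power inside \<open>P\<close>, hence inside
      \<open>M\<close>, so \<open>x\<close> has local units in \<open>M\<close>.\<close>
    then have "x \<in> M" using pw_subset[OF P' \<open>k \<ge> 1\<close>] M(2) by blast
    then obtain u v where "u \<in> M" "v \<in> M" "u * x = x" "x * v = x" using M(1) by (auto simp: pure_def)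
    then show "x \<in> ?S" using key[of u x v] x by simp
  qed
qed

text \<open>When \<open>s j\<close> exceeds \<open>r i\<close>, the factors on either side of
  \<open>P i\<close> in the first product form two ideals outside \<open>P i\<close>, while
  \<open>I\<close> lies in the next power of \<open>P i\<close>. Then \<open>pw_stable\<close> makes
  the powers of \<open>P i\<close> constant from \<open>r i\<close> on.\<close>

lemma prime_rep_exponent_le:
  assumes repP: "prime_rep I m P r" and repQ: "prime_rep I n Q s"
    and i: "i \<in> {1..m}" and j: "j \<in> {1..n}" and eq: "P i = Q j"
  shows "pw (P i) (r i) \<subseteq> pw (Q j) (s j)"
proof (cases "s j \<le> r i")
  case True
  then show ?thesis using pw_antimono[OF prime_repD(2)[OF repP i]] eq by simp
next
  case False
  let ?f = "\<lambda>i. pw (P i) (r i)"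
  note D = prime_repD[OF repP]
  have "i \<in> set [1..<Suc m]" using i by auto
  then obtain us ws where split: "[1..<Suc m] = us @ i # ws" by (meson split_list)
  let ?Xs = "map ?f us" and ?Ys = "map ?f ws"
  have mem: "set us \<subseteq> {1..m} - {i}" "set ws \<subseteq> {1..m} - {i}"
  proof -
    have "set (us @ i # ws) = {1..m}" "distinct (us @ i # ws)" 
      using split[symmetric] by auto
    then show "set us \<subseteq> {1..m} - {i}" "set ws \<subseteq> {1..m} - {i}" by auto
  qed
  have is_ideal: "is_ideal A" if "A \<in> set (map ?f us') " "set us' \<subseteq> {1..m} - {i}" for A us'
    using that D(2) is_ideal_pw by auto
  \<comment> \<open>By incomparability no other factor lies in \<open>P i\<close>. A block may be
    empty; its product is then \<open>R\<close>, which is not inside a prime either.\<close>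
  have notin: "\<not> lprod (map ?f us') \<subseteq> P i" if us': "set us' \<subseteq> {1..m} - {i}" for us'
  proof
    assume "lprod (map ?f us') \<subseteq> P i"
    then obtain A where "A \<in> set (map ?f us')" "A \<subseteq> P i"
      using is_prime_lprod[OF D(1)[OF i] is_ideal[OF _ us']] by blast
    then obtain l where l: "l \<in> set us'" "?f l \<subseteq> P i" by auto
    then have "l \<in> {1..m}" "l \<noteq> i" using us' by auto
    then show False
      using is_prime_pw[OF D(1)[OF i] D(2) l(2)] prime_rep_incomparable[OF repP] i by blast
  qed
  have fi: "is_ideal (?f i)" using D(2)[OF i] is_ideal_pw by auto
  have "I = lprod (?Xs @ ?f i # ?Ys)" using D(5) split by simp
  also have "\<dots> = iprod (lprod ?Xs) (iprod (?f i) (lprod ?Ys))"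
    using lprod_append[of "?f i # ?Ys" ?Xs] is_ideal[OF _ mem(2)] fi by auto
  finally have "iprod (lprod ?Xs) (iprod (?f i) (lprod ?Ys)) = I" by simp
  also have "I \<subseteq> pw (P i) (s j)" using prime_repD(7)[OF repQ j] eq by simp
  also have "\<dots> \<subseteq> pw (P i) (Suc (r i))" using False D(2)[OF i] by (intro pw_antimono) auto
  finally have "pw (P i) (r i) \<subseteq> pw (P i) (Suc (r i))"
    using D(1,3)[OF i] notin[OF mem(1)] notin[OF mem(2)]
    by (intro pw_stable[of "P i" "lprod ?Xs" "lprod ?Ys"] is_ideal_lprod is_ideal[OF _ mem(1)] is_ideal[OF _ mem(2)])
  then have stable: "pw (P i) (r i) = pw (P i) (Suc (r i))"
    using pw_antimono[OF D(2)[OF i], of "r i" "Suc (r i)"] by auto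
  have "pw (P i) (r i + k) = pw (P i) (r i)" for k
  proof (induction k)
    case (Suc k)
    have "pw (P i) (r i + Suc k) = iprod (P i) (pw (P i) (r i + k))" by (simp add: pw_Suc)
    also have "\<dots> = pw (P i) (Suc (r i))" using Suc by (simp add: pw_Suc)
    finally show ?case using stable by simp
  qed simp
  from this[of "s j - r i"] show ?thesis using False eq by simp
qed

text \<open>Passing back and forth gives \<open>P l\<close> inside \<open>Q j\<close> inside
  \<open>P i\<close>; incomparability forces \<open>l = i\<close>, and the sandwich
  collapses.\<close>

lemma prime_rep_primes_subset:
  assumes repP: "prime_rep I m P r" and repQ: "prime_rep I n Q s" and i: "i \<in> {1..m}"
  shows "\<exists>j\<in>{1..n}. P i = Q j"
proof -
  obtain j where j: "j \<in> {1..n}" "Q j \<subseteq> P i"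
    using prime_repD(6)[OF repQ prime_repD(1)[OF repP i] prime_repD(8)[OF repP i]] by blast
  obtain l where l: "l \<in> {1..m}" "P l \<subseteq> Q j"
    using prime_repD(6)[OF repP prime_repD(1)[OF repQ j(1)] prime_repD(8)[OF repQ j(1)]] by blast
  have "l = i" using prime_rep_incomparable[OF repP l(1) i] l j by blast
  then show ?thesis using l j by blast
qed

theorem prime_rep_unique:
  assumes repP: "prime_rep I m P r" and repQ: "prime_rep I n Q s"
  shows "m = n \<and> (\<lambda>i. pw (P i) (r i)) ` {1..m} = (\<lambda>j. pw (Q j) (s j)) ` {1..n}"
proof
  \<comment> \<open>The count is taken on the primes, where the indexing is injective; the powers
    are matched afterwards.\<close>
  have "P ` {1..m} = Q ` {1..n}"
    using prime_rep_primes_subset[OF repP repQ] prime_rep_primes_subset[OF repQ repP]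
    by (force simp: image_iff)
  then have "card (P ` {1..m}) = card (Q ` {1..n})" by simp
  then show "m = n" using prime_repD(4)[OF repP] prime_repD(4)[OF repQ] by (simp add: card_image)
  have *: "(\<lambda>i. pw (P i) (r i)) ` {1..m} \<subseteq> (\<lambda>j. pw (Q j) (s j)) ` {1..n}"
    if repP: "prime_rep I m P r" and repQ: "prime_rep I n Q s" for P Q r s m n
  proof
    fix A assume "A \<in> (\<lambda>i. pw (P i) (r i)) ` {1..m}"
    then obtain i where i: "i \<in> {1..m}" "A = pw (P i) (r i)" by auto
    obtain j where j: "j \<in> {1..n}" "P i = Q j"
      using prime_rep_primes_subset[OF repP repQ i(1)] by blast
    have "pw (P i) (r i) = pw (Q j) (s j)"
      using prime_rep_exponent_le[OF repP repQ i(1) j] prime_rep_exponent_le[OF repQ repP j(1) i(1)] j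
      by simp
    then show "A \<in> (\<lambda>j. pw (Q j) (s j)) ` {1..n}" using i j by auto
  qed
  show "(\<lambda>i. pw (P i) (r i)) ` {1..m} = (\<lambda>j. pw (Q j) (s j)) ` {1..n}"
    using *[OF repP repQ] *[OF repQ repP] by auto
qed

end

section \<open>Transport along an injective ring homomorphism\<close>

text \<open>The ring laws of \<open>L\<close> are pulled back from \<open>R\<close> through the
  injective \<open>h\<close>; the record itself only supplies closure and the homomorphism
  equations.\<close>

locale ring_image = ideals_in R for R :: "'a::ring set" +
  fixes L :: "('c, 'd) ring_scheme" (structure) and h :: "'c \<Rightarrow> 'a"
  assumes inj: "inj_on h (carrier L)"
    and image: "h ` carrier L = R"
    and zero: "\<zero> \<in> carrier L" "h \<zero> = 0"
    and add: "x \<in> carrier L \<Longrightarrow> y \<in> carrier L \<Longrightarrow> x \<oplus> y \<in> carrier L"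
      "x \<in> carrier L \<Longrightarrow> y \<in> carrier L \<Longrightarrow> h (x \<oplus> y) = h x + h y"
    and mult: "x \<in> carrier L \<Longrightarrow> y \<in> carrier L \<Longrightarrow> x \<otimes> y \<in> carrier L"
      "x \<in> carrier L \<Longrightarrow> y \<in> carrier L \<Longrightarrow> h (x \<otimes> y) = h x * h y"
begin

lemma h_in_R: "x \<in> carrier L \<Longrightarrow> h x \<in> R"
  using image by blast

lemma h_cancel: "x \<in> carrier L \<Longrightarrow> y \<in> carrier L \<Longrightarrow> h x = h y \<Longrightarrow> x = y"
  using inj by (rule inj_onD)

lemma h_obtain:
  assumes "r \<in> R" obtains x where "x \<in> carrier L" "h x = r"
  using assms image by blast

lemma opposite:
  assumes "x \<in> carrier L"
  obtains y where "y \<in> carrier L" "h y = - h x" "y \<oplus> x = \<zero>"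
proof -
  obtain y where y: "y \<in> carrier L" "h y = - h x"
    using h_obtain R_uminus h_in_R[OF assms] by metis
  then have "y \<oplus> x = \<zero>" using assms by (intro h_cancel) (auto simp: add zero)
  then show thesis using that y by blast
qed

lemma group_add: "group (add_monoid L)"
proof (rule groupI)
  fix x assume x: "x \<in> carrier (add_monoid L)"
  then obtain y where "y \<in> carrier L" "h y = - h x" "y \<oplus> x = \<zero>" by (auto elim: opposite)
  then show "\<exists>y\<in>carrier (add_monoid L). y \<otimes>\<^bsub>add_monoid L\<^esub> x = \<one>\<^bsub>add_monoid L\<^esub>" by auto
qed (auto intro!: h_cancel simp: add zero)

text \<open>\<open>two_sided_ideal\<close> refers to inverses in the additive group of the record,
  which have to be matched with the minus of the ring type.\<close>

lemma h_inv:
  assumes "x \<in> carrier L"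
  shows "inv\<^bsub>add_monoid L\<^esub> x \<in> carrier L" "h (inv\<^bsub>add_monoid L\<^esub> x) = - h x"
proof -
  obtain y where y: "y \<in> carrier L" "h y = - h x" "y \<oplus> x = \<zero>" using assms by (rule opposite)
  then have "inv\<^bsub>add_monoid L\<^esub> x = y"
    using group.inv_equality[OF group_add, of y x] assms by simp
  then show "inv\<^bsub>add_monoid L\<^esub> x \<in> carrier L" "h (inv\<^bsub>add_monoid L\<^esub> x) = - h x" using y by auto
qed

lemma two_sided_idealD:
  assumes "two_sided_ideal J L"
  shows "J \<subseteq> carrier L" "\<zero> \<in> J" "x \<in> J \<Longrightarrow> y \<in> J \<Longrightarrow> x \<oplus> y \<in> J"
    "x \<in> J \<Longrightarrow> inv\<^bsub>add_monoid L\<^esub> x \<in> J"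
    "x \<in> J \<Longrightarrow> r \<in> carrier L \<Longrightarrow> r \<otimes> x \<in> J" "x \<in> J \<Longrightarrow> r \<in> carrier L \<Longrightarrow> x \<otimes> r \<in> J"
proof -
  have J: "subgroup J (add_monoid L)"
    using assms by (simp add: two_sided_ideal_def additive_subgroup_def)
  show "J \<subseteq> carrier L" "\<zero> \<in> J" "x \<in> J \<Longrightarrow> y \<in> J \<Longrightarrow> x \<oplus> y \<in> J"
    "x \<in> J \<Longrightarrow> inv\<^bsub>add_monoid L\<^esub> x \<in> J"
    using subgroup.subset[OF J] subgroup.one_closed[OF J] subgroup.m_closed[OF J]
      subgroup.m_inv_closed[OF J] by auto
  show "x \<in> J \<Longrightarrow> r \<in> carrier L \<Longrightarrow> r \<otimes> x \<in> J" "x \<in> J \<Longrightarrow> r \<in> carrier L \<Longrightarrow> x \<otimes> r \<in> J"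
    using assms by (auto simp: two_sided_ideal_def)
qed

lemma is_ideal_image:
  assumes "two_sided_ideal J L"
  shows "is_ideal (h ` J)"
proof -
  note J = two_sided_idealD[OF assms]
  have c: "x \<in> carrier L" if "x \<in> J" for x using J(1) that by blast
  show ?thesis
    unfolding is_ideal_def
  proof (intro conjI ballI)
    show "h ` J \<subseteq> R" using c h_in_R by blast
    show "0 \<in> h ` J" using J(2) zero(2) by (intro image_eqI[of _ _ \<zero>]) auto
    fix a assume "a \<in> h ` J"
    then obtain x where x: "x \<in> J" "a = h x" by blast
    show "- a \<in> h ` J"
      using J(4)[OF x(1)] h_inv(2)[OF c[OF x(1)]] x(2) by (metis imageI)
    show "a + b \<in> h ` J" if "b \<in> h ` J" for b
    proof -
      from that obtain y where y: "y \<in> J" "b = h y" by blast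
      then show ?thesis using add(2)[OF c[OF x(1)] c[OF y(1)]] J(3)[OF x(1) y(1)] x(2) by (metis imageI)
    qed
    fix r assume "r \<in> R"
    then obtain s where s: "s \<in> carrier L" "h s = r" by (rule h_obtain)
    show "r * a \<in> h ` J"
      using mult(2)[OF s(1) c[OF x(1)]] J(5)[OF x(1) s(1)] x(2) s(2) by (metis imageI)
    show "a * r \<in> h ` J"
      using mult(2)[OF c[OF x(1)] s(1)] J(6)[OF x(1) s(1)] x(2) s(2) by (metis imageI)
  qed
qed

definition preimage :: "'a set \<Rightarrow> 'c set" where
  "preimage A = {x \<in> carrier L. h x \<in> A}"

lemma image_preimage: "A \<subseteq> R \<Longrightarrow> h ` preimage A = A"
  using image by (auto simp: preimage_def)

lemma preimage_image: "A \<subseteq> carrier L \<Longrightarrow> preimage (h ` A) = A"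
  using h_cancel by (auto simp: preimage_def)

lemma image_cancel:
  assumes "A \<subseteq> carrier L" "B \<subseteq> carrier L" "h ` A = h ` B"
  shows "A = B"
proof -
  have "preimage (h ` A) = preimage (h ` B)" using assms(3) by (rule arg_cong)
  then show ?thesis unfolding preimage_image[OF assms(1)] preimage_image[OF assms(2)] .
qed

lemma two_sided_ideal_preimage:
  assumes "is_ideal A"
  shows "two_sided_ideal (preimage A) L"
proof -
  have "subgroup (preimage A) (add_monoid L)"
  proof (rule group.subgroupI[OF group_add])
    show "preimage A \<subseteq> carrier (add_monoid L)" by (auto simp: preimage_def)
    show "preimage A \<noteq> {}" using zero is_idealD(2)[OF assms] by (auto simp: preimage_def)
    show "inv\<^bsub>add_monoid L\<^esub> a \<in> preimage A" if "a \<in> preimage A" for a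
      using that h_inv[of a] is_idealD(4)[OF assms] by (auto simp: preimage_def)
    show "a \<otimes>\<^bsub>add_monoid L\<^esub> b \<in> preimage A" if "a \<in> preimage A" "b \<in> preimage A" for a b
      using that add is_idealD(3)[OF assms] by (auto simp: preimage_def)
  qed
  then show ?thesis
    using mult h_in_R is_idealD(6,7)[OF assms]
    by (auto simp: two_sided_ideal_def additive_subgroup_def preimage_def)
qed

lemma image_ideal_prod:
  assumes "A \<subseteq> carrier L" "B \<subseteq> carrier L"
  shows "ideal_prod L A B \<subseteq> carrier L" "h ` ideal_prod L A B = iprod (h ` A) (h ` B)"
proof -
  have *: "x \<in> carrier L \<and> h x \<in> iprod (h ` A) (h ` B)" if "x \<in> ideal_prod L A B" for x
    using that
  proof induction
    case (prod a b)
    then have "a \<in> carrier L" "b \<in> carrier L" using assms by auto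
    then show ?case using prod mult by (auto intro: iprod.prod)
  next
    case (sum x y)
    then show ?case using add by (auto intro: iprod.add)
  qed
  then show "ideal_prod L A B \<subseteq> carrier L" by blast
  show "h ` ideal_prod L A B = iprod (h ` A) (h ` B)"
  proof
    show "h ` ideal_prod L A B \<subseteq> iprod (h ` A) (h ` B)" using * by blast
    show "iprod (h ` A) (h ` B) \<subseteq> h ` ideal_prod L A B"
    proof
      fix z assume "z \<in> iprod (h ` A) (h ` B)"
      then show "z \<in> h ` ideal_prod L A B"
      proof induction
        case (prod a' b')
        then obtain a b where ab: "a \<in> A" "b \<in> B" "a' = h a" "b' = h b" by blast
        then have "h (a \<otimes> b) = a' * b'" using assms mult(2) by blast
        then show ?case using ideal_prod.prod[OF ab(1,2)] by (metis imageI)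
      next
        case (add x' y')
        then obtain x y where xy: "x \<in> ideal_prod L A B" "y \<in> ideal_prod L A B" "x' = h x" "y' = h y"
          by blast
        then have "h (x \<oplus> y) = x' + y'" using * ring_image.add(2)[OF ring_image_axioms] by blast
        then show ?case using ideal_prod.sum[OF xy(1,2)] by (metis imageI)
      qed
    qed
  qed
qed

lemma is_prime_image:
  assumes "prime_ideal P L"
  shows "is_prime (h ` P)"
proof -
  have P: "two_sided_ideal P L" "P \<noteq> carrier L" using assms by (auto simp: prime_ideal_def)
  have sub: "P \<subseteq> carrier L" using two_sided_idealD(1)[OF P(1)] .
  have "h ` P \<noteq> R"
  proof
    assume "h ` P = R"
    then have "preimage (h ` P) = preimage (h ` carrier L)" using image by simp
    then show False using preimage_image[OF sub] preimage_image[OF subset_refl] P(2) by simp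
  qed
  moreover have "A \<subseteq> h ` P \<or> B \<subseteq> h ` P" if A: "is_ideal A" and B: "is_ideal B" and AB: "iprod A B \<subseteq> h ` P" for A B
  proof -
    have c: "preimage A \<subseteq> carrier L" "preimage B \<subseteq> carrier L" by (auto simp: preimage_def)
    have "h ` ideal_prod L (preimage A) (preimage B) \<subseteq> h ` P"
      using AB image_ideal_prod(2)[OF c] image_preimage is_idealD(1) A B by simp
    then have "ideal_prod L (preimage A) (preimage B) \<subseteq> preimage (h ` P)"
      using image_ideal_prod(1)[OF c] unfolding preimage_def by blast
    then have "ideal_prod L (preimage A) (preimage B) \<subseteq> P" using preimage_image[OF sub] by simp
    then have "preimage A \<subseteq> P \<or> preimage B \<subseteq> P"
      using assms two_sided_ideal_preimage[OF A] two_sided_ideal_preimage[OF B]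
      by (auto simp: prime_ideal_def)
    then show ?thesis
      using image_preimage[OF is_idealD(1)[OF A]] image_preimage[OF is_idealD(1)[OF B]] by blast
  qed
  ultimately show ?thesis using is_ideal_image[OF P(1)] by (auto simp: is_prime_def)
qed

end

locale pure_ring_image = ring_image + pure_ideals_in R
begin

lemma image_ideal_list_prod:
  assumes "\<And>A. A \<in> set As \<Longrightarrow> two_sided_ideal A L"
  shows "ideal_list_prod L As \<subseteq> carrier L" "h ` ideal_list_prod L As = lprod (map ((`) h) As)"
proof -
  have "ideal_list_prod L As \<subseteq> carrier L \<and> h ` ideal_list_prod L As = lprod (map ((`) h) As)"
    using assms
  proof (induction As rule: induct_list012)
    case 1
    then show ?case by (simp add: image)
  next
    case (2 A)
    \<comment> \<open>Here \<open>lprod\<close> has one factor \<open>R\<close> more than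
      \<open>ideal_list_prod\<close>; purity of \<open>R\<close> removes it.\<close>
    then show ?case using two_sided_idealD(1) is_ideal_image by (simp add: iprod_R)
  next
    case (3 A B As)
    then have "A \<subseteq> carrier L" using two_sided_idealD(1) by simp
    with 3 image_ideal_prod[of A "ideal_list_prod L (B # As)"] show ?case by simp
  qed
  then show "ideal_list_prod L As \<subseteq> carrier L" "h ` ideal_list_prod L As = lprod (map ((`) h) As)"
    by auto
qed

lemma image_ideal_power:
  assumes "two_sided_ideal P L"
  shows "ideal_power L P k \<subseteq> carrier L" "h ` ideal_power L P k = pw (h ` P) k"
  using image_ideal_list_prod[of "replicate k P"] assms by (auto simp: ideal_power_def pw_def)

lemma prime_power_repD:
  assumes "prime_power_rep L I m P r" "i \<in> {1..m}"
  shows "prime_ideal (P i) L" "two_sided_ideal (P i) L" "r i \<ge> 1"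
proof -
  have "\<forall>i\<in>{1..m}. prime_ideal (P i) L \<and> r i \<ge> 1"
    using assms(1) unfolding prime_power_rep_def by (elim conjE)
  then show "prime_ideal (P i) L" "two_sided_ideal (P i) L" "r i \<ge> 1"
    using assms(2) by (auto simp: prime_ideal_def)
qed

text \<open>A competing list \<open>Cs\<close> lives on the side of \<open>R\<close>. Its members
  are images of factors, so preimages turn it into a competing list in \<open>L\<close>.\<close>

lemma irredundant_image:
  assumes irr: "irredundant_product L As" and ideals: "\<And>A. A \<in> set As \<Longrightarrow> two_sided_ideal A L"
  shows "distinct (map ((`) h) As)"
    and "Cs \<noteq> [] \<Longrightarrow> distinct Cs \<Longrightarrow> set Cs \<subset> set (map ((`) h) As) \<Longrightarrow>
      lprod Cs \<noteq> lprod (map ((`) h) As)"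
proof -
  have dist: "distinct As" using irr by (simp add: irredundant_product_def)
  have sub: "A \<subseteq> carrier L" if "A \<in> set As" for A
    using two_sided_idealD(1)[OF ideals[OF that]] .
  have "inj_on ((`) h) (set As)"
  proof (rule inj_onI)
    fix A B assume AB: "A \<in> set As" "B \<in> set As" "h ` A = h ` B"
    show "A = B" by (rule image_cancel[OF sub[OF AB(1)] sub[OF AB(2)] AB(3)])
  qed
  then show "distinct (map ((`) h) As)" using dist by (simp add: distinct_map)
  show "lprod Cs \<noteq> lprod (map ((`) h) As)"
    if Cs: "Cs \<noteq> []" "distinct Cs" "set Cs \<subset> set (map ((`) h) As)"
  proof
    assume eq: "lprod Cs = lprod (map ((`) h) As)"
    let ?Cs = "map preimage Cs"
    have pre: "preimage C \<in> set As \<and> h ` preimage C = C" if "C \<in> set Cs" for C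
    proof -
      from Cs(3) that have "C \<in> (`) h ` set As" unfolding set_map by blast
      then obtain A where A: "A \<in> set As" "C = h ` A" by blast
      then show ?thesis using preimage_image[OF sub[OF A(1)]] by simp
    qed
    then have Cs_eq: "map ((`) h) ?Cs = Cs" by (simp add: map_idI)
    have "set ?Cs \<noteq> set As"
    proof
      assume "set ?Cs = set As"
      then have "set (map ((`) h) ?Cs) = set (map ((`) h) As)" unfolding set_map[of "(`) h"] by (rule arg_cong)
      then show False using Cs(3) unfolding Cs_eq by blast
    qed
    moreover have Cs_sub: "set ?Cs \<subseteq> set As" using pre by auto
    moreover have "distinct ?Cs" using Cs(2) Cs_eq by (metis distinct_map)
    moreover have "?Cs \<noteq> []" using Cs(1) by simp
    ultimately have ne: "ideal_list_prod L ?Cs \<noteq> ideal_list_prod L As"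
      using irr unfolding irredundant_product_def by blast
    have ideals': "two_sided_ideal A L" if "A \<in> set ?Cs" for A
      using ideals that Cs_sub by blast
    have "h ` ideal_list_prod L ?Cs = lprod Cs"
      using image_ideal_list_prod(2)[of ?Cs, OF ideals'] unfolding Cs_eq .
    also have "\<dots> = h ` ideal_list_prod L As"
      unfolding eq by (rule image_ideal_list_prod(2)[symmetric, OF ideals])
    finally show False
      using ne image_cancel[OF image_ideal_list_prod(1)[of ?Cs, OF ideals']
          image_ideal_list_prod(1)[of As, OF ideals]]
      by blast
  qed
qed

lemma prime_rep_image:
  assumes "prime_power_rep L I m P r"
  shows "prime_rep (h ` I) m (\<lambda>i. h ` P i) r"
proof -
  define As where "As = map (\<lambda>i. ideal_power L (P i) (r i)) [1..<Suc m]"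
  note P = prime_power_repD[OF assms]
  have sub: "P i \<subseteq> carrier L" if "i \<in> {1..m}" for i using P(2)[OF that] by (rule two_sided_idealD(1))
  have inj_P: "inj_on P {1..m}"
    using assms unfolding prime_power_rep_def by (elim conjE)
  have I: "I = ideal_list_prod L As"
    using assms unfolding prime_power_rep_def Let_def As_def[symmetric] by (elim conjE)
  have irr: "irredundant_product L As"
    using assms unfolding prime_power_rep_def Let_def As_def[symmetric] by (elim conjE)
  have inj_hP: "inj_on (\<lambda>i. h ` P i) {1..m}"
  proof (rule inj_onI)
    fix i j assume ij: "i \<in> {1..m}" "j \<in> {1..m}" "h ` P i = h ` P j"
    have "P i = P j" by (rule image_cancel[OF sub[OF ij(1)] sub[OF ij(2)] ij(3)])
    then show "i = j" using inj_onD[OF inj_P _ ij(1,2)] by blast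
  qed
  have upt: "set [1..<Suc m] = {1..m}" by auto
  have ideals: "two_sided_ideal A L" if "A \<in> set As" for A
  proof -
    from that obtain i where i: "i \<in> {1..m}" "A = ideal_power L (P i) (r i)"
      unfolding As_def set_map upt by blast
    \<comment> \<open>That a power is an ideal is known in \<open>R\<close>; the preimage carries it
      back to \<open>L\<close>.\<close>
    have "is_ideal (h ` A)"
      unfolding i(2) image_ideal_power(2)[OF P(2)[OF i(1)]]
      by (intro is_ideal_pw is_ideal_image P(2)[OF i(1)])
    from two_sided_ideal_preimage[OF this] show ?thesis
      unfolding i(2) preimage_image[OF image_ideal_power(1)[OF P(2)[OF i(1)]]] .
  qed
  have Bs: "map (\<lambda>i. pw (h ` P i) (r i)) [1..<Suc m] = map ((`) h) As"
    unfolding As_def map_map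
    by (rule map_cong[OF refl]) (unfold upt, simp only: o_apply image_ideal_power(2)[OF P(2)])
  have prod: "h ` I = lprod (map ((`) h) As)"
    unfolding I by (rule image_ideal_list_prod(2)[OF ideals])
  show ?thesis
    unfolding prime_rep_def Let_def Bs
    using is_prime_image[OF P(1)] P(3) inj_hP prod irredundant_image[OF irr ideals]
    by (intro conjI ballI allI impI)
qed

theorem prime_power_rep_unique:
  assumes "prime_power_rep L I m P r" "prime_power_rep L I n Q s"
  shows "m = n \<and>
    (\<lambda>i. ideal_power L (P i) (r i)) ` {1..m} = (\<lambda>j. ideal_power L (Q j) (s j)) ` {1..n}"
proof -
  have im: "(\<lambda>i. ideal_power L (P i) (r i)) ` {1..m} =
      preimage ` (\<lambda>i. pw (h ` P i) (r i)) ` {1..m}" if "prime_power_rep L I m P r" for P r m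
  proof -
    have "ideal_power L (P i) (r i) = preimage (pw (h ` P i) (r i))" if "i \<in> {1..m}" for i
    proof -
      have "two_sided_ideal (P i) L" by (rule prime_power_repD(2)) fact+
      from image_ideal_power[OF this] show ?thesis using preimage_image by metis
    qed
    then show ?thesis by (simp add: image_image)
  qed
  note unique = prime_rep_unique[OF prime_rep_image[OF assms(1)] prime_rep_image[OF assms(2)]]
  show ?thesis
    unfolding im[OF assms(1)] im[OF assms(2)]
    using conjunct1[OF unique] arg_cong[OF conjunct2[OF unique], of "(`) preimage"] by (rule conjI)
qed

end

section \<open>Algebras spanned by a Cuntz--Krieger family\<close>

text \<open>Relation (CK2) is not assumed: it only divides out an ideal, and the argument below applies
  to every quotient of a Cohn path algebra.\<close>

locale ck_family = wf_digraph E + vector_space scl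
  for E :: "('v, 'e) pre_digraph" and scl :: "'k::field \<Rightarrow> 'a::ring_1 \<Rightarrow> 'a" +
  fixes V :: "'v \<Rightarrow> 'a" and D S :: "'e \<Rightarrow> 'a"
  assumes scl_left: "scl k x * y = scl k (x * y)"
    and scl_right: "x * scl k y = scl k (x * y)"
    and VV: "v \<in> verts E \<Longrightarrow> V v * V v = V v"
    and VW: "v \<in> verts E \<Longrightarrow> w \<in> verts E \<Longrightarrow> v \<noteq> w \<Longrightarrow> V v * V w = 0"
    and VD: "e \<in> arcs E \<Longrightarrow> V (tail E e) * D e = D e"
    and DV: "e \<in> arcs E \<Longrightarrow> D e * V (head E e) = D e"
    and VS: "e \<in> arcs E \<Longrightarrow> V (head E e) * S e = S e"
    and SV: "e \<in> arcs E \<Longrightarrow> S e * V (tail E e) = S e"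
    and SD: "e \<in> arcs E \<Longrightarrow> S e * D e = V (head E e)"
    and SD0: "e \<in> arcs E \<Longrightarrow> f \<in> arcs E \<Longrightarrow> e \<noteq> f \<Longrightarrow> S e * D f = 0"
begin

fun wpath :: "'v \<Rightarrow> 'e list \<Rightarrow> 'v \<Rightarrow> bool" where
  "wpath u [] v \<longleftrightarrow> u = v \<and> u \<in> verts E"
| "wpath u (e # es) v \<longleftrightarrow> e \<in> arcs E \<and> tail E e = u \<and> wpath (head E e) es v"

text \<open>The real path and the ghost path of an edge list that starts at \<open>u\<close>.\<close>

fun pe :: "'v \<Rightarrow> 'e list \<Rightarrow> 'a" where
  "pe u [] = V u"
| "pe u (e # es) = D e * pe (head E e) es"

fun gh :: "'v \<Rightarrow> 'e list \<Rightarrow> 'a" where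
  "gh u [] = V u"
| "gh u (e # es) = gh (head E e) es * S e"

text \<open>With \<open>F\<close> empty this is the vertex itself; with \<open>F\<close> finite and
  nonempty it has the form of the elements attached to breaking vertices. One family thus covers
  both kinds of generators of graded ideals.\<close>

definition q :: "'v \<Rightarrow> 'e set \<Rightarrow> 'a" where
  "q v F = V v - (\<Sum>e\<in>F. D e * S e)"

definition valid :: "'v \<Rightarrow> 'e set \<Rightarrow> bool" where
  "valid v F \<longleftrightarrow> v \<in> verts E \<and> finite F \<and> F \<subseteq> out_arcs E v"

definition mons :: "('v \<times> 'e set) set \<Rightarrow> 'a set" where
  "mons Q = {pe u es * q v F * gh w fs | u es v F w fs.
     (v, F) \<in> Q \<and> valid v F \<and> wpath u es v \<and> wpath w fs v}"

text \<open>Compressing \<open>q v F\<close> by an edge \<open>f\<close> outside \<open>F\<close>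
  leaves \<open>V (head E f)\<close>; closure under this is what makes the span of
  \<open>mons Q\<close> an ideal.\<close>

definition hereditary :: "('v \<times> 'e set) set \<Rightarrow> bool" where
  "hereditary Q \<longleftrightarrow> (\<forall>v F f. (v, F) \<in> Q \<longrightarrow> f \<in> out_arcs E v - F \<longrightarrow> (head E f, {}) \<in> Q)"

section \<open>Multiplication rules for vertices, paths and ghost paths\<close>

lemma V_left:
  assumes "u \<in> verts E" "x = V v * x" "v \<in> verts E"
  shows "V u * x = (if u = v then x else 0)"
proof -
  have "V u * x = V u * V v * x" using assms(2) by (metis mult.assoc)
  then show ?thesis using assms VV[of u] VW[of u v] by auto
qed

lemma V_right:
  assumes "u \<in> verts E" "x = x * V v" "v \<in> verts E"
  shows "x * V u = (if u = v then x else 0)"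
proof -
  have "x * V u = x * (V v * V u)" using assms(2) by (metis mult.assoc)
  then show ?thesis using assms VV[of u] VW[of v u] by auto
qed

lemma VD_if: "u \<in> verts E \<Longrightarrow> e \<in> arcs E \<Longrightarrow> V u * D e = (if u = tail E e then D e else 0)"
  by (rule V_left) (auto simp: VD)

lemma SV_if: "u \<in> verts E \<Longrightarrow> e \<in> arcs E \<Longrightarrow> S e * V u = (if u = tail E e then S e else 0)"
  by (rule V_right) (auto simp: SV)

lemma SD_if: "e \<in> arcs E \<Longrightarrow> f \<in> arcs E \<Longrightarrow> S e * D f = (if e = f then V (head E e) else 0)"
  using SD SD0 by auto

lemma wpath_verts: "wpath u es v \<Longrightarrow> u \<in> verts E" "wpath u es v \<Longrightarrow> v \<in> verts E"
  by (induction es arbitrary: u) auto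

lemma wpath_append: "wpath u (es @ fs) v \<longleftrightarrow> (\<exists>x. wpath u es x \<and> wpath x fs v)"
  by (induction es arbitrary: u) (auto simp: wpath_verts)

lemma wpath_unique: "wpath u es v \<Longrightarrow> wpath u es w \<Longrightarrow> v = w"
  by (induction es arbitrary: u) auto

lemma V_pe: "wpath u es v \<Longrightarrow> V u * pe u es = pe u es"
  by (cases es) (auto simp: VV VD mult.assoc[symmetric])

lemma pe_V: "wpath u es v \<Longrightarrow> pe u es * V v = pe u es"
  by (induction es arbitrary: u) (auto simp: VV mult.assoc)

lemma gh_V: "wpath u es v \<Longrightarrow> gh u es * V u = gh u es"
  by (cases es) (auto simp: VV SV mult.assoc)

lemma V_gh: "wpath u es v \<Longrightarrow> V v * gh u es = gh u es"
  by (induction es arbitrary: u) (auto simp: VV mult.assoc[symmetric])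

lemma V_pe_if:
  "w \<in> verts E \<Longrightarrow> wpath u es v \<Longrightarrow> V w * pe u es = (if w = u then pe u es else 0)"
  by (rule V_left) (auto simp: V_pe wpath_verts)

lemma gh_V_if:
  "w \<in> verts E \<Longrightarrow> wpath u es v \<Longrightarrow> gh u es * V w = (if w = u then gh u es else 0)"
  by (rule V_right) (auto simp: gh_V wpath_verts)

lemma pe_append: "wpath u es x \<Longrightarrow> wpath x fs v \<Longrightarrow> pe u (es @ fs) = pe u es * pe x fs"
  by (induction es arbitrary: u) (auto simp: V_pe mult.assoc)

lemma gh_append: "wpath u es x \<Longrightarrow> wpath x fs v \<Longrightarrow> gh u (es @ fs) = gh x fs * gh u es"
  by (induction es arbitrary: u) (auto simp: gh_V mult.assoc)

lemma pe_single: "e \<in> arcs E \<Longrightarrow> pe u [e] = D e"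
  by (simp add: DV)

lemma gh_single: "e \<in> arcs E \<Longrightarrow> gh u [e] = S e"
  by (simp add: VS)

lemma gh_pe: "wpath u es v \<Longrightarrow> gh u es * pe u es = V v"
proof (induction es arbitrary: u)
  case (Cons e es)
  then have e: "e \<in> arcs E" "wpath (head E e) es v" by auto
  have "gh u (e # es) * pe u (e # es) = gh (head E e) es * (S e * D e) * pe (head E e) es"
    by (simp add: mult.assoc)
  also have "\<dots> = gh (head E e) es * pe (head E e) es"
    using SD[OF e(1)] V_pe[OF e(2)] by (simp add: mult.assoc)
  finally show ?case using Cons.IH[OF e(2)] by simp
qed (simp add: VV)

lemma gh_pe_append:
  assumes "wpath u es x" "wpath x fs v"
  shows "gh u es * pe u (es @ fs) = pe x fs" "gh u (es @ fs) * pe u es = gh x fs"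
proof -
  show "gh u es * pe u (es @ fs) = pe x fs"
    using gh_pe[OF assms(1)] V_pe[OF assms(2)] by (simp add: pe_append[OF assms] mult.assoc[symmetric])
  show "gh u (es @ fs) * pe u es = gh x fs"
    using gh_pe[OF assms(1)] gh_V[OF assms(2)] by (simp add: gh_append[OF assms] mult.assoc)
qed

text \<open>Common initial edges cancel by \<open>SD\<close>. At the first disagreement
  \<open>SD0\<close> gives zero; without one, a list runs out and is a prefix of the other.\<close>

lemma gh_pe_cases:
  assumes "wpath u es x" "wpath u fs y"
  shows "(\<exists>gs. fs = es @ gs) \<or> (\<exists>gs. es = fs @ gs) \<or> gh u es * pe u fs = 0"
  using assms
proof (induction es arbitrary: u fs)
  case (Cons e es)
  show ?case
  proof (cases fs)
    case (Cons f fs')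
    have ef: "e \<in> arcs E" "f \<in> arcs E" "wpath (head E e) es x" "wpath (head E f) fs' y"
      using Cons.prems Cons by auto
    have *: "gh u (e # es) * pe u fs = gh (head E e) es * (S e * D f) * pe (head E f) fs'"
      by (simp add: Cons mult.assoc)
    show ?thesis
    proof (cases "e = f")
      case True
      then have "gh u (e # es) * pe u fs = gh (head E e) es * pe (head E e) fs'"
        using * SD[OF ef(1)] V_pe[OF ef(4)] by (metis mult.assoc)
      then show ?thesis using Cons.IH[OF ef(3), of fs'] ef(4) True Cons by auto
    next
      case False
      then show ?thesis using * SD0[OF ef(1,2)] by simp
    qed
  qed simp
qed simp

lemma q_empty [simp]: "q v {} = V v"
  by (simp add: q_def)

lemma validD: "valid v F \<Longrightarrow> v \<in> verts E" "valid v F \<Longrightarrow> finite F"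
  "valid v F \<Longrightarrow> e \<in> F \<Longrightarrow> e \<in> arcs E" "valid v F \<Longrightarrow> e \<in> F \<Longrightarrow> tail E e = v"
  by (auto simp: valid_def)

lemma valid_empty: "v \<in> verts E \<Longrightarrow> valid v {}"
  by (simp add: valid_def)

text \<open>\<open>S f\<close> annihilates every summand except that of \<open>f\<close>, which
  cancels \<open>S f\<close> if it is present.\<close>

lemma S_q:
  assumes "valid v F" "f \<in> arcs E" "tail E f = v"
  shows "S f * q v F = (if f \<in> F then 0 else S f)"
proof -
  have "S f * (\<Sum>e\<in>F. D e * S e) = (\<Sum>e\<in>F. if f = e then S f else 0)"
    unfolding sum_distrib_left
    using validD[OF assms(1)] assms(2)
    by (intro sum.cong) (auto simp: mult.assoc[symmetric] SD_if VS)
  then show ?thesis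
    using validD[OF assms(1)] SV[OF assms(2)] assms(3) by (simp add: q_def right_diff_distrib)
qed

lemma q_D:
  assumes "valid v F" "f \<in> arcs E" "tail E f = v"
  shows "q v F * D f = (if f \<in> F then 0 else D f)"
proof -
  have "(\<Sum>e\<in>F. D e * S e) * D f = (\<Sum>e\<in>F. if f = e then D f else 0)"
    unfolding sum_distrib_right
    using validD[OF assms(1)] assms(2)
    by (intro sum.cong) (auto simp: mult.assoc SD_if DV)
  then show ?thesis
    using validD[OF assms(1)] VD[OF assms(2)] assms(3) by (simp add: q_def left_diff_distrib)
qed

lemma V_q: "valid v F \<Longrightarrow> V v * q v F = q v F"
  unfolding q_def right_diff_distrib sum_distrib_left
  by (intro arg_cong2[where f = minus] sum.cong)
    (auto simp: validD(1) VV mult.assoc[symmetric] VD_if validD(3)[of v F] validD(4)[of v F])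

lemma q_V: "valid v F \<Longrightarrow> q v F * V v = q v F"
  unfolding q_def left_diff_distrib sum_distrib_right
  by (intro arg_cong2[where f = minus] sum.cong)
    (auto simp: validD(1) VV mult.assoc SV_if validD(3)[of v F] validD(4)[of v F])

lemma q_q: "valid v F \<Longrightarrow> q v F * q v F = q v F"
proof -
  assume v: "valid v F"
  have "q v F * (\<Sum>e\<in>F. D e * S e) = (\<Sum>e\<in>F. 0)"
    unfolding sum_distrib_left
    by (intro sum.cong) (auto simp: mult.assoc[symmetric] q_D[OF v] validD[OF v])
  then show ?thesis
    using q_V[OF v] unfolding q_def[of v F] by (simp add: right_diff_distrib)
qed

lemma q_pe_Cons:
  assumes "valid v F" "wpath v (e # es) w"
  shows "q v F * pe v (e # es) = (if e \<in> F then 0 else pe v (e # es))"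
  using assms q_D[of v F e] by (simp add: mult.assoc[symmetric])

lemma q_insert:
  assumes "valid v F" "e \<notin> F" 
  shows "q v (insert e F) = q v F - D e * S e"
  using assms by (simp add: q_def validD algebra_simps)

lemma valid_insert: "valid v F \<Longrightarrow> e \<in> arcs E \<Longrightarrow> tail E e = v \<Longrightarrow> valid v (insert e F)"
  by (auto simp: valid_def)

section \<open>Ideals spanned by monomials\<close>

lemma span_mult:
  assumes "x \<in> span A" "y \<in> span B" "\<And>a b. a \<in> A \<Longrightarrow> b \<in> B \<Longrightarrow> a * b \<in> span C"
  shows "x * y \<in> span C"
  using assms(1)
proof (induction rule: span_induct_alt)
  case base
  then show ?case by (simp add: span_zero)
next
  case (step k a x)
  have "a * y \<in> span C"
    using assms(2)
    by (induction rule: span_induct_alt)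
      (auto simp: distrib_left scl_right span_zero intro!: span_add span_scale assms(3) step(1))
  then show ?case using step by (simp add: distrib_right scl_left span_add span_scale)
qed

lemma mult_span: "x \<in> span A \<Longrightarrow> (\<And>a. a \<in> A \<Longrightarrow> y * a \<in> span C) \<Longrightarrow> y * x \<in> span C"
  by (rule span_mult[of y "{y}" x A]) (auto intro: span_base)

lemma span_mult': "x \<in> span A \<Longrightarrow> (\<And>a. a \<in> A \<Longrightarrow> a * y \<in> span C) \<Longrightarrow> x * y \<in> span C"
  by (rule span_mult[of x A y "{y}"]) (auto intro: span_base)

lemma monsI:
  "(v, F) \<in> Q \<Longrightarrow> valid v F \<Longrightarrow> wpath u es v \<Longrightarrow> wpath w fs v \<Longrightarrow> pe u es * q v F * gh w fs \<in> mons Q"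
  unfolding mons_def by blast

lemma monsE:
  assumes "m \<in> mons Q"
  obtains u es v F w fs where "m = pe u es * (q v F * gh w fs)" "(v, F) \<in> Q" "valid v F" 
    "wpath u es v" "wpath w fs v"
  using assms by (auto simp: mons_def mult.assoc)

text \<open>A generator on the left keeps, lengthens, shortens or kills the real path, except when
  \<open>S f\<close> meets \<open>q v F\<close> directly. There \<open>S_q\<close> leaves zero or a
  monomial based at \<open>head E f\<close> with empty set, and heredity puts that pair in
  \<open>Q\<close>.\<close>

lemma mons_left:
  assumes "hereditary Q" "m \<in> mons Q"
  shows "u \<in> verts E \<Longrightarrow> V u * m \<in> span (mons Q)"
    and "f \<in> arcs E \<Longrightarrow> D f * m \<in> span (mons Q)"
    and "f \<in> arcs E \<Longrightarrow> S f * m \<in> span (mons Q)"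
proof -
  obtain u' es v F w fs where m: "m = pe u' es * (q v F * gh w fs)" "(v, F) \<in> Q" "valid v F"
    "wpath u' es v" "wpath w fs v" using assms(2) by (rule monsE)
  show "V u * m \<in> span (mons Q)" if "u \<in> verts E"
    using V_pe_if[OF that m(4)] assms(2)
    by (auto simp: m(1) mult.assoc[symmetric] span_zero intro: span_base)
  have V: "v \<in> verts E" "u' \<in> verts E" using m wpath_verts by blast+
  show "D f * m \<in> span (mons Q)" if f: "f \<in> arcs E"
  proof (cases "head E f = u'")
    case True
    have "D f * m = pe (tail E f) (f # es) * q v F * gh w fs"
      by (simp add: m(1) True mult.assoc)
    moreover have "\<dots> \<in> mons Q" by (rule monsI) (use m f True in auto)
    ultimately show ?thesis by (simp add: span_base)
  next
    case False
    have "D f * m = D f * (V (head E f) * V u') * m"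
      using V_pe[OF m(4)] DV[OF f] by (metis m(1) mult.assoc)
    then show ?thesis using VW[of "head E f" u'] V f False by (simp add: span_zero)
  qed
  show "S f * m \<in> span (mons Q)" if f: "f \<in> arcs E"
  proof (cases "tail E f = u'")
    case tail: True
    show ?thesis
    proof (cases es)
      case Nil
      then have [simp]: "u' = v" using m(4) by simp
      have Sf: "S f * m = S f * q v F * gh w fs"
        using Nil V_q[OF m(3)] by (simp add: m(1) mult.assoc[symmetric] SV_if f tail V(1))
      show ?thesis
      proof (cases "f \<in> F")
        case True
        then show ?thesis using Sf S_q[OF m(3) f] tail by (simp add: span_zero)
      next
        case False
        have wp: "wpath w (fs @ [f]) (head E f)" using m(5) f tail by (auto simp: wpath_append)
        have "S f * m = S f * gh w fs" using Sf S_q[OF m(3) f] tail False by simp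
        also have "\<dots> = gh w (fs @ [f])"
          using gh_append[OF m(5), of "[f]" "head E f"] f tail gh_single[OF f] by simp
        also have "\<dots> = pe (head E f) [] * q (head E f) {} * gh w (fs @ [f])"
          using V_gh[OF wp] f by (simp add: VV)
        also have "\<dots> \<in> mons Q"
          using assms(1) m(2) f tail False wp
          by (intro monsI) (auto simp: hereditary_def valid_empty)
        finally show ?thesis by (rule span_base)
      qed
    next
      case (Cons e es')
      have e: "e \<in> arcs E" "wpath (head E e) es' v" using m(4) Cons by auto
      have "S f * m = S f * D e * (pe (head E e) es' * (q v F * gh w fs))"
        by (simp add: m(1) Cons mult.assoc)
      also have "\<dots> = (if f = e then V (head E e) * pe (head E e) es' * q v F * gh w fs else 0)"
        by (simp add: SD_if f e mult.assoc)
      also have "\<dots> = (if f = e then pe (head E e) es' * q v F * gh w fs else 0)"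
        by (simp add: V_pe[OF e(2)])
      also have "\<dots> \<in> span (mons Q)"
        using monsI[OF m(2,3) e(2) m(5)] by (simp add: span_base span_zero)
      finally show ?thesis .
    qed
  next
    case False
    have "S f * m = S f * (V (tail E f) * V u') * m"
      using V_pe[OF m(4)] SV[OF f] by (metis m(1) mult.assoc)
    then show ?thesis using VW[of "tail E f" u'] V f False by (simp add: span_zero)
  qed
qed

lemma mons_right:
  assumes "hereditary Q" "m \<in> mons Q"
  shows "u \<in> verts E \<Longrightarrow> m * V u \<in> span (mons Q)"
    and "f \<in> arcs E \<Longrightarrow> m * D f \<in> span (mons Q)"
    and "f \<in> arcs E \<Longrightarrow> m * S f \<in> span (mons Q)"
proof -
  obtain u' es v F w fs where m: "m = pe u' es * (q v F * gh w fs)" "(v, F) \<in> Q" "valid v F"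
    "wpath u' es v" "wpath w fs v" using assms(2) by (rule monsE)
  show "m * V u \<in> span (mons Q)" if "u \<in> verts E"
    using gh_V_if[OF that m(5)] assms(2)
    by (auto simp: m(1) mult.assoc span_zero intro: span_base)
  have V: "v \<in> verts E" "w \<in> verts E" using m wpath_verts by blast+
  show "m * S f \<in> span (mons Q)" if f: "f \<in> arcs E"
  proof (cases "head E f = w")
    case True
    have "m * S f = pe u' es * q v F * gh (tail E f) (f # fs)"
      by (simp add: m(1) True mult.assoc)
    moreover have "\<dots> \<in> mons Q" by (rule monsI) (use m f True in auto)
    ultimately show ?thesis by (simp add: span_base)
  next
    case False
    have "m * S f = m * (V w * V (head E f)) * S f"
      using gh_V[OF m(5)] VS[OF f] by (metis m(1) mult.assoc)
    then show ?thesis using VW[of w "head E f"] V f False by (simp add: span_zero)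
  qed
  show "m * D f \<in> span (mons Q)" if f: "f \<in> arcs E"
  proof (cases "tail E f = w")
    case tail: True
    show ?thesis
    proof (cases fs)
      case Nil
      then have [simp]: "w = v" using m(5) by simp
      have Df: "m * D f = pe u' es * (q v F * D f)"
        using Nil q_V[OF m(3)] by (simp add: m(1) mult.assoc)
      show ?thesis
      proof (cases "f \<in> F")
        case True
        then show ?thesis using Df q_D[OF m(3) f] tail by (simp add: span_zero)
      next
        case False
        have wp: "wpath u' (es @ [f]) (head E f)" using m(4) f tail by (auto simp: wpath_append)
        have "m * D f = pe u' es * D f" using Df q_D[OF m(3) f] tail False by simp
        also have "\<dots> = pe u' (es @ [f])"
          using pe_append[OF m(4), of "[f]" "head E f"] f tail pe_single[OF f] by simp
        also have "\<dots> = pe u' (es @ [f]) * q (head E f) {} * gh (head E f) []"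
          using pe_V[OF wp] f by (simp add: VV mult.assoc)
        also have "\<dots> \<in> mons Q"
          using assms(1) m(2) f tail False wp
          by (intro monsI) (auto simp: hereditary_def valid_empty)
        finally show ?thesis by (rule span_base)
      qed
    next
      case (Cons e fs')
      have e: "e \<in> arcs E" "wpath (head E e) fs' v" using m(5) Cons by auto
      have "m * D f = pe u' es * (q v F * (gh (head E e) fs' * (S e * D f)))"
        by (simp add: m(1) Cons mult.assoc)
      also have "\<dots> = (if f = e then pe u' es * q v F * (gh (head E e) fs' * V (head E e)) else 0)"
        by (simp add: SD_if f e mult.assoc)
      also have "\<dots> = (if f = e then pe u' es * q v F * gh (head E e) fs' else 0)"
        by (simp add: gh_V[OF e(2)])
      also have "\<dots> \<in> span (mons Q)"
        using monsI[OF m(2,3,4) e(2)] by (simp add: span_base span_zero)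
      finally show ?thesis .
    qed
  next
    case False
    have "m * D f = m * (V w * V (tail E f)) * D f"
      using gh_V[OF m(5)] VD[OF f] by (metis m(1) mult.assoc)
    then show ?thesis using VW[of w "tail E f"] V f False by (simp add: span_zero)
  qed
qed

text \<open>Admitting every pair makes \<open>R\<close> itself an instance of the ideals
  \<open>span (mons Q)\<close>, so closure and local units come from the general lemmas.
  \<open>R_eq_span\<close> supplies the usual spanning set.\<close>

definition R :: "'a set" where
  "R = span (mons UNIV)"

lemma span_mons_left:
  assumes Q: "hereditary Q" and x: "x \<in> span (mons Q)"
  shows "u \<in> verts E \<Longrightarrow> V u * x \<in> span (mons Q)"
    "f \<in> arcs E \<Longrightarrow> D f * x \<in> span (mons Q)"
    "f \<in> arcs E \<Longrightarrow> S f * x \<in> span (mons Q)"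
    "wpath u es v \<Longrightarrow> pe u es * x \<in> span (mons Q)"
    "wpath u es v \<Longrightarrow> gh u es * x \<in> span (mons Q)"
    "valid v F \<Longrightarrow> q v F * x \<in> span (mons Q)"
    "r \<in> R \<Longrightarrow> r * x \<in> span (mons Q)"
proof -
  have V: "V u * x \<in> span (mons Q)" if "u \<in> verts E" "x \<in> span (mons Q)" for u x
    using mult_span[OF that(2)] mons_left(1)[OF Q] that(1) by blast
  have D: "D f * x \<in> span (mons Q)" if "f \<in> arcs E" "x \<in> span (mons Q)" for f x
    using mult_span[OF that(2)] mons_left(2)[OF Q] that(1) by blast
  have S: "S f * x \<in> span (mons Q)" if "f \<in> arcs E" "x \<in> span (mons Q)" for f x
    using mult_span[OF that(2)] mons_left(3)[OF Q] that(1) by blast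
  have pe: "pe u es * x \<in> span (mons Q)" if "wpath u es v" "x \<in> span (mons Q)" for u es v x
    using that by (induction es arbitrary: u) (auto simp: V D mult.assoc)
  have gh: "gh u es * x \<in> span (mons Q)" if "wpath u es v" "x \<in> span (mons Q)" for u es v x
    using that by (induction es arbitrary: u x) (auto simp: V S mult.assoc)
  have q: "q v F * x \<in> span (mons Q)" if "valid v F" "x \<in> span (mons Q)" for v F x
    unfolding q_def left_diff_distrib sum_distrib_right mult.assoc
    by (intro span_diff span_sum V D S) (use that validD in auto)
  show "u \<in> verts E \<Longrightarrow> V u * x \<in> span (mons Q)"
    "f \<in> arcs E \<Longrightarrow> D f * x \<in> span (mons Q)"
    "f \<in> arcs E \<Longrightarrow> S f * x \<in> span (mons Q)"
    "wpath u es v \<Longrightarrow> pe u es * x \<in> span (mons Q)"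
    "wpath u es v \<Longrightarrow> gh u es * x \<in> span (mons Q)"
    "valid v F \<Longrightarrow> q v F * x \<in> span (mons Q)"
    using x V D S pe gh q by blast+
  show "r * x \<in> span (mons Q)" if "r \<in> R"
  proof (rule span_mult'[OF that[unfolded R_def]])
    fix m assume "m \<in> mons UNIV"
    then show "m * x \<in> span (mons Q)" by (elim monsE) (auto simp: mult.assoc intro!: pe gh q x)
  qed
qed

lemma span_mons_right:
  assumes Q: "hereditary Q" and x: "x \<in> span (mons Q)"
  shows "u \<in> verts E \<Longrightarrow> x * V u \<in> span (mons Q)"
    "f \<in> arcs E \<Longrightarrow> x * D f \<in> span (mons Q)"
    "f \<in> arcs E \<Longrightarrow> x * S f \<in> span (mons Q)"
    "wpath u es v \<Longrightarrow> x * pe u es \<in> span (mons Q)"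
    "wpath u es v \<Longrightarrow> x * gh u es \<in> span (mons Q)"
    "valid v F \<Longrightarrow> x * q v F \<in> span (mons Q)"
    "r \<in> R \<Longrightarrow> x * r \<in> span (mons Q)"
proof -
  have V: "x * V u \<in> span (mons Q)" if "u \<in> verts E" "x \<in> span (mons Q)" for u x
    using span_mult'[OF that(2)] mons_right(1)[OF Q] that(1) by blast
  have D: "x * D f \<in> span (mons Q)" if "f \<in> arcs E" "x \<in> span (mons Q)" for f x
    using span_mult'[OF that(2)] mons_right(2)[OF Q] that(1) by blast
  have S: "x * S f \<in> span (mons Q)" if "f \<in> arcs E" "x \<in> span (mons Q)" for f x
    using span_mult'[OF that(2)] mons_right(3)[OF Q] that(1) by blast
  have pe: "x * pe u es \<in> span (mons Q)" if "wpath u es v" "x \<in> span (mons Q)" for u es v x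
    using that by (induction es arbitrary: u x) (auto simp: V D mult.assoc[symmetric])
  have gh: "x * gh u es \<in> span (mons Q)" if "wpath u es v" "x \<in> span (mons Q)" for u es v x
    using that by (induction es arbitrary: u) (auto simp: V S mult.assoc[symmetric])
  have q: "x * q v F \<in> span (mons Q)" if "valid v F" "x \<in> span (mons Q)" for v F x
    unfolding q_def right_diff_distrib sum_distrib_left mult.assoc[symmetric]
    by (intro span_diff span_sum V D S) (use that validD in auto)
  show "u \<in> verts E \<Longrightarrow> x * V u \<in> span (mons Q)"
    "f \<in> arcs E \<Longrightarrow> x * D f \<in> span (mons Q)"
    "f \<in> arcs E \<Longrightarrow> x * S f \<in> span (mons Q)"
    "wpath u es v \<Longrightarrow> x * pe u es \<in> span (mons Q)"
    "wpath u es v \<Longrightarrow> x * gh u es \<in> span (mons Q)"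
    "valid v F \<Longrightarrow> x * q v F \<in> span (mons Q)"
    using x V D S pe gh q by blast+
  show "x * r \<in> span (mons Q)" if "r \<in> R"
  proof (rule mult_span[OF that[unfolded R_def]])
    fix m assume "m \<in> mons UNIV"
    then show "x * m \<in> span (mons Q)"
      by (elim monsE) (auto simp: mult.assoc[symmetric] intro!: pe gh q x)
  qed
qed

lemma hereditary_UNIV: "hereditary UNIV"
  by (simp add: hereditary_def)

lemma mons_mono: "Q \<subseteq> Q' \<Longrightarrow> span (mons Q) \<subseteq> span (mons Q')"
  by (intro span_mono) (unfold mons_def, blast)

sublocale ideals_in R
  by unfold_locales
    (auto simp: R_def[symmetric] intro: span_mons_left(7)[OF hereditary_UNIV, folded R_def],
      auto simp: R_def span_zero span_add span_neg)

lemma R_scale: "x \<in> R \<Longrightarrow> scl k x \<in> R"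
  by (simp add: R_def span_scale)

lemma monomial_in_R: "wpath u es x \<Longrightarrow> wpath v fs x \<Longrightarrow> pe u es * gh v fs \<in> R"
  using monsI[of x "{}" UNIV u es v fs]
  by (auto simp: R_def pe_V valid_empty wpath_verts intro: span_base)

lemma generators_in_R:
  "u \<in> verts E \<Longrightarrow> V u \<in> R" "f \<in> arcs E \<Longrightarrow> D f \<in> R" "f \<in> arcs E \<Longrightarrow> S f \<in> R"
  "wpath u es v \<Longrightarrow> pe u es \<in> R" "wpath u es v \<Longrightarrow> gh u es \<in> R" "valid v F \<Longrightarrow> q v F \<in> R"
proof -
  show V: "V u \<in> R" if "u \<in> verts E" for u
    using monomial_in_R[of u "[]" u u "[]"] that by (simp add: VV)
  note L = span_mons_left[OF hereditary_UNIV, folded R_def]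
  show "D f \<in> R" if "f \<in> arcs E" using L(2)[OF V that] that DV[of f] head_in_verts[of f] by metis
  show "S f \<in> R" if "f \<in> arcs E" using L(3)[OF V that] that SV[of f] tail_in_verts[of f] by metis
  show "pe u es \<in> R" if "wpath u es v" using L(4)[OF V that] that pe_V wpath_verts by metis
  show "gh u es \<in> R" if "wpath u es v" using L(5)[OF V that] that gh_V wpath_verts by metis
  show "q v F \<in> R" if "valid v F" using L(6)[OF V that] that q_V validD(1) by metis
qed

lemma is_ideal_span_mons: "hereditary Q \<Longrightarrow> is_ideal (span (mons Q))"
  using span_mons_left(7)[of Q] span_mons_right(7)[of Q] mons_mono[of Q UNIV]
  by (auto simp: is_ideal_def R_def[symmetric] span_zero span_add span_neg)

section \<open>Commuting range projections and local units\<close>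

definition proj :: "'v \<Rightarrow> 'e list \<Rightarrow> 'a" where
  "proj u es = pe u es * gh u es"

definition projs :: "'a set" where
  "projs = span {proj u es | u es v. wpath u es v}"

lemma gh_pe_zero:
  assumes "wpath u es x" "wpath w fs y" "u \<noteq> w"
  shows "gh u es * pe w fs = 0"
proof -
  have "gh u es * pe w fs = gh u es * (V u * V w) * pe w fs"
    using gh_V[OF assms(1)] V_pe[OF assms(2)] by (metis mult.assoc)
  then show ?thesis using VW[of u w] assms wpath_verts by simp
qed

lemma proj_prefix:
  assumes "wpath u es x" "wpath x gs y"
  shows "proj u es * proj u (es @ gs) = proj u (es @ gs)"
    "proj u (es @ gs) * proj u es = proj u (es @ gs)"
proof -
  have "proj u es * proj u (es @ gs) = pe u es * (gh u es * pe u (es @ gs)) * gh u (es @ gs)"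
    by (simp add: proj_def mult.assoc)
  then show "proj u es * proj u (es @ gs) = proj u (es @ gs)"
    by (simp add: gh_pe_append(1)[OF assms] pe_append[OF assms, symmetric] proj_def)
  have "proj u (es @ gs) * proj u es = pe u (es @ gs) * (gh u (es @ gs) * pe u es) * gh u es"
    by (simp add: proj_def mult.assoc)
  also have "\<dots> = pe u (es @ gs) * (gh x gs * gh u es)"
    by (simp add: gh_pe_append(2)[OF assms] mult.assoc)
  finally show "proj u (es @ gs) * proj u es = proj u (es @ gs)"
    by (simp add: gh_append[OF assms, symmetric] proj_def)
qed

text \<open>When one path extends the other, the product in either order is the projection of the
  longer path; otherwise both products vanish.\<close>

lemma proj_mult:
  assumes "wpath u es x" "wpath w fs y"
  shows "proj u es * proj w fs = proj w fs * proj u es \<and> proj u es * proj w fs \<in> projs"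
proof -
  have in_projs: "proj u es \<in> projs" "proj w fs \<in> projs" "0 \<in> projs"
    using assms unfolding projs_def by (blast intro: span_base span_zero)+
  consider "gh u es * pe w fs = 0" "gh w fs * pe u es = 0"
    | gs where "w = u" "fs = es @ gs" | gs where "w = u" "es = fs @ gs"
    using gh_pe_zero[OF assms] gh_pe_zero[OF assms(2,1)] gh_pe_cases[OF assms(1), of fs y]
      gh_pe_cases[of w fs y es x] assms by metis
  then show ?thesis
  proof cases
    case 1
    then have "proj u es * proj w fs = 0" "proj w fs * proj u es = 0"
      unfolding proj_def by (metis mult.assoc mult_zero_left mult_zero_right)+
    then show ?thesis using in_projs by simp
  next
    case (2 gs)
    then have "wpath x gs y" using assms wpath_append wpath_unique by metis
    then show ?thesis using proj_prefix[OF assms(1)] 2 in_projs by simp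
  next
    case (3 gs)
    then have "wpath y gs x" using assms wpath_append wpath_unique by metis
    then show ?thesis using proj_prefix[of w fs y gs x] 3 in_projs assms(2) by simp
  qed
qed

lemma projs_mult:
  assumes "x \<in> projs" "y \<in> projs"
  shows "x * y \<in> projs"
  unfolding projs_def
  by (rule span_mult[OF assms[unfolded projs_def]]) (use proj_mult in \<open>auto simp: projs_def\<close>)

lemma projs_commute:
  assumes "x \<in> projs" "y \<in> projs"
  shows "x * y = y * x"
proof -
  have *: "a * y = y * a" if "a \<in> {proj u es | u es v. wpath u es v}" for a
    using assms(2) unfolding projs_def
  proof (induction rule: span_induct_alt)
    case (step c b y)
    then have "a * b = b * a" using proj_mult that by blast
    then show ?case using step by (simp add: distrib_left distrib_right scl_left scl_right)
  qed simp
  show ?thesis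
    using assms(1) unfolding projs_def
  proof (induction rule: span_induct_alt)
    case (step c b x)
    then show ?case using * by (simp add: distrib_left distrib_right scl_left scl_right)
  qed simp
qed

lemma path_snoc:
  assumes "wpath u es (tail E e)" "e \<in> arcs E"
  shows "pe u (es @ [e]) = pe u es * D e" "gh u (es @ [e]) = S e * gh u es"
    "wpath u (es @ [e]) (head E e)"
  using assms pe_append[OF assms(1), of "[e]" "head E e"] gh_append[OF assms(1), of "[e]" "head E e"]
    pe_single[of e] gh_single[of e]
  by (auto simp: wpath_append)

lemma pe_q_gh_in_projs:
  assumes "valid v F" "wpath u es v"
  shows "pe u es * q v F * gh u es \<in> projs"
proof -
  have "pe u es * (D e * S e) * gh u es = proj u (es @ [e]) \<and> wpath u (es @ [e]) (head E e)"
    if "e \<in> F" for e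
    using validD(3,4)[OF assms(1) that] assms(2) path_snoc[of u es e]
    by (simp add: proj_def mult.assoc)
  moreover have "pe u es * V v * gh u es = proj u es"
    by (simp add: proj_def pe_V[OF assms(2)])
  ultimately have "pe u es * q v F * gh u es = proj u es - (\<Sum>e\<in>F. proj u (es @ [e]))"
    by (simp add: q_def right_diff_distrib left_diff_distrib sum_distrib_left sum_distrib_right)
  also have "\<dots> \<in> projs"
    unfolding projs_def
    by (intro span_diff span_sum span_base)
      (use assms \<open>\<And>e. e \<in> F \<Longrightarrow> _ e \<and> _ e\<close> in blast)+
  finally show ?thesis .
qed

lemma span_mons_unit:
  assumes Q: "hereditary Q" and x: "x \<in> span (mons Q)"
  shows "\<exists>u\<in>projs \<inter> span (mons Q). u * x = x" "\<exists>u\<in>projs \<inter> span (mons Q). x * u = x"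
proof -
  note I = is_ideal_span_mons[OF Q]
  \<comment> \<open>\<open>u + w - u * w\<close> is the join of commuting projections: it fixes
    whatever either of them fixes.\<close>
  have join: "u + w - u * w \<in> projs \<inter> span (mons Q)"
    if "u \<in> projs \<inter> span (mons Q)" "w \<in> projs \<inter> span (mons Q)" for u w
  proof -
    have "u * w \<in> span (mons Q)" using that is_idealD(1,6)[OF I] by blast
    moreover have "u * w \<in> projs" using projs_mult that by blast
    ultimately show ?thesis
      using that unfolding projs_def by (auto intro!: span_add span_diff)
  qed
  show "\<exists>u\<in>projs \<inter> span (mons Q). u * x = x"
    using x
  proof (induction rule: span_induct_alt)
    case base
    then show ?case by (intro bexI[of _ 0]) (auto simp: projs_def span_zero)
  next
    case (step c m x)
    obtain w where w: "w \<in> projs \<inter> span (mons Q)" "w * x = x" using step by blast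
    obtain u es v F u' fs where m: "m = pe u es * (q v F * gh u' fs)" "(v, F) \<in> Q" "valid v F" 
      "wpath u es v" "wpath u' fs v" using step(1) by (rule monsE)
    \<comment> \<open>\<open>t\<close> fixes \<open>m\<close> because
      \<open>gh u es * pe u es\<close> is the vertex \<open>v\<close> and \<open>q v F\<close> is
      idempotent. It lies in \<open>projs\<close>, so it commutes with the unit \<open>w\<close>
      found so far.\<close>
    define t where "t = pe u es * q v F * gh u es"
    have t: "t \<in> projs \<inter> span (mons Q)"
      using pe_q_gh_in_projs[OF m(3,4)] monsI[OF m(2,3,4,4)] by (simp add: t_def span_base)
    have "t * m = pe u es * q v F * (gh u es * pe u es) * q v F * gh u' fs"
      by (simp add: t_def m(1) mult.assoc)
    also have "\<dots> = m"
      using q_V[OF m(3)] q_q[OF m(3)] by (simp add: gh_pe[OF m(4)] m(1) mult.assoc)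
    finally have tm: "t * m = m" .
    have "(t + w - t * w) * (scl c m) = scl c m"
    proof -
      have "t * w = w * t" using projs_commute t w by blast
      then have "(t + w - t * w) * m = t * m + w * m - w * (t * m)"
        by (simp add: distrib_right left_diff_distrib mult.assoc)
      then show ?thesis using tm by (simp add: scl_right)
    qed
    moreover have "(t + w - t * w) * x = x"
      using w(2) by (simp add: distrib_right left_diff_distrib mult.assoc)
    ultimately have "(t + w - t * w) * (scl c m + x) = scl c m + x" by (simp add: distrib_left)
    then show ?case using join[OF t w(1)] by blast
  qed
  show "\<exists>u\<in>projs \<inter> span (mons Q). x * u = x"
    using x
  proof (induction rule: span_induct_alt)
    case base
    then show ?case by (intro bexI[of _ 0]) (auto simp: projs_def span_zero)
  next
    case (step c m x)
    obtain w where w: "w \<in> projs \<inter> span (mons Q)" "x * w = x" using step by blast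
    obtain u' fs v F u es where m: "m = pe u' fs * (q v F * gh u es)" "(v, F) \<in> Q" "valid v F" 
      "wpath u' fs v" "wpath u es v" using step(1) by (rule monsE)
    define t where "t = pe u es * q v F * gh u es"
    have t: "t \<in> projs \<inter> span (mons Q)"
      using pe_q_gh_in_projs[OF m(3,5)] monsI[OF m(2,3,5,5)] by (simp add: t_def span_base)
    have "m * t = pe u' fs * (q v F * ((gh u es * pe u es) * q v F * gh u es))"
      by (simp add: t_def m(1) mult.assoc)
    also have "\<dots> = pe u' fs * (q v F * q v F * gh u es)"
      using V_q[OF m(3)] by (simp add: gh_pe[OF m(5)] mult.assoc)
    also have "\<dots> = m" by (simp add: q_q[OF m(3)] m(1))
    finally have tm: "m * t = m" .
    have "scl c m * (t + w - t * w) = scl c m"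
      using tm by (simp add: scl_left distrib_left right_diff_distrib mult.assoc[symmetric])
    moreover have "x * (t + w - t * w) = x"
    proof -
      have "t * w = w * t" using projs_commute t w by blast
      then have "x * (t + w - t * w) = x * t + x * w - (x * w) * t"
        by (simp add: distrib_left right_diff_distrib mult.assoc)
      then show ?thesis using w(2) by simp
    qed
    ultimately have "(scl c m + x) * (t + w - t * w) = scl c m + x" by (simp add: distrib_right)
    then show ?case using join[OF t w(1)] by blast
  qed
qed

lemma pure_span_mons: "hereditary Q \<Longrightarrow> pure (span (mons Q))"
  using span_mons_unit[of Q] is_ideal_span_mons[of Q] unfolding pure_def by blast

lemma pure_R: "pure R"
  using pure_span_mons[OF hereditary_UNIV] by (simp add: R_def[symmetric])

section \<open>Scalars in ideals, and the core of an ideal\<close>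

lemma R_unit:
  assumes "x \<in> R"
  obtains u where "u \<in> R" "u * x = x"
  using pure_R assms unfolding pure_def by blast

text \<open>Ideals are ring ideals by definition; a local unit \<open>u\<close> of \<open>x\<close>
  absorbs the scalar, since \<open>k x = (k u) x\<close>.\<close>

lemma is_ideal_scale:
  assumes "is_ideal J" "x \<in> J"
  shows "scl k x \<in> J"
proof -
  obtain u where u: "u \<in> R" "u * x = x" using assms is_idealD(1) R_unit by blast
  have "scl k x = scl k u * x" using u by (simp add: scl_left)
  then show ?thesis using is_idealD(6)[OF assms] R_scale[OF u(1)] by simp
qed

lemma is_ideal_subspace: "is_ideal J \<Longrightarrow> subspace J"
  by (auto simp: subspace_def is_idealD is_ideal_scale)

text \<open>In a Leavitt path algebra this is the largest graded ideal inside \<open>J\<close>.\<close>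

definition core :: "'a set \<Rightarrow> 'a set" where
  "core J = span (mons {(v, F). q v F \<in> J})"

lemma hereditary_core:
  assumes "is_ideal J"
  shows "hereditary {(v, F). q v F \<in> J \<and> valid v F}"
proof -
  have "V (head E f) \<in> J" if "q v F \<in> J" "valid v F" "f \<in> out_arcs E v" "f \<notin> F" for v F f
  proof -
    have f: "f \<in> arcs E" "tail E f = v" using that by auto
    have "S f * q v F * D f = V (head E f)"
      using S_q[OF that(2) f] that(4) by (simp add: SD f)
    moreover have "S f * q v F * D f \<in> J"
      using that(1) assms generators_in_R f by (metis is_idealD(6,7))
    ultimately show ?thesis by simp
  qed
  then show ?thesis
    by (auto simp: hereditary_def valid_empty)
qed

lemma core_eq: "core J = span (mons {(v, F). q v F \<in> J \<and> valid v F})"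
  unfolding core_def by (rule arg_cong[where f = span]) (auto simp: mons_def)

lemma pure_core: "is_ideal J \<Longrightarrow> pure (core J)"
  unfolding core_eq by (intro pure_span_mons hereditary_core)

lemma is_ideal_core: "is_ideal J \<Longrightarrow> is_ideal (core J)"
  using pure_core by (simp add: pure_def)

lemma core_subset: "is_ideal J \<Longrightarrow> core J \<subseteq> J"
proof -
  assume J: "is_ideal J"
  have "mons {(v, F). q v F \<in> J} \<subseteq> J"
    using generators_in_R(4,5) is_idealD(6,7)[OF J] by (auto simp: mons_def)
  then show ?thesis unfolding core_def by (rule span_minimal) (rule is_ideal_subspace[OF J])
qed

lemma core_mono: "J \<subseteq> J' \<Longrightarrow> core J \<subseteq> core J'"
  unfolding core_def by (rule mons_mono) auto

lemma q_in_core: "q v F \<in> J \<Longrightarrow> valid v F \<Longrightarrow> q v F \<in> core J"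
  using monsI[of v F "{(v, F). q v F \<in> J}" v "[]" v "[]"]
  by (auto simp: core_def V_q q_V validD(1) intro: span_base)

lemma V_in_core: "V v \<in> J \<Longrightarrow> v \<in> verts E \<Longrightarrow> V v \<in> core J"
  using q_in_core[of v "{}"] by (simp add: valid_empty)

lemma R_eq_span: "R = span {pe u es * gh v fs | u es v fs x. wpath u es x \<and> wpath v fs x}"
  (is "_ = span ?M")
proof
  have "mons UNIV \<subseteq> span ?M"
  proof
    fix m assume "m \<in> mons UNIV"
    then obtain u es v F w fs where m: "m = pe u es * (q v F * gh w fs)" "valid v F"
      "wpath u es v" "wpath w fs v" by (rule monsE)
    have snoc: "pe u es * (D e * S e) * gh w fs = pe u (es @ [e]) * gh w (fs @ [e]) \<and>
        wpath u (es @ [e]) (head E e) \<and> wpath w (fs @ [e]) (head E e)" if "e \<in> F" for e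
      using path_snoc[of u es e] path_snoc[of w fs e] m(3,4) validD(3,4)[OF m(2) that]
      by (simp add: mult.assoc)
    have "m = pe u es * gh w fs - (\<Sum>e\<in>F. pe u es * (D e * S e) * gh w fs)"
      using pe_V[OF m(3)]
      by (simp add: m(1) q_def right_diff_distrib left_diff_distrib sum_distrib_left
          sum_distrib_right mult.assoc[symmetric])
    also have "\<dots> \<in> span ?M"
      by (intro span_diff span_sum span_base) (use snoc m in blast)+
    finally show "m \<in> span ?M" .
  qed
  then show "R \<subseteq> span ?M" unfolding R_def by (rule span_minimal) (rule subspace_span)
  have "subspace R" by (simp add: R_def subspace_span)
  then show "span ?M \<subseteq> R" by (intro span_minimal) (use monomial_in_R in auto)
qed

subsection \<open>Reduction to a cycle without exits\<close>

definition lc :: "'v \<Rightarrow> ('e list \<Rightarrow> 'k) \<Rightarrow> 'e list set \<Rightarrow> 'a" where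
  "lc u k B = (\<Sum>es\<in>B. scl (k es) (pe u es))"

definition rep :: "'a set \<Rightarrow> 'v \<Rightarrow> 'v \<Rightarrow> 'e set \<Rightarrow> 'e list set \<Rightarrow> ('e list \<Rightarrow> 'k) \<Rightarrow> bool" where
  "rep X u v F B k \<longleftrightarrow> valid v F \<and> finite B \<and> (\<forall>es\<in>B. wpath u es v) \<and> lc u k B * q v F \<in> X"

lemma lc_in_R: "\<forall>es\<in>B. wpath u es v \<Longrightarrow> lc u k B \<in> R"
  unfolding lc_def by (intro is_ideal_sum[OF is_ideal_R] R_scale generators_in_R) auto

lemma span_pe_lc:
  assumes "x \<in> span {pe u es | es. wpath u es v}"
  obtains B k where "finite B" "\<forall>es\<in>B. wpath u es v" "x = lc u k B"
proof -
  obtain t c where t: "finite t" "t \<subseteq> {pe u es | es. wpath u es v}" "x = (\<Sum>a\<in>t. scl (c a) a)"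
    using assms unfolding span_explicit by blast
  \<comment> \<open>Several paths may have the same value, so one is chosen for each element of
    \<open>t\<close>. The value recovers the element, hence \<open>p\<close> is injective on
    \<open>t\<close>.\<close>
  define p where "p a = (SOME es. a = pe u es \<and> wpath u es v)" for a
  have p: "a = pe u (p a)" "wpath u (p a) v" if "a \<in> t" for a
  proof -
    have "\<exists>es. a = pe u es \<and> wpath u es v" using t(2) that by blast
    then have "a = pe u (p a) \<and> wpath u (p a) v" unfolding p_def by (rule someI_ex)
    then show "a = pe u (p a)" "wpath u (p a) v" by auto
  qed
  have "x = (\<Sum>a\<in>t. scl (c (pe u (p a))) (pe u (p a)))"
    unfolding t(3) by (intro sum.cong) (use p in auto)
  also have "\<dots> = (\<Sum>es\<in>p ` t. scl (c (pe u es)) (pe u es))"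
    by (subst sum.reindex) (auto simp: o_def intro: inj_onI dest: p(1) intro!: inj_onI, metis p(1))
  finally have "x = lc u (c \<circ> pe u) (p ` t)" by (simp add: lc_def)
  then show thesis using that t(1) p(2) by blast
qed

lemma lc_restrict:
  assumes "finite B" "B1 \<subseteq> B"
    "\<And>es. es \<in> B1 \<Longrightarrow> y * pe u es = pe u es" "\<And>es. es \<in> B - B1 \<Longrightarrow> y * pe u es = 0"
  shows "y * lc u k B = lc u k B1"
proof -
  have "y * lc u k B = (\<Sum>es\<in>B. if es \<in> B1 then scl (k es) (pe u es) else 0)"
    unfolding lc_def sum_distrib_left by (intro sum.cong) (use assms(3,4) in \<open>auto simp: scl_right\<close>)
  also have "\<dots> = lc u k B1"
    using assms(1,2) by (simp add: sum.If_cases lc_def Int_absorb1)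
  finally show ?thesis .
qed

lemma lc_Diff: "finite B \<Longrightarrow> B1 \<subseteq> B \<Longrightarrow> lc u k (B - B1) = lc u k B - lc u k B1"
  unfolding lc_def by (rule sum_diff)

lemma lc_snoc:
  assumes "\<forall>es\<in>B. wpath u es (tail E e)" "e \<in> arcs E"
  shows "lc u k B * D e = lc u (k \<circ> butlast) ((\<lambda>es. es @ [e]) ` B)"
proof -
  have "lc u k B * D e = (\<Sum>es\<in>B. scl (k es) (pe u (es @ [e])))"
    unfolding lc_def sum_distrib_right
    by (intro sum.cong) (use assms path_snoc(1) in \<open>auto simp: scl_left\<close>)
  also have "\<dots> = lc u (k \<circ> butlast) ((\<lambda>es. es @ [e]) ` B)"
    by (simp add: lc_def sum.reindex inj_on_def)
  finally show ?thesis .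
qed

lemma scl_cancel:
  assumes "is_ideal J" "scl c x \<in> J" "c \<noteq> 0"
  shows "x \<in> J"
  using is_ideal_scale[OF assms(1,2), of "inverse c"] assms(3) by simp

section \<open>Representations with the least number of paths\<close>

context
  fixes P N :: "'a set" and n :: nat
  assumes P: "is_ideal P" and N: "is_ideal N" and core_P: "core P \<subseteq> N"
    and min: "\<And>u v F B k. rep (P - N) u v F B k \<Longrightarrow> n \<le> card B"
begin

lemma small_in_N: "rep P u v F B k \<Longrightarrow> card B < n \<Longrightarrow> lc u k B * q v F \<in> N"
  using min[of u v F B k] by (auto simp: rep_def)

text \<open>\<open>y\<close> splits the element into a kept part and a rest, both in
  \<open>P\<close>. The rest has fewer than \<open>n\<close> paths and so lies in \<open>N\<close>;
  the kept part is therefore outside \<open>N\<close> and by minimality uses all of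
  \<open>B\<close>.\<close>

lemma rep_left_mult:
  assumes rep: "rep (P - N) u v F B k" and n: "card B = n" and B1: "B1 \<subseteq> B" "B1 \<noteq> {}" and y: "y \<in> R"
    and "\<And>es. es \<in> B1 \<Longrightarrow> y * pe u es = pe u es" "\<And>es. es \<in> B - B1 \<Longrightarrow> y * pe u es = 0"
  shows "B1 = B" "y * lc u k B * q v F \<notin> N"
proof -
  let ?x = "lc u k B * q v F"
  have fin: "finite B" and x: "?x \<in> P" "?x \<notin> N" using rep by (auto simp: rep_def)
  have lc1: "y * lc u k B = lc u k B1" by (rule lc_restrict[OF fin B1(1) assms(6,7)])
  have x1: "lc u k B1 * q v F \<in> P" using is_idealD(6)[OF P x(1) y] by (simp add: lc1[symmetric] mult.assoc)
  have x2: "lc u k (B - B1) * q v F = ?x - lc u k B1 * q v F"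
    by (simp add: lc_Diff[OF fin B1(1)] left_diff_distrib)
  have "rep P u v F (B - B1) k" "rep P u v F B1 k"
    using rep x1 is_idealD(5)[OF P x(1) x1] B1(1) fin finite_subset x2 by (auto simp: rep_def)
  moreover have "card (B - B1) < n"
    unfolding n[symmetric] by (rule psubset_card_mono[OF fin]) (use B1 in blast)
  ultimately have "lc u k (B - B1) * q v F \<in> N" by (intro small_in_N)
  then have notin: "lc u k B1 * q v F \<notin> N" using x x2 is_idealD(3)[OF N] by fastforce
  then show "y * lc u k B * q v F \<notin> N" using lc1 by simp
  have "\<not> card B1 < n" using small_in_N[OF \<open>rep P u v F B1 k\<close>] notin by blast
  then show "B1 = B" using B1(1) fin n by (metis psubset_card_mono psubsetI)
qed

text \<open>\<open>proj u al\<close> fixes the paths that extend \<open>al\<close> and kills the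
  others, since none is a proper initial piece of the shortest path \<open>al\<close>; minimality
  leaves no others. Removing \<open>al\<close> yields closed paths at \<open>v\<close>. The result
  stays outside \<open>N\<close>, because multiplying back by \<open>pe u al\<close> gives the
  projected element.\<close>

lemma rep_strip_prefix:
  assumes rep: "rep (P - N) u v F B k" and n: "card B = n"
    and al: "al \<in> B" "\<And>es. es \<in> B \<Longrightarrow> length al \<le> length es"
  shows "\<forall>es\<in>B. \<exists>gs. es = al @ gs"
    and "\<exists>k'. rep (P - N) v v F (drop (length al) ` B) k'"
    and "card (drop (length al) ` B) = n"
proof -
  let ?x = "lc u k B * q v F"
  have fin: "finite B" and x: "?x \<in> P" "?x \<notin> N" and path: "\<And>es. es \<in> B \<Longrightarrow> wpath u es v"
    and F: "valid v F"
    using rep by (auto simp: rep_def)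
  note al_path = path[OF al(1)]
  let ?B1 = "{es \<in> B. \<exists>gs. es = al @ gs}"
  have ext: "wpath v gs v" if "al @ gs \<in> B" for gs
    using path[OF that] al_path wpath_append wpath_unique by metis
  have R: "proj u al \<in> R" using generators_in_R(4,5)[OF al_path] R_mult by (simp add: proj_def)
  have keep: "proj u al * pe u es = pe u es" if "es \<in> ?B1" for es
  proof -
    from that obtain gs where gs: "es = al @ gs" "al @ gs \<in> B" by auto
    have "proj u al * pe u es = pe u al * pe v gs"
      using gh_pe_append(1)[OF al_path ext[OF gs(2)]] by (simp add: gs(1) proj_def mult.assoc)
    also have "\<dots> = pe u es" using pe_append[OF al_path ext[OF gs(2)]] gs by simp
    finally show ?thesis .
  qed
  have drop: "proj u al * pe u es = 0" if es: "es \<in> B - ?B1" for es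
  proof -
    have "\<nexists>gs. al = es @ gs"
    proof
      assume "\<exists>gs. al = es @ gs"
      then obtain gs where gs: "al = es @ gs" by blast
      then have "gs = []" using al(2)[of es] es by simp
      then show False using gs es by auto
    qed
    then have "gh u al * pe u es = 0" using gh_pe_cases[OF al_path path[of es]] es by blast
    then show ?thesis by (simp add: proj_def mult.assoc)
  qed
  have B1: "?B1 \<subseteq> B" "?B1 \<noteq> {}" using al(1) by auto
  have "?B1 = B" using rep n B1 R keep drop by (rule rep_left_mult(1))
  have notin: "proj u al * lc u k B * q v F \<notin> N"
    using rep n B1 R keep drop by (rule rep_left_mult(2))
  show B: "\<forall>es\<in>B. \<exists>gs. es = al @ gs" using \<open>?B1 = B\<close> by blast
  have inj: "inj_on (drop (length al)) B"
    by (rule inj_onI) (metis B append_eq_conv_conj)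
  then show "card (drop (length al) ` B) = n" using n by (simp add: card_image)
  let ?k = "\<lambda>gs. k (al @ gs)"
  have "gh u al * lc u k B = (\<Sum>es\<in>B. scl (?k (drop (length al) es)) (pe v (drop (length al) es)))"
    unfolding lc_def sum_distrib_left
  proof (intro sum.cong refl)
    fix es assume "es \<in> B"
    then obtain gs where gs: "es = al @ gs" "al @ gs \<in> B" using B by auto
    then show "gh u al * scl (k es) (pe u es) =
        scl (?k (drop (length al) es)) (pe v (drop (length al) es))"
      using gh_pe_append(1)[OF al_path ext[OF gs(2)]] by (simp add: scl_right)
  qed
  also have "\<dots> = lc v ?k (drop (length al) ` B)"
    by (simp add: lc_def sum.reindex[OF inj])
  finally have eq: "lc v ?k (drop (length al) ` B) * q v F = gh u al * ?x" by (simp only: mult.assoc[symmetric])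
  have "gh u al * ?x \<in> P" using is_idealD(6)[OF P x(1)] generators_in_R(5)[OF al_path] by blast
  moreover have "gh u al * ?x \<notin> N"
  proof
    assume "gh u al * ?x \<in> N"
    then have "pe u al * (gh u al * ?x) \<in> N"
      using is_idealD(6)[OF N] generators_in_R(4)[OF al_path] by blast
    then show False using notin by (simp add: proj_def mult.assoc)
  qed
  ultimately have "rep (P - N) v v F (drop (length al) ` B) ?k"
    using F fin B ext eq by (auto simp: rep_def)
  then show "\<exists>k'. rep (P - N) v v F (drop (length al) ` B) k'" by blast
qed

text \<open>The normal form reached by stripping a shortest path; the empty path plays the role of a
  constant term.\<close>

definition good :: "'v \<Rightarrow> 'e set \<Rightarrow> 'e list set \<Rightarrow> ('e list \<Rightarrow> 'k) \<Rightarrow> bool" where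
  "good v F B k \<longleftrightarrow> rep (P - N) v v F B k \<and> card B = n \<and> [] \<in> B"

lemma good_head_notin:
  assumes good: "good v F B k" and es: "e # es \<in> B"
  shows "e \<notin> F"
proof -
  have rep: "rep (P - N) v v F B k" "card B = n" "[] \<in> B" using good by (auto simp: good_def)
  have F: "valid v F" and path: "\<And>es. es \<in> B \<Longrightarrow> wpath v es v" using rep by (auto simp: rep_def)
  have mult: "q v F * pe v (f # fs) = (if f \<in> F then 0 else pe v (f # fs))" if "f # fs \<in> B" for f fs
    using q_pe_Cons[OF F path[OF that]] by simp
  let ?B0 = "{es \<in> B. es = [] \<or> hd es \<notin> F}"
  let ?x = "lc v k B * q v F"
  \<comment> \<open>\<open>q v F\<close> fixes the constant path only after multiplication by
    \<open>q v F\<close> on the right, so the splitting argument of \<open>rep_left_mult\<close> is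
    repeated with this weaker fact.\<close>
  have *: "q v F * pe v [] * q v F = pe v [] * q v F"
    using q_V[OF F] V_q[OF F] q_q[OF F] by simp
  have fin: "finite B" and x: "?x \<in> P" "?x \<notin> N" using rep(1) by (auto simp: rep_def)
  have "(q v F * lc v k B) * q v F = (\<Sum>es\<in>B. scl (k es) (q v F * pe v es * q v F))"
    by (simp add: lc_def sum_distrib_left sum_distrib_right scl_left scl_right)
  also have "\<dots> = (\<Sum>es\<in>B. if es = [] \<or> hd es \<notin> F then scl (k es) (pe v es * q v F) else 0)"
  proof (intro sum.cong refl)
    fix es assume "es \<in> B"
    then show "scl (k es) (q v F * pe v es * q v F) =
        (if es = [] \<or> hd es \<notin> F then scl (k es) (pe v es * q v F) else 0)"
    proof (cases es)
      case Nil
      then show ?thesis using * \<open>es \<in> B\<close> by simp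
    next
      case (Cons f fs)
      then show ?thesis using mult[of f fs] \<open>es \<in> B\<close> by auto
    qed
  qed
  also have "\<dots> = lc v k ?B0 * q v F"
    by (subst sum.inter_filter[OF fin, symmetric]) (simp add: lc_def sum_distrib_right scl_left)
  finally have eq: "q v F * ?x = lc v k ?B0 * q v F" by (simp add: mult.assoc)
  then have x1: "lc v k ?B0 * q v F \<in> P"
    using is_idealD(6)[OF P x(1) generators_in_R(6)[OF F]] by simp
  have x2: "lc v k (B - ?B0) * q v F = ?x - lc v k ?B0 * q v F"
    by (subst lc_Diff[OF fin]) (auto simp: left_diff_distrib)
  have reps: "rep P v v F (B - ?B0) k" "rep P v v F ?B0 k"
    using rep(1) x1 is_idealD(5)[OF P x(1) x1] fin x2 by (auto simp: rep_def)
  have "card (B - ?B0) < n"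
    using rep(2,3) fin by (intro order_less_le_trans[OF psubset_card_mono[of B]]) auto
  then have "lc v k (B - ?B0) * q v F \<in> N" using reps by (intro small_in_N)
  then have notin: "lc v k ?B0 * q v F \<notin> N" using x x2 is_idealD(3)[OF N] by fastforce
  then have "\<not> card ?B0 < n" using small_in_N[OF reps(2)] by blast
  moreover have "?B0 \<subseteq> B" by auto
  ultimately have "?B0 = B" using fin rep(2) by (metis psubset_card_mono psubsetI)
  then show ?thesis using es by fastforce
qed

text \<open>Appending \<open>e\<close> turns the empty path into \<open>[e]\<close>, now a shortest
  one. Stripping it shows that every nonempty path began with \<open>e\<close>, and moves that edge
  to the end.\<close>

lemma good_snoc:
  assumes good: "good v F B k" and e: "e \<in> arcs E" "tail E e = v" "e \<notin> F"
    and xe: "lc v k B * D e \<notin> N"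
  shows "\<forall>es\<in>B. es = [] \<or> hd es = e"
    and "\<exists>k'. good (head E e) {} ((\<lambda>es. drop 1 (es @ [e])) ` B) k'"
proof -
  have rep: "rep (P - N) v v F B k" "card B = n" "[] \<in> B" using good by (auto simp: good_def)
  have F: "valid v F" and path: "\<And>es. es \<in> B \<Longrightarrow> wpath v es v" using rep by (auto simp: rep_def)
  have fin: "finite B" and x: "lc v k B * q v F \<in> P" "lc v k B * q v F \<notin> N"
    using rep(1) by (auto simp: rep_def)
  let ?B = "(\<lambda>es. es @ [e]) ` B"
  have h: "head E e \<in> verts E" using e by simp
  have eq: "lc v k B * D e = lc v (k \<circ> butlast) ?B"
    using path e by (intro lc_snoc) auto
  have path': "\<forall>es\<in>?B. wpath v es (head E e)" using path path_snoc(3) e by auto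
  have "lc v k B * D e = lc v k B * q v F * D e" using q_D[OF F e(1,2)] e(3) by (simp add: mult.assoc)
  then have "lc v k B * D e \<in> P" using is_idealD(7)[OF P x(1)] generators_in_R(2)[OF e(1)] by simp
  moreover have "lc v k B * D e * V (head E e) = lc v k B * D e" by (simp add: mult.assoc DV e)
  ultimately have rep': "rep (P - N) v (head E e) {} ?B (k \<circ> butlast)"
    using xe eq fin path' h by (simp add: rep_def valid_empty)
  have card': "card ?B = n" using rep(2) by (simp add: card_image inj_on_def)
  have mem: "[e] \<in> ?B" using rep(3) by force
  have len: "\<And>es. es \<in> ?B \<Longrightarrow> length [e] \<le> length es" by auto
  have strip: "\<forall>es\<in>?B. \<exists>gs. es = [e] @ gs"
    using rep' card' mem len by (rule rep_strip_prefix(1))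
  have strip2: "\<exists>k'. rep (P - N) (head E e) (head E e) {} (drop (length [e]) ` ?B) k'"
    using rep' card' mem len by (rule rep_strip_prefix(2))
  have strip3: "card (drop (length [e]) ` ?B) = n"
    using rep' card' mem len by (rule rep_strip_prefix(3))
  show "\<forall>es\<in>B. es = [] \<or> hd es = e"
  proof
    fix es assume "es \<in> B"
    then have "\<exists>gs. es @ [e] = [e] @ gs" using strip by blast
    then show "es = [] \<or> hd es = e" by (cases es) auto
  qed
  have im: "drop (length [e]) ` ?B = (\<lambda>es. drop 1 (es @ [e])) ` B" by (simp add: image_image)
  have "[] \<in> (\<lambda>es. drop 1 (es @ [e])) ` B" using rep(3) by force
  then show "\<exists>k'. good (head E e) {} ((\<lambda>es. drop 1 (es @ [e])) ` B) k'"
    using strip2 strip3 unfolding im good_def by blast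
qed

text \<open>If \<open>D e\<close> carries the element into \<open>N\<close>, subtracting its
  multiple by \<open>D e * S e\<close> does not change it modulo \<open>N\<close>. So
  \<open>e\<close> may be added to \<open>F\<close>, and \<open>good_head_notin\<close>
  applies.\<close>

lemma good_snoc_in_N:
  assumes good: "good v F B k" and e: "e \<in> arcs E" "tail E e = v" "e \<notin> F"
    and xe: "lc v k B * D e \<in> N" and es: "e' # es \<in> B"
  shows "e' \<noteq> e"
proof -
  have rep: "rep (P - N) v v F B k" "card B = n" "[] \<in> B" using good by (auto simp: good_def)
  have F: "valid v F" using rep by (auto simp: rep_def)
  have x: "lc v k B * q v F \<in> P" "lc v k B * q v F \<notin> N"
    using rep(1) by (auto simp: rep_def)
  have "lc v k B * q v (insert e F) = lc v k B * q v F - lc v k B * D e * S e"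
    using q_insert[OF F e(3)] by (simp add: right_diff_distrib mult.assoc)
  moreover have "lc v k B * D e * S e \<in> N" using is_idealD(7)[OF N xe] generators_in_R(3)[OF e(1)] by blast
  moreover have "lc v k B * D e * S e \<in> P"
  proof -
    have "lc v k B * D e * S e = lc v k B * q v F * (D e * S e)"
      using q_D[OF F e(1,2)] e(3) by (simp add: mult.assoc[symmetric]) (simp add: mult.assoc)
    then show ?thesis using is_idealD(7)[OF P x(1)] generators_in_R(2,3)[OF e(1)] R_mult by metis
  qed
  ultimately have "lc v k B * q v (insert e F) \<in> P - N"
    using x is_idealD(5)[OF P] is_idealD(3)[OF N] by (metis Diff_iff diff_add_cancel)
  then have "good v (insert e F) B k"
    using rep valid_insert[OF F e(1,2)] by (auto simp: good_def rep_def)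
  then show ?thesis using good_head_notin es by blast
qed

text \<open>An element \<open>q v F\<close> of \<open>P\<close> lies in \<open>core P\<close> and so
  in \<open>N\<close>; this is where \<open>core_P\<close> enters.\<close>

lemma q_notin_P:
  assumes "valid v F" "y * q v F \<notin> N" "y \<in> R"
  shows "q v F \<notin> P"
  using q_in_core[of v F P] assms core_P is_idealD(6)[OF N] by blast

lemma good_coeff_Nil:
  assumes "good v F B k"
  shows "k [] \<noteq> 0"
proof
  assume "k [] = 0"
  have rep: "rep (P - N) v v F B k" "card B = n" "[] \<in> B" using assms by (auto simp: good_def)
  then have fin: "finite B" by (simp add: rep_def)
  have "lc v k B = lc v k (B - {[]})"
    unfolding lc_def using \<open>k [] = 0\<close> by (simp add: sum.remove[OF fin rep(3)])
  then have "rep (P - N) v v F (B - {[]}) k" using rep(1) by (auto simp: rep_def)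
  then show False using min fin rep(2,3) by (metis card_Diff1_less not_le)
qed

text \<open>With the empty path alone the element would be a nonzero multiple of
  \<open>q v F\<close>, against \<open>q_notin_P\<close>.\<close>

lemma good_nontrivial:
  assumes good: "good v F B k"
  obtains e es where "e # es \<in> B"
proof -
  have rep: "rep (P - N) v v F B k" "card B = n" "[] \<in> B" using good by (auto simp: good_def)
  have F: "valid v F" and path: "\<forall>es\<in>B. wpath v es v" using rep by (auto simp: rep_def)
  have x: "lc v k B * q v F \<in> P" "lc v k B * q v F \<notin> N" using rep(1) by (auto simp: rep_def)
  have "B \<noteq> {[]}"
  proof
    assume "B = {[]}"
    then have "lc v k B * q v F = scl (k []) (q v F)" by (simp add: lc_def scl_left V_q[OF F])
    then have "q v F \<in> P" using x(1) scl_cancel[OF P] good_coeff_Nil[OF good] by simp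
    then show False using q_notin_P[OF F x(2)] lc_in_R[OF path] by blast
  qed
  then obtain es where "es \<in> B" "es \<noteq> []" using rep(3) by blast
  then show thesis using that by (cases es) auto
qed

text \<open>A path beginning with \<open>e\<close> excludes the case of
  \<open>good_snoc_in_N\<close>, so \<open>good_snoc\<close> rotates all paths by one edge and
  empties \<open>F\<close>.\<close>

lemma good_rotate:
  assumes good: "good v F B k" and es: "e # es \<in> B"
  shows "\<exists>B' k'. good (head E e) {} B' k' \<and> es @ [e] \<in> B'"
    and "\<forall>es\<in>B. es = [] \<or> hd es = e"
proof -
  have "wpath v (e # es) v" using assms by (auto simp: good_def rep_def)
  then have e: "e \<in> arcs E" "tail E e = v" by auto
  have eF: "e \<notin> F" by (rule good_head_notin[OF good es])
  have xe: "lc v k B * D e \<notin> N" using good_snoc_in_N[OF good e eF _ es] by blast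
  show "\<forall>es\<in>B. es = [] \<or> hd es = e" using good_snoc(1)[OF good e eF xe] .
  obtain k' where "good (head E e) {} ((\<lambda>es. drop 1 (es @ [e])) ` B) k'"
    using good_snoc(2)[OF good e eF xe] by blast
  moreover have "es @ [e] \<in> (\<lambda>es. drop 1 (es @ [e])) ` B"
    by (rule image_eqI[OF _ es]) simp
  ultimately show "\<exists>B' k'. good (head E e) {} B' k' \<and> es @ [e] \<in> B'" by blast
qed

text \<open>All nonempty paths begin with \<open>e\<close>, so left multiplication by
  \<open>q v {e}\<close> kills everything but the constant term and leaves a nonzero multiple of
  \<open>q v {e}\<close> in \<open>P\<close>.\<close>

lemma good_no_exit:
  assumes good: "good v {} B k" and es: "e # es \<in> B"
  shows "q v {e} \<in> P"
proof -
  have rep: "rep (P - N) v v {} B k" "card B = n" "[] \<in> B" using good by (auto simp: good_def)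
  have fin: "finite B" and path: "\<And>es. es \<in> B \<Longrightarrow> wpath v es v" and x: "lc v k B * V v \<in> P"
    using rep by (auto simp: rep_def)
  have "e \<in> arcs E" "tail E e = v" using path[OF es] by auto
  then have valid: "valid v {e}" using valid_insert[OF valid_empty, of v e] tail_in_verts by blast
  have "q v {e} * lc v k B = (\<Sum>es\<in>B. if es = [] then scl (k []) (q v {e}) else 0)"
    unfolding lc_def sum_distrib_left
  proof (intro sum.cong refl)
    fix fs assume fs: "fs \<in> B"
    show "q v {e} * scl (k fs) (pe v fs) = (if fs = [] then scl (k []) (q v {e}) else 0)"
    proof (cases fs)
      case Nil
      then show ?thesis using q_V[OF valid] by (simp add: scl_right)
    next
      case (Cons f gs)
      then have "f = e" using good_rotate(2)[OF good es] fs by auto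
      then show ?thesis using q_pe_Cons[OF valid, of f gs v] path[OF fs] Cons by (simp add: scl_right)
    qed
  qed
  also have "\<dots> = scl (k []) (q v {e})" using fin rep(3) by simp
  finally have "q v {e} * (lc v k B * V v) * q v {e} = scl (k []) (q v {e})"
    using V_q[OF valid] q_q[OF valid] by (simp add: mult.assoc[symmetric] scl_left)
      (simp add: mult.assoc scl_left)
  then have "scl (k []) (q v {e}) \<in> P"
    using is_idealD(6,7)[OF P] x generators_in_R(6)[OF valid] by metis
  then show ?thesis using scl_cancel[OF P] good_coeff_Nil[OF good] by blast
qed

text \<open>Rotation brings each edge to the front in turn; \<open>fs\<close> collects the edges
  already moved to the end.\<close>

lemma good_no_exits:
  assumes "good v {} B k" "es @ fs \<in> B" "e \<in> set es"
  shows "q (tail E e) {e} \<in> P"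
  using assms
proof (induction es arbitrary: v B k fs)
  case (Cons f es)
  have f: "tail E f = v" using Cons.prems by (auto simp: good_def rep_def)
  obtain B' k' where B': "good (head E f) {} B' k'" "es @ (fs @ [f]) \<in> B'"
    using good_rotate(1)[OF Cons.prems(1), of f "es @ fs"] Cons.prems(2) by auto
  show ?case
  proof (cases "e = f")
    case True
    then show ?thesis using good_no_exit[OF Cons.prems(1), of f "es @ fs"] Cons.prems(2) f by auto
  next
    case False
    then show ?thesis using Cons.IH[OF B'] Cons.prems(3) by simp
  qed
qed simp

lemma rep_cycle:
  assumes rep: "rep (P - N) u v F B k" and n: "card B = n"
  shows "\<exists>w ga b. ga \<noteq> [] \<and> wpath w ga w \<and> (\<forall>e\<in>set ga. q (tail E e) {e} \<in> P) \<and>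
    b \<in> P - N \<and> V w * b = b \<and> b * V w = b"
proof -
  have "B \<noteq> {}"
  proof
    assume "B = {}"
    then have "0 \<in> P - N" using rep by (simp add: rep_def lc_def)
    then show False using is_idealD(2)[OF N] by simp
  qed
  then obtain al where al: "al \<in> B" "\<And>es. es \<in> B \<Longrightarrow> length al \<le> length es"
    using ex_has_least_nat[of "\<lambda>es. es \<in> B" _ length] by blast
  have "[] \<in> drop (length al) ` B" using al(1) by force
  then obtain B0 k0 where "good v F B0 k0"
    using rep_strip_prefix(2,3)[OF rep n al] by (auto simp: good_def)
  then obtain e es where "e # es \<in> B0" "good v F B0 k0" using good_nontrivial by blast
  \<comment> \<open>One rotation empties \<open>F\<close>, as \<open>good_no_exits\<close>
    requires.\<close>
  then obtain B k where good: "good (head E e) {} B k" using good_rotate(1) by blast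
  let ?w = "head E e"
  obtain f fs where f: "f # fs \<in> B" using good_nontrivial[OF good] by blast
  let ?b = "lc ?w k B * V ?w"
  have path: "\<forall>es\<in>B. wpath ?w es ?w" and b: "?b \<in> P - N" using good by (auto simp: good_def rep_def)
  then have w: "?w \<in> verts E" using f wpath_verts by blast
  have "V ?w * lc ?w k B = lc ?w k B"
    unfolding lc_def sum_distrib_left
    by (intro sum.cong) (use path V_pe in \<open>auto simp: scl_right\<close>)
  then have "V ?w * ?b = ?b" by (simp add: mult.assoc[symmetric])
  moreover have "?b * V ?w = ?b" by (simp add: mult.assoc VV w)
  moreover have "\<forall>g\<in>set (f # fs). q (tail E g) {g} \<in> P"
    using good_no_exits[OF good, of "f # fs" "[]"] f by auto
  moreover have "wpath ?w (f # fs) ?w" using path f by blast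
  ultimately show ?thesis
    using b by (intro exI[of _ ?w] exI[of _ "f # fs"] exI[of _ ?b] conjI) auto
qed

end

text \<open>Induction on the length \<open>d\<close> of ghost paths: multiplying by
  \<open>D e\<close> removes the rightmost ghost edge \<open>S e\<close>. If all these products fall
  into \<open>N\<close>, subtracting every \<open>a * D e * S e\<close> changes \<open>a\<close>
  only modulo \<open>N\<close> and leaves \<open>b * q v F\<close> with \<open>b\<close> free of
  ghost edges.\<close>

lemma rep_exists:
  assumes P: "is_ideal P" and N: "is_ideal N" and a: "a \<in> P" "a \<notin> N"
  shows "\<exists>u v F B k. rep (P - N) u v F B k"
proof -
  define T where "T d u v = span {pe u es * gh v fs | es fs x. wpath u es x \<and> wpath v fs x \<and> length fs \<le> d}"
    for d u v
  have T_mono: "T d u v \<subseteq> T d' u v" if "d \<le> d'" for d d' u v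
    unfolding T_def by (intro span_mono) (use that order_trans[of _ d d'] in blast)
  have T0: "T 0 u v \<subseteq> span {pe u es | es. wpath u es v}" for u v
    unfolding T_def by (intro span_mono) (auto simp: pe_V)
  have T0': "span {pe u es | es. wpath u es v} \<subseteq> T d u v" for u v d
    unfolding T_def
  proof (intro span_mono subsetI)
    fix x assume "x \<in> {pe u es | es. wpath u es v}"
    then obtain es where es: "x = pe u es" "wpath u es v" by blast
    then have "x = pe u es * gh v []" "wpath v [] v" using pe_V[OF es(2)] wpath_verts by auto
    then show "x \<in> {pe u es * gh v fs | es fs x. wpath u es x \<and> wpath v fs x \<and> length fs \<le> d}"
      using es by fastforce
  qed
  have TD: "b * D e \<in> T d u (head E e)" if "b \<in> T 0 u (tail E e)" "e \<in> arcs E" for b u e d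
  proof -
    have "b * D e \<in> span {pe u es | es. wpath u es (head E e)}"
    proof (rule span_mult'[of b "{pe u es | es. wpath u es (tail E e)}"])
      show "b \<in> span {pe u es | es. wpath u es (tail E e)}" using T0 that by blast
      fix m assume "m \<in> {pe u es | es. wpath u es (tail E e)}"
      then show "m * D e \<in> span {pe u es | es. wpath u es (head E e)}"
        using path_snoc[OF _ that(2)] by (auto intro!: span_base) metis
    qed
    then show ?thesis using T0' by blast
  qed
  \<comment> \<open>Terms are sorted by their rightmost ghost edge; those without one make up
    \<open>b\<close>. Setting \<open>g\<close> to 0 outside \<open>F\<close> allows the set of edges
    to be enlarged.\<close>
  have split: "\<exists>b\<in>T 0 u v. \<exists>F g. finite F \<and> F \<subseteq> out_arcs E v \<and> (\<forall>e. g e \<in> T d u (head E e)) \<and>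
      (\<forall>e. e \<notin> F \<longrightarrow> g e = 0) \<and> a = b + (\<Sum>e\<in>F. g e * S e)" if "a \<in> T (Suc d) u v" for a d u v
    using that unfolding T_def[of "Suc d"]
  proof (induction rule: span_induct_alt)
    case base
    then show ?case by (intro bexI[of _ 0] exI[of _ "{}"] exI[of _ "\<lambda>_. 0"]) (auto simp: T_def span_zero)
  next
    case (step c m a)
    obtain b F g where IH: "b \<in> T 0 u v" "finite F" "F \<subseteq> out_arcs E v" "\<forall>e. g e \<in> T d u (head E e)"
      "\<forall>e. e \<notin> F \<longrightarrow> g e = 0" "a = b + (\<Sum>e\<in>F. g e * S e)" using step by blast
    obtain es fs x where m: "m = pe u es * gh v fs" "wpath u es x" "wpath v fs x" "length fs \<le> Suc d"
      using step(1) by blast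
    show ?case
    proof (cases fs)
      case Nil
      then have "m \<in> T 0 u v" using m unfolding T_def by (fastforce intro: span_base)
      then have "scl c m + b \<in> T 0 u v" using IH(1) unfolding T_def by (intro span_add span_scale)
      then show ?thesis using IH by (intro bexI[of _ "scl c m + b"] exI[of _ F] exI[of _ g]) auto
    next
      case (Cons f fs')
      have f: "f \<in> out_arcs E v" "wpath (head E f) fs' x" using m(3) Cons by auto
      define t where "t = scl c (pe u es * gh (head E f) fs')"
      have t: "t \<in> T d u (head E f)"
        unfolding t_def T_def by (intro span_scale span_base) (use m f Cons in fastforce)
      have mt: "scl c m = t * S f" by (simp add: t_def m(1) Cons mult.assoc scl_left)
      let ?g = "\<lambda>e. if e = f then t + g f else g e"
      have "(\<Sum>e\<in>insert f F. ?g e * S e) = (\<Sum>e\<in>insert f F. (if e = f then t * S f else 0) + g e * S e)"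
        by (intro sum.cong) (auto simp: distrib_right)
      also have "\<dots> = t * S f + (\<Sum>e\<in>insert f F. g e * S e)"
        using IH(2) by (simp add: sum.distrib del: sum.insert_if)
      also have "(\<Sum>e\<in>insert f F. g e * S e) = (\<Sum>e\<in>F. g e * S e)"
        using IH(2,5) by (intro sum.mono_neutral_right) auto
      finally have "scl c m + a = b + (\<Sum>e\<in>insert f F. ?g e * S e)" using IH(6) mt by simp
      moreover have "\<forall>e. ?g e \<in> T d u (head E e)"
        using IH(4) t unfolding T_def by (auto intro: span_add)
      ultimately show ?thesis using IH f
        by (intro bexI[of _ b] exI[of _ "insert f F"] exI[of _ ?g]) auto
    qed
  qed
  have main: "\<exists>v F B k. rep (P - N) u v F B k" if "a \<in> T d u v" "a \<in> P" "a \<notin> N" "v \<in> verts E" for a d u v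
    using that
  proof (induction d arbitrary: a v)
    case 0
    then obtain B k where B: "finite B" "\<forall>es\<in>B. wpath u es v" "a = lc u k B"
      using T0 span_pe_lc[of a u v] by blast
    have "lc u k B * V v = lc u k B"
      unfolding lc_def sum_distrib_right
      by (intro sum.cong) (use B(2) pe_V in \<open>auto simp: scl_left\<close>)
    then have "rep (P - N) u v {} B k" using B 0 by (auto simp: rep_def valid_empty)
    then show ?case by blast
  next
    case (Suc d)
    obtain b F g where b: "b \<in> T 0 u v" "finite F" "F \<subseteq> out_arcs E v" "\<forall>e. g e \<in> T d u (head E e)"
      "a = b + (\<Sum>e\<in>F. g e * S e)" using split[OF Suc.prems(1)] by blast
    have F: "valid v F" using b Suc.prems by (simp add: valid_def)
    have arcs: "e \<in> arcs E" if "e \<in> F" for e using b(3) that by auto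
    have aD: "a * D e = b * D e + g e" if e: "e \<in> F" for e
    proof -
      have "(\<Sum>f\<in>F. g f * S f) * D e = (\<Sum>f\<in>F. if f = e then g e * V (head E e) else 0)"
        unfolding sum_distrib_right
        by (intro sum.cong) (use SD_if[OF arcs arcs] e in \<open>auto simp: mult.assoc\<close>)
      also have "\<dots> = g e * V (head E e)" using b(2) e by simp
      also have "\<dots> = g e"
      proof -
        have "g e * V (head E e) = id (g e)" using b(4)[rule_format, of e] unfolding T_def
        proof (induction rule: span_induct_alt)
          case (step c m x)
          then have "m * V (head E e) = m" by (auto simp: mult.assoc gh_V)
          then show ?case using step by (simp add: distrib_right scl_left)
        qed simp
        then show ?thesis by simp
      qed
      finally show ?thesis by (simp add: b(5) distrib_right)
    qed
    show ?case
    proof (cases "\<exists>e\<in>F. a * D e \<notin> N")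
      case True
      then obtain e where e: "e \<in> F" "a * D e \<notin> N" by blast
      then have e': "e \<in> arcs E" "tail E e = v" using b(3) by auto
      have "a * D e \<in> T d u (head E e)"
        using aD[OF e(1)] TD[of b u e d] b(1,4) e' unfolding T_def by (auto intro!: span_add)
      moreover have "a * D e \<in> P" using is_idealD(7)[OF P] Suc.prems(2) generators_in_R(2) e' by blast
      ultimately show ?thesis using Suc.IH[of "a * D e" "head E e"] e head_in_verts[OF e'(1)] by blast
    next
      case False
      have bV: "b * V v = b"
      proof -
        have "b * V v = id b" using b(1) unfolding T_def
        proof (induction rule: span_induct_alt)
          case (step c m x)
          then have "m * V v = m" by (auto simp: mult.assoc gh_V VV)
          then show ?case using step by (simp add: distrib_right scl_left)
        qed simp
        then show ?thesis by simp
      qed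
      have "b * q v F = b - (\<Sum>e\<in>F. b * D e * S e)"
        by (simp add: q_def right_diff_distrib sum_distrib_left bV mult.assoc)
      moreover have "(\<Sum>e\<in>F. a * D e * S e) = (\<Sum>e\<in>F. b * D e * S e) + (\<Sum>e\<in>F. g e * S e)"
        by (subst sum.distrib[symmetric], intro sum.cong) (auto simp: aD distrib_right)
      \<comment> \<open>The summands \<open>g e * S e\<close> of \<open>a\<close> cancel here, which
        removes the ghost part.\<close>
      ultimately have bq: "b * q v F = a - (\<Sum>e\<in>F. a * D e * S e)" using b(5) by simp
      have "(\<Sum>e\<in>F. a * D e * S e) \<in> N"
        by (rule is_ideal_sum[OF N], rule is_idealD(7)[OF N]) (use False generators_in_R(3) arcs in auto)
      moreover have "(\<Sum>e\<in>F. a * D e * S e) \<in> P"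
        by (rule is_ideal_sum[OF P], rule is_idealD(7)[OF P], rule is_idealD(7)[OF P])
          (use Suc.prems(2) generators_in_R(2,3) arcs in auto)
      ultimately have "b * q v F \<in> P - N"
        using bq Suc.prems(2,3) is_idealD(5)[OF P] is_idealD(3)[OF N] by (metis Diff_iff diff_add_cancel)
      moreover obtain B k where "finite B" "\<forall>es\<in>B. wpath u es v" "b = lc u k B"
        using T0 b(1) span_pe_lc[of b u v] by blast
      ultimately have "rep (P - N) u v F B k" using F by (auto simp: rep_def)
      then show ?thesis by blast
    qed
  qed
  \<comment> \<open>If all corners of \<open>a\<close> were in \<open>N\<close>, local units on both
    sides, expanded into monomials that begin and end at vertices, would put \<open>a\<close> in
    \<open>N\<close>.\<close>
  have decomp: "\<exists>u v. u \<in> verts E \<and> v \<in> verts E \<and> V u * a * V v \<notin> N"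
  proof (rule ccontr)
    assume no: "\<not> ?thesis"
    have spanN: "span N = N" using is_ideal_subspace[OF N] by simp
    have VaV: "V u * a * V v \<in> N" if "u \<in> verts E" "v \<in> verts E" for u v using no that by blast
    have Va: "V u * a \<in> N" if "u \<in> verts E" for u
    proof -
      obtain w where w: "w \<in> R" "a * w = a" using pure_R a(1) is_idealD(1)[OF P] unfolding pure_def by blast
      have "V u * a * w \<in> span N"
      proof (rule mult_span[OF w(1)[unfolded R_eq_span]])
        fix m assume "m \<in> {pe u es * gh v fs | u es v fs x. wpath u es x \<and> wpath v fs x}"
        then obtain u' es w fs x where m: "m = pe u' es * gh w fs" "wpath u' es x" "wpath w fs x"
          by blast
        have "V u * a * m = V u * a * V u' * m" using V_pe[OF m(2)] m(1) by (metis mult.assoc)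
        moreover have "m \<in> R" unfolding m(1) by (rule monomial_in_R[OF m(2,3)])
        ultimately show "V u * a * m \<in> span N"
          unfolding spanN using is_idealD(7)[OF N VaV[OF that wpath_verts(1)[OF m(2)]]] by simp
      qed
      then show ?thesis using w(2) spanN by (simp add: mult.assoc)
    qed
    obtain w where w: "w \<in> R" "w * a = a" using pure_R a(1) is_idealD(1)[OF P] unfolding pure_def by blast
    have "w * a \<in> span N"
    proof (rule span_mult'[OF w(1)[unfolded R_eq_span]])
      fix m assume "m \<in> {pe u es * gh v fs | u es v fs x. wpath u es x \<and> wpath v fs x}"
      then obtain u' es w fs x where m: "m = pe u' es * gh w fs" "wpath u' es x" "wpath w fs x"
        by blast
      have "m * a = m * (V w * a)" using gh_V[OF m(3)] m(1) by (metis mult.assoc)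
      moreover have "m \<in> R" unfolding m(1) by (rule monomial_in_R[OF m(2,3)])
      ultimately show "m * a \<in> span N"
        unfolding spanN using is_idealD(6)[OF N Va[OF wpath_verts(1)[OF m(3)]]] by simp
    qed
    then show False using w a spanN by simp
  qed
  obtain u v where uv: "u \<in> verts E" "v \<in> verts E" "V u * a * V v \<notin> N"
    using decomp by (elim exE conjE)
  have aR: "a \<in> R" using a is_idealD(1)[OF P] by blast
  have "\<exists>d. V u * a * V v \<in> T d u v"
    using aR unfolding R_eq_span
  proof (induction rule: span_induct_alt)
    case base
    then show ?case by (simp add: T_def span_zero)
  next
    case (step c m x)
    then obtain d where d: "V u * x * V v \<in> T d u v" by blast
    obtain u' es w fs y where m: "m = pe u' es * gh w fs" "wpath u' es y" "wpath w fs y"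
      using step(1) by blast
    have m': "V u * m * V v = (V u * pe u' es) * (gh w fs * V v)" by (simp add: m(1) mult.assoc)
    have "\<exists>d. V u * m * V v \<in> T d u v"
    proof (cases "u' = u \<and> w = v")
      case True
      then have "V u * m * V v = pe u es * gh v fs" "wpath u es y" "wpath v fs y"
        using V_pe[OF m(2)] gh_V[OF m(3)] m m' by auto
      then have "V u * m * V v \<in> T (length fs) u v" unfolding T_def by (auto intro!: span_base)
      then show ?thesis by blast
    next
      case False
      then have "V u * m * V v = 0"
        using V_pe_if[OF uv(1) m(2)] gh_V_if[OF uv(2) m(3)] m' by auto
      then show ?thesis by (simp add: T_def span_zero)
    qed
    then obtain d' where d': "V u * m * V v \<in> T d' u v" by blast
    have "V u * m * V v \<in> T (max d d') u v" "V u * x * V v \<in> T (max d d') u v"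
      using subsetD[OF T_mono d, of "max d d'"] subsetD[OF T_mono d', of "max d d'"] by auto
    then have "scl c (V u * m * V v) + V u * x * V v \<in> T (max d d') u v"
      unfolding T_def by (intro span_add span_scale)
    then have "V u * (scl c m + x) * V v \<in> T (max d d') u v"
      by (simp add: distrib_left distrib_right scl_left scl_right)
    then show ?case by blast
  qed
  then obtain d where "V u * a * V v \<in> T d u v" by blast
  moreover have "V u * a * V v \<in> P"
    by (intro is_idealD(6,7)[OF P] a(1) generators_in_R(1) uv)
  ultimately show ?thesis using main uv by blast
qed

text \<open>Take an element of \<open>P - N\<close> of the form \<open>b q\<close>, with \<open>b\<close> a combination of as few paths as
  possible. Stripping a shortest path and comparing \<open>b e\<close> with \<open>b (q - e e\<^sup>*)\<close> for each edge \<open>e\<close>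
  forces all remaining paths to run along one cycle, whose exits lie in \<open>P\<close>.\<close>

theorem reduction:
  assumes P: "is_ideal P" and N: "is_ideal N" and core: "core P \<subseteq> N" and a: "a \<in> P" "a \<notin> N"
  obtains w ga b where "ga \<noteq> []" "wpath w ga w" "\<forall>e\<in>set ga. q (tail E e) {e} \<in> P"
    "b \<in> P" "b \<notin> N" "V w * b = b" "b * V w = b"
proof -
  define realizes where "realizes n \<longleftrightarrow> (\<exists>u v F B k. rep (P - N) u v F B k \<and> card B = n)" for n
  obtain u0 v0 F0 B0 k0 where "rep (P - N) u0 v0 F0 B0 k0"
    using rep_exists[OF P N a] by (elim exE)
  then have "realizes (card B0)" unfolding realizes_def by blast
  define n where "n = (LEAST n. realizes n)"
  have "realizes n" unfolding n_def by (rule LeastI) fact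
  then obtain u v F B k where rep: "rep (P - N) u v F B k" "card B = n"
    unfolding realizes_def by blast
  have min: "n \<le> card B'" if "rep (P - N) u' v' F' B' k'" for u' v' F' B' k'
    unfolding n_def by (rule Least_le) (unfold realizes_def, use that in blast)
  have "\<exists>w ga b. ga \<noteq> [] \<and> wpath w ga w \<and> (\<forall>e\<in>set ga. q (tail E e) {e} \<in> P) \<and>
      b \<in> P - N \<and> V w * b = b \<and> b * V w = b"
    by (rule rep_cycle[OF P N core _ rep]) (rule min)
  then show thesis
  proof (elim exE conjE)
    fix w ga b
    assume "ga \<noteq> []" "wpath w ga w" "\<forall>e\<in>set ga. q (tail E e) {e} \<in> P" "b \<in> P - N"
      "V w * b = b" "b * V w = b"
    then show thesis by (intro that[of ga w b]) blast+
  qed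
qed

subsection \<open>Primes and the corner at a cycle\<close>

text \<open>\<open>?A\<close> collects the \<open>z\<close> with \<open>z R y\<close> inside
  \<open>P\<close>, and \<open>?B\<close> is the right annihilator of \<open>?A\<close> modulo
  \<open>P\<close>; both are ideals with product inside \<open>P\<close>. A local unit of
  \<open>y\<close>, in the place of 1, puts \<open>y\<close> in \<open>?B\<close>.\<close>

lemma is_prime_elem:
  assumes P: "is_prime P" and x: "x \<in> R" "x \<notin> P" and y: "y \<in> R" "y \<notin> P"
  obtains r where "r \<in> R" "x * r * y \<notin> P"
proof (rule ccontr)
  assume "\<not> thesis"
  then have xy: "x * r * y \<in> P" if "r \<in> R" for r using that \<open>\<And>r. r \<in> R \<Longrightarrow> x * r * y \<notin> P \<Longrightarrow> thesis\<close> by blast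
  note I = is_primeD(1)[OF P]
  let ?A = "{z \<in> R. \<forall>r\<in>R. z * r * y \<in> P}"
  let ?B = "{z \<in> R. \<forall>u\<in>?A. u * z \<in> P}"
  have A: "is_ideal ?A"
    unfolding is_ideal_def
  proof (intro conjI ballI)
    show "?A \<subseteq> R" by blast
    show "0 \<in> ?A" using R_zero is_idealD(2)[OF I] by simp
    fix z assume z: "z \<in> ?A"
    show "z + z' \<in> ?A" if "z' \<in> ?A" for z'
      using z that R_add is_idealD(3)[OF I] by (simp add: distrib_right)
    show "- z \<in> ?A" using z R_uminus is_idealD(4)[OF I] by simp
    fix r assume r: "r \<in> R"
    show "r * z \<in> ?A" using z r R_mult is_idealD(6)[OF I] by (simp add: mult.assoc)
    have "z * (r * r') * y \<in> P" if "r' \<in> R" for r' using z R_mult[OF r that] by blast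
    then show "z * r \<in> ?A" using z r R_mult by (simp add: mult.assoc)
  qed
  have B: "is_ideal ?B"
    unfolding is_ideal_def
  proof (intro conjI ballI)
    show "?B \<subseteq> R" by blast
    show "0 \<in> ?B" using R_zero is_idealD(2)[OF I] by simp
    fix z assume z: "z \<in> ?B"
    show "z + z' \<in> ?B" if "z' \<in> ?B" for z'
      using z that R_add is_idealD(3)[OF I] by (simp add: distrib_left)
    show "- z \<in> ?B" using z R_uminus is_idealD(4)[OF I] by simp
    fix r assume r: "r \<in> R"
    have "u * (r * z) \<in> P" if "u \<in> ?A" for u
      using z is_idealD(7)[OF A that r] by (simp add: mult.assoc[symmetric])
    then show "r * z \<in> ?B" using z r R_mult by blast
    have "u * (z * r) \<in> P" if "u \<in> ?A" for u
    proof -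
      have "u * z \<in> P" using z that by blast
      then show ?thesis using is_idealD(7)[OF I _ r] by (simp add: mult.assoc[symmetric])
    qed
    then show "z * r \<in> ?B" using z r R_mult by blast
  qed
  have "iprod ?A ?B \<subseteq> P"
  proof
    fix z assume "z \<in> iprod ?A ?B"
    then show "z \<in> P" by induction (use is_idealD(3)[OF I] in auto)
  qed
  then have "?A \<subseteq> P \<or> ?B \<subseteq> P" by (rule is_primeD(3)[OF P A B])
  moreover have "x \<in> ?A" using x xy by blast
  moreover have "y \<in> ?B"
  proof -
    obtain e where e: "e \<in> R" "e * y = y" using R_unit y by blast
    have "u * y \<in> P" if "u \<in> ?A" for u
    proof -
      have "u * e * y \<in> P" using that e by blast
      then show ?thesis using e by (simp add: mult.assoc)
    qed
    then show ?thesis using y by blast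
  qed
  ultimately show False using x y by blast
qed

text \<open>Membership of \<open>q (tail E e) {e}\<close> in \<open>P\<close> says that modulo
  \<open>P\<close> the projection \<open>D e * S e\<close> is the whole vertex, so every other edge
  leaving it dies in the quotient.\<close>

definition no_exit :: "'a set \<Rightarrow> 'e list \<Rightarrow> bool" where
  "no_exit P es \<longleftrightarrow> (\<forall>e\<in>set es. q (tail E e) {e} \<in> P)"

text \<open>At the first edge \<open>f\<close> where \<open>al\<close> leaves \<open>ga\<close>,
  compressing the exit element by \<open>f\<close> puts \<open>V (head E f)\<close> in
  \<open>P\<close>, and with it the end vertex of \<open>al\<close>.\<close>

lemma no_exit_prefix:
  assumes P: "is_ideal P" and "wpath u al x" "V x \<notin> P" "wpath u ga y" "no_exit P ga"
  shows "(\<exists>gs. ga = al @ gs) \<or> (\<exists>gs. al = ga @ gs)"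
  using assms(2-)
proof (induction al arbitrary: u ga)
  case (Cons f al)
  show ?case
  proof (cases ga)
    case (Cons e ga')
    have f: "f \<in> arcs E" "tail E f = u" "wpath (head E f) al x"
      and e: "e \<in> arcs E" "tail E e = u" "wpath (head E e) ga' y"
      using Cons.prems Cons by auto
    have "f = e"
    proof (rule ccontr)
      assume "f \<noteq> e"
      have valid: "valid u {e}" using e by (auto simp: valid_def)
      have "S f * q u {e} * D f \<in> P"
        using is_idealD(6,7)[OF P] generators_in_R(2,3) f Cons.prems(4) Cons e by (auto simp: no_exit_def)
      then have "V (head E f) \<in> P" using S_q[OF valid f(1,2)] \<open>f \<noteq> e\<close> SD[OF f(1)] by simp
      then have "gh (head E f) al * V (head E f) * pe (head E f) al \<in> P"
        using is_idealD(6,7)[OF P] generators_in_R(4,5)[OF f(3)] by blast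
      then show False using gh_V[OF f(3)] gh_pe[OF f(3)] Cons.prems(2) by simp
    qed
    moreover have "no_exit P ga'" using Cons.prems(4) Cons by (simp add: no_exit_def)
    ultimately show ?thesis using Cons.IH[OF f(3) Cons.prems(2), of ga'] e Cons by auto
  qed simp
qed simp

text \<open>The difference telescopes along the path: each edge contributes a conjugate of some
  \<open>q u {e}\<close>, which lies in \<open>core P\<close> and not merely in
  \<open>P\<close>.\<close>

lemma no_exit_unitary:
  assumes P: "is_ideal P" and "wpath u es v" "no_exit P es"
  shows "V u - pe u es * gh u es \<in> core P"
  using assms(2-)
proof (induction es arbitrary: u)
  case Nil
  then show ?case using is_idealD(2)[OF is_ideal_core[OF P]] by (auto simp: VV)
next
  case (Cons e es)
  let ?h = "head E e"
  have e: "e \<in> arcs E" "tail E e = u" "wpath ?h es v" "q u {e} \<in> P" "no_exit P es"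
    using Cons.prems by (auto simp: no_exit_def)
  have "valid u {e}" using e by (auto simp: valid_def)
  then have "q u {e} \<in> core P" by (rule q_in_core[OF e(4)])
  moreover have "D e * (V ?h - pe ?h es * gh ?h es) * S e \<in> core P"
    using is_idealD(6,7)[OF is_ideal_core[OF P]] Cons.IH[OF e(3,5)] generators_in_R(2,3)[OF e(1)] by blast
  moreover have "V u - pe u (e # es) * gh u (e # es) =
      q u {e} + D e * (V ?h - pe ?h es * gh ?h es) * S e"
    by (simp add: q_def right_diff_distrib left_diff_distrib mult.assoc[symmetric] DV[OF e(1)])
  ultimately show ?case using is_idealD(3)[OF is_ideal_core[OF P]] by simp
qed

section \<open>The corner at a vertex on a shortest closed path without exits\<close>

context
  fixes P :: "'a set" and w :: 'v and c :: "'e list"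
  assumes P: "is_ideal P" and w_notin: "V w \<notin> P"
    and c: "c \<noteq> []" "wpath w c w" "no_exit P c"
    and c_min: "\<And>c'. c' \<noteq> [] \<Longrightarrow> wpath w c' w \<Longrightarrow> no_exit P c' \<Longrightarrow> length c \<le> length c'"
begin

definition cyc :: "nat \<Rightarrow> 'e list" where
  "cyc n = concat (replicate n c)"

lemma w_vert: "w \<in> verts E"
  using wpath_verts c(2) by blast

lemma cyc_0 [simp]: "cyc 0 = []"
  and cyc_1: "cyc (Suc 0) = c"
  and cyc_Suc: "cyc (Suc n) = c @ cyc n"
  and cyc_add: "cyc (m + n) = cyc m @ cyc n"
  by (auto simp: cyc_def replicate_add)

lemma wpath_cyc: "wpath w (cyc n) w"
proof (induction n)
  case (Suc n)
  then show ?case using c(2) unfolding cyc_Suc wpath_append by blast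
qed (simp add: w_vert)

lemma no_exit_cyc: "no_exit P (cyc n)"
  by (induction n) (use c(3) in \<open>auto simp: cyc_Suc no_exit_def\<close>)

text \<open>By \<open>no_exit_prefix\<close> a closed path is an initial piece of \<open>c\<close>
  or starts with \<open>c\<close>. Minimal length of \<open>c\<close> excludes nonempty proper
  pieces, and full turns are removed by induction.\<close>

lemma closed_path_cyc: "wpath w al w \<Longrightarrow> \<exists>n. al = cyc n"
proof (induction "length al" arbitrary: al rule: less_induct)
  case less
  show ?case
  proof (cases "al = []")
    case True
    then show ?thesis by (intro exI[of _ 0]) simp
  next
    case False
    from no_exit_prefix[OF P less.prems w_notin c(2,3)] show ?thesis
    proof (elim disjE exE)
      fix gs assume gs: "c = al @ gs"
      then have "no_exit P al" using c(3) by (simp add: no_exit_def)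
      then have "length c \<le> length al" using c_min False less.prems by blast
      then have "al = c" using gs by simp
      then show ?thesis using cyc_1 by metis
    next
      fix gs assume gs: "al = c @ gs"
      then have "wpath w gs w" using less.prems c(2) wpath_append wpath_unique by metis
      then obtain n where "gs = cyc n" using less.hyps[of gs] gs c(1) by auto
      then show ?thesis using gs cyc_Suc by metis
    qed
  qed
qed

text \<open>A path ending outside \<open>P\<close> cannot leave the cycle, so the rest of the
  current turn leads back to \<open>w\<close>.\<close>

lemma return_path:
  assumes "wpath w al u" "V u \<notin> P"
  shows "\<exists>de. wpath u de w \<and> no_exit P de"
  using assms(1)
proof (induction "length al" arbitrary: al rule: less_induct)
  case less
  from no_exit_prefix[OF P less.prems assms(2) c(2,3)] show ?case
  proof (elim disjE exE)
    fix gs assume gs: "c = al @ gs"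
    then have "wpath u gs w" using less.prems c(2) wpath_append wpath_unique by metis
    then show ?thesis using gs c(3) by (auto simp: no_exit_def)
  next
    fix gs assume gs: "al = c @ gs"
    then have "wpath w gs u" using less.prems c(2) wpath_append wpath_unique by metis
    then show ?thesis using less.hyps[of gs] gs c(1) by auto
  qed
qed

text \<open>\<open>cp\<close> and \<open>cg\<close> are the powers of \<open>x\<close> and of its
  inverse in the corner: \<open>cg n * cp n\<close> is exactly \<open>V w\<close>, whereas
  \<open>cp n * cg n\<close> is \<open>V w\<close> only modulo \<open>core P\<close>.\<close>

definition cp :: "nat \<Rightarrow> 'a" where "cp n = pe w (cyc n)"
definition cg :: "nat \<Rightarrow> 'a" where "cg n = gh w (cyc n)"

lemma cp_add: "cp (m + n) = cp m * cp n"
  unfolding cp_def cyc_add by (rule pe_append[OF wpath_cyc wpath_cyc])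

lemma cg_cp: "cg n * cp n = V w"
  unfolding cp_def cg_def by (rule gh_pe[OF wpath_cyc])

lemma cp_0: "cp 0 = V w"
  by (simp add: cp_def)

lemma w_cp: "V w * cp n = cp n" "cp n * V w = cp n"
  unfolding cp_def by (rule V_pe[OF wpath_cyc] pe_V[OF wpath_cyc])+

lemma cp_cg: "V w - cp n * cg n \<in> core P"
  unfolding cp_def cg_def by (rule no_exit_unitary[OF P wpath_cyc no_exit_cyc])

lemma cyc_in_R: "cp n \<in> R" "cg n \<in> R" "V w \<in> R"
  unfolding cp_def cg_def
  by (rule generators_in_R(4,5)[OF wpath_cyc] generators_in_R(1)[OF w_vert])+

lemma cp_mult_cancel:
  assumes J: "is_ideal J" and "cp n * x \<in> J" "V w * x = x"
  shows "x \<in> J"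
proof -
  have "cg n * (cp n * x) \<in> J" using is_idealD(6)[OF J assms(2)] cyc_in_R by blast
  then show ?thesis using assms(3) by (simp add: mult.assoc[symmetric] cg_cp)
qed

text \<open>Evaluation at the cycle by Horner's rule; 1 goes to \<open>V w\<close>, the unit of the
  corner, and not to the unit of the ring type.\<close>

definition ev :: "'k poly \<Rightarrow> 'a" where
  "ev f = fold_coeffs (\<lambda>a x. scl a (V w) + cp 1 * x) f 0"

lemma ev_0 [simp]: "ev 0 = 0"
  by (simp add: ev_def)

lemma ev_pCons: "ev (pCons a f) = scl a (V w) + cp 1 * ev f"
  by (cases "a = 0 \<and> f = 0") (auto simp: ev_def fold_coeffs_pCons_eq)

lemma ev_add: "ev (f + g) = ev f + ev g"
  by (induction f g rule: poly_induct2) (simp_all add: ev_pCons distrib_left scale_left_distrib)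

lemma ev_smult: "ev (smult a f) = scl a (ev f)"
  by (induction f) (simp_all add: ev_pCons scale_right_distrib scl_right)

lemma w_ev: "V w * ev f = ev f"
  by (induction f) (simp_all add: ev_pCons distrib_left scl_right VV w_vert mult.assoc[symmetric] w_cp)

lemma ev_mult: "ev (f * g) = ev f * ev g"
  by (induction f)
    (simp_all add: ev_pCons ev_add ev_smult distrib_right scl_left w_ev mult.assoc)

lemma ev_monom: "ev (monom 1 n) = cp n"
  by (induction n) (simp_all add: monom_0 monom_Suc ev_pCons cp_0 cp_add[of 1, simplified, symmetric])

lemma ev_in_R: "ev f \<in> R"
  by (induction f) (auto simp: ev_pCons intro!: R_zero R_add R_scale R_mult cyc_in_R)

lemma ev_commute: "ev f * ev g = ev g * ev f"
  by (metis ev_mult mult.commute)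

text \<open>A monomial in the corner is zero or congruent to some \<open>cp i * cg j\<close>, and a
  high power of the cycle on the left clears the negative part. The inner claim covers all large
  \<open>n\<close> so that two summands can share an exponent.\<close>

lemma corner_polynomial:
  assumes "x \<in> R"
  obtains n f where "cp n * (V w * x * V w) - ev f \<in> core P"
proof -
  note G = is_ideal_core[OF P]
  have "\<exists>n0. \<forall>n\<ge>n0. \<exists>f. cp n * (V w * x * V w) - ev f \<in> core P"
    using assms unfolding R_eq_span
  proof (induction rule: span_induct_alt)
    case base
    have "cp n * (V w * 0 * V w) - ev 0 \<in> core P" for n using is_idealD(2)[OF G] by simp
    then show ?case by blast
  next
    case (step k m x)
    obtain n0 where n0: "\<forall>n\<ge>n0. \<exists>f. cp n * (V w * x * V w) - ev f \<in> core P" using step by blast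
    obtain u es v fs y where m: "m = pe u es * gh v fs" "wpath u es y" "wpath v fs y"
      using step(1) by blast
    have "\<exists>n0. \<forall>n\<ge>n0. \<exists>f. cp n * (V w * m * V w) - ev f \<in> core P"
    proof -
      have m': "V w * m * V w = (V w * pe u es) * (gh v fs * V w)" by (simp add: m(1) mult.assoc)
      \<comment> \<open>Monomials whose middle vertex \<open>y\<close> lies in \<open>P\<close>
        vanish modulo \<open>core P\<close>; the others can be completed to full turns of the
        cycle.\<close>
      consider "u \<noteq> w \<or> v \<noteq> w" | "u = w" "v = w" "V y \<in> P" | "u = w" "v = w" "V y \<notin> P" by blast
      then show ?thesis
      proof cases
        case 1
        then have "V w * m * V w = 0"
          using V_pe_if[OF w_vert m(2)] gh_V_if[OF w_vert m(3)] m' by auto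
        then have "cp n * (V w * m * V w) - ev 0 \<in> core P" for n using is_idealD(2)[OF G] by simp
        then show ?thesis by blast
      next
        case 2
        have "V y \<in> core P" using V_in_core[OF 2(3)] wpath_verts(2)[OF m(2)] .
        then have "pe u es * V y * gh v fs \<in> core P"
          using is_idealD(6,7)[OF G] generators_in_R(4)[OF m(2)] generators_in_R(5)[OF m(3)] by blast
        then have "m \<in> core P" using pe_V[OF m(2)] m(1) by simp
        then have "cp n * (V w * m * V w) - ev 0 \<in> core P" for n
          using is_idealD(6,7)[OF G] cyc_in_R by simp
        then show ?thesis by blast
      next
        case 3
        obtain de where de: "wpath y de w" "no_exit P de" using return_path[OF _ 3(3)] m(2) 3(1) by blast
        have paths: "wpath w (es @ de) w" "wpath w (fs @ de) w"
          using m(2,3) 3 de(1) by (auto simp: wpath_append)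
        obtain i j where ij: "es @ de = cyc i" "fs @ de = cyc j"
          using closed_path_cyc[OF paths(1)] closed_path_cyc[OF paths(2)] by blast
        \<comment> \<open>Inserting \<open>pe y de * gh y de\<close>, which equals
          \<open>V y\<close> modulo \<open>core P\<close>, closes both legs at
          \<open>w\<close>.\<close>
        have "pe w es * (V y - pe y de * gh y de) * gh w fs \<in> core P"
          using no_exit_unitary[OF P de] is_idealD(6,7)[OF G] generators_in_R(4)[OF m(2)]
            generators_in_R(5)[OF m(3)] 3 by blast
        moreover have "pe w es * (V y - pe y de * gh y de) * gh w fs = m - cp i * cg j"
          using pe_append[OF m(2) de(1)] gh_append[OF m(3) de(1)] 3 ij m(1) pe_V[OF m(2)]
          by (simp add: cp_def cg_def right_diff_distrib left_diff_distrib mult.assoc[symmetric])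
        ultimately have d: "m - cp i * cg j \<in> core P" by simp
        have VmV: "V w * m * V w = m" using V_pe[OF m(2)] gh_V[OF m(3)] m' m(1) 3 by simp
        have "cp n * (V w * m * V w) - ev (monom 1 (n - j + i)) \<in> core P" if "n \<ge> j" for n
        proof -
          have "cp n * cp i = cp (n - j + i) * cp j"
            using that by (simp add: cp_add[symmetric] add.commute)
          then have "cp n * m - cp (n - j + i) =
              cp n * (m - cp i * cg j) - cp (n - j + i) * (V w - cp j * cg j)"
            by (simp add: right_diff_distrib mult.assoc[symmetric] w_cp)
          also have "\<dots> \<in> core P"
            using is_idealD(6)[OF G d] is_idealD(6)[OF G cp_cg] cyc_in_R(1) is_idealD(5)[OF G] by blast
          finally show ?thesis unfolding VmV ev_monom .
        qed
        then show ?thesis by blast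
      qed
    qed
    then obtain n1 where n1: "\<forall>n\<ge>n1. \<exists>f. cp n * (V w * m * V w) - ev f \<in> core P" by blast
    have "\<exists>f. cp n * (V w * (scl k m + x) * V w) - ev f \<in> core P" if n: "n \<ge> max n0 n1" for n
    proof -
      obtain f where f: "cp n * (V w * x * V w) - ev f \<in> core P" using n0 n by auto
      obtain g where g: "cp n * (V w * m * V w) - ev g \<in> core P" using n1 n by auto
      have "scl k (cp n * (V w * m * V w) - ev g) + (cp n * (V w * x * V w) - ev f) \<in> core P"
        using is_ideal_scale[OF G g] f is_idealD(3)[OF G] by blast
      moreover have "scl k (cp n * (V w * m * V w) - ev g) + (cp n * (V w * x * V w) - ev f) =
          cp n * (V w * (scl k m + x) * V w) - ev (smult k g + f)"
        by (simp add: ev_add ev_smult scl_right scl_left distrib_left distrib_right scale_right_diff_distrib)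
      ultimately show ?thesis by metis
    qed
    then show ?case by blast
  qed
  then show thesis using that by blast
qed

text \<open>Primeness provides some \<open>r\<close> between the two factors. In the corner
  \<open>r\<close> becomes a polynomial after multiplication by a power of the cycle; polynomials
  commute, and the power cancels again.\<close>

lemma ev_prime:
  assumes "is_prime P" "ev f * ev g \<in> P"
  shows "ev f \<in> P \<or> ev g \<in> P"
proof (rule ccontr)
  assume "\<not> ?thesis"
  then obtain r where r: "r \<in> R" "ev f * r * ev g \<notin> P"
    using is_prime_elem[OF assms(1) ev_in_R _ ev_in_R, of f g] by blast
  obtain n h where h: "cp n * (V w * r * V w) - ev h \<in> core P" by (rule corner_polynomial[OF r(1)])
  then have "cp n * (V w * r * V w) - ev h \<in> P" using core_subset[OF P] by blast
  then have "ev f * (cp n * (V w * r * V w) - ev h) * ev g \<in> P"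
    using is_idealD(6,7)[OF P] ev_in_R by blast
  moreover have "ev h * (ev f * ev g) \<in> P" using is_idealD(6)[OF P assms(2)] ev_in_R by blast
  moreover have "ev f * (cp n * (V w * r * V w) - ev h) * ev g + ev h * (ev f * ev g) =
      cp n * (ev f * r * ev g)"
  proof -
    have w2: "ev f * V w = ev f" using ev_commute[of f "monom 1 0"] w_ev[of f] unfolding ev_monom cp_0 by simp
    have "ev f * (cp n * (V w * r * V w)) * ev g = (ev f * cp n) * V w * r * (V w * ev g)"
      by (simp add: mult.assoc)
    also have "ev f * cp n = cp n * ev f" using ev_commute[of f "monom 1 n"] by (simp add: ev_monom)
    finally have "ev f * (cp n * (V w * r * V w)) * ev g = cp n * (ev f * r * ev g)"
      by (simp add: w_ev mult.assoc) (metis w2 mult.assoc)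
    moreover have "ev f * ev h * ev g = ev h * (ev f * ev g)"
      by (metis ev_commute mult.assoc)
    ultimately show ?thesis by (simp add: right_diff_distrib left_diff_distrib)
  qed
  ultimately have "cp n * (ev f * r * ev g) \<in> P" using is_idealD(3)[OF P] by metis
  then have "ev f * r * ev g \<in> P"
    by (rule cp_mult_cancel[OF P]) (simp add: mult.assoc[symmetric] w_ev)
  then show False using r by blast
qed

text \<open>Modulo \<open>core P\<close> the corner at \<open>w\<close> is a localization of a quotient of \<open>K[x]\<close>, so the nonzero
  prime that \<open>P\<close> induces there is maximal.\<close>

lemma vertex_in_larger_ideal:
  assumes is_prime: "is_prime P" and b: "b \<in> P" "b \<notin> core P" "V w * b = b" "b * V w = b"
    and A: "is_ideal A" "P \<subset> A"
  shows "V w \<in> A"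
proof -
  note core_P = subsetD[OF core_subset[OF P]]
  obtain n g where "cp n * (V w * b * V w) - ev g \<in> core P"
    using corner_polynomial b(1) is_idealD(1)[OF P] by blast
  then have g: "cp n * b - ev g \<in> core P" by (simp add: b)
  have "g \<noteq> 0"
  proof
    assume "g = 0"
    then have "cp n * b \<in> core P" using g by simp
    then show False using cp_mult_cancel[OF is_ideal_core[OF P]] b by blast
  qed
  moreover have "ev g \<in> P"
    using is_idealD(5)[OF P _ core_P[OF g], of "cp n * b"] is_idealD(6)[OF P b(1)] cyc_in_R by simp
  ultimately have "\<exists>g. g \<noteq> 0 \<and> ev g \<in> P" by blast
  then obtain g where g: "g \<noteq> 0" "ev g \<in> P"
    and g_min: "\<And>h. h \<noteq> 0 \<Longrightarrow> ev h \<in> P \<Longrightarrow> degree g \<le> degree h"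
    using ex_has_least_nat[of "\<lambda>g. g \<noteq> 0 \<and> ev g \<in> P" _ degree] by blast
  \<comment> \<open>An element of \<open>A\<close> outside \<open>P\<close> is moved into the corner
    at \<open>w\<close>, staying outside \<open>P\<close>, by using primeness against
    \<open>V w\<close> on each side.\<close>
  obtain a where a: "a \<in> A" "a \<notin> P" using A(2) by blast
  have aR: "a \<in> R" using a is_idealD(1)[OF A(1)] by blast
  obtain r where r: "r \<in> R" "V w * r * a \<notin> P"
    using is_prime_elem[OF is_prime cyc_in_R(3) w_notin aR a(2)] by blast
  have raR: "V w * r * a \<in> R" using r aR cyc_in_R R_mult by blast
  obtain r' where r': "r' \<in> R" "V w * r * a * r' * V w \<notin> P"
    using is_prime_elem[OF is_prime raR r(2) cyc_in_R(3) w_notin] by blast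
  define a' where "a' = V w * r * a * r' * V w"
  have "a' \<in> A"
    unfolding a'_def using a(1) r(1) r'(1) cyc_in_R(3) by (intro is_idealD(6,7)[OF A(1)] R_mult)
  have w_a': "V w * a' * V w = a'"
    by (simp add: a'_def mult.assoc VV w_vert) (simp add: mult.assoc[symmetric] VV w_vert)
  obtain n f where f: "cp n * a' - ev f \<in> core P"
    using corner_polynomial[of a'] w_a' \<open>a' \<in> A\<close> is_idealD(1)[OF A(1)] by (metis subsetD)
  have "ev f \<in> A"
    using is_idealD(5)[OF A(1) _ subsetD[OF _ core_P[OF f]], of "cp n * a'"] A(2)
      is_idealD(6)[OF A(1) \<open>a' \<in> A\<close>] cyc_in_R by auto
  have "ev f \<notin> P"
  proof
    assume "ev f \<in> P"
    then have "cp n * a' \<in> P" using is_idealD(3)[OF P core_P[OF f]] by fastforce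
    then have "a' \<in> P" by (rule cp_mult_cancel[OF P]) (metis w_a' VV[OF w_vert] mult.assoc)
    then show False using r' by (simp add: a'_def)
  qed
  then have "f \<noteq> 0" using is_idealD(2)[OF P] by auto
  \<comment> \<open>Of least degree, \<open>d\<close> generates the ideal of polynomials that
    \<open>ev\<close> sends into \<open>A\<close>.\<close>
  then obtain d where d: "d \<noteq> 0" "ev d \<in> A"
    and d_min: "\<And>h. h \<noteq> 0 \<Longrightarrow> ev h \<in> A \<Longrightarrow> degree d \<le> degree h"
    using ex_has_least_nat[of "\<lambda>d. d \<noteq> 0 \<and> ev d \<in> A" f degree] \<open>ev f \<in> A\<close> by blast
  have d_dvd: "d dvd h" if "ev h \<in> A" for h
  proof (rule ccontr)
    assume "\<not> d dvd h"
    then have nz: "h mod d \<noteq> 0" by (simp add: dvd_eq_mod_eq_0)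
    have "h mod d = h + smult (-1) ((h div d) * d)" by (simp add: minus_div_mult_eq_mod[symmetric])
    then have "ev (h mod d) = ev h + scl (-1) (ev (h div d) * ev d)"
      by (simp only: ev_add ev_smult ev_mult)
    moreover have "ev (h div d) * ev d \<in> A" using is_idealD(6)[OF A(1) d(2)] ev_in_R by blast
    ultimately have "ev (h mod d) \<in> A" using that is_idealD(5)[OF A(1)] by simp
    then show False using d_min[OF nz] degree_mod_less'[OF d(1) nz] by simp
  qed
  obtain h where h: "g = d * h" using d_dvd g(2) A(2) by blast
  have "ev d \<notin> P"
  proof
    assume "ev d \<in> P"
    obtain k where "f = d * k" using d_dvd \<open>ev f \<in> A\<close> by blast
    then have "ev f \<in> P" using is_idealD(7)[OF P \<open>ev d \<in> P\<close>] ev_in_R by (simp add: ev_mult)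
    then show False using \<open>ev f \<notin> P\<close> by blast
  qed
  \<comment> \<open>\<open>P\<close> contains \<open>ev g = ev d * ev h\<close> but not
    \<open>ev d\<close>. As \<open>g\<close> has least degree in \<open>P\<close>, the factor
    \<open>d\<close> is left with degree 0, and a nonzero multiple of \<open>V w\<close> lies in
    \<open>A\<close>.\<close>
  then have "ev h \<in> P" using ev_prime[OF is_prime, of d h] g(2) h by (simp add: ev_mult)
  moreover have hd: "h \<noteq> 0" using g(1) h by auto
  ultimately have "degree g \<le> degree h" by (intro g_min)
  then have "degree d = 0" using degree_mult_eq[OF d(1) hd] h by simp
  then obtain k where k: "d = [:k:]" by (rule degree_eq_zeroE)
  then have "scl k (V w) \<in> A" "k \<noteq> 0" using d by (auto simp: ev_pCons)
  then show ?thesis using scl_cancel[OF A(1)] by blast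
qed

end

lemma prime_has_pure_cover:
  assumes is_prime: "is_prime P"
  shows "\<exists>M. pure M \<and> P \<subseteq> M \<and> (\<forall>A. is_ideal A \<longrightarrow> P \<subset> A \<longrightarrow> M \<subseteq> A)"
proof -
  note P = is_primeD(1)[OF is_prime]
  \<comment> \<open>Restricting to \<open>R\<close> makes \<open>J\<close> equal to \<open>R\<close>
    when no ideal lies strictly above \<open>P\<close>.\<close>
  define J where "J = {x \<in> R. \<forall>A. is_ideal A \<longrightarrow> P \<subset> A \<longrightarrow> x \<in> A}"
  have "P \<subseteq> J" using is_idealD(1)[OF P] by (auto simp: J_def)
  have J: "is_ideal J"
    unfolding is_ideal_def J_def using R_zero R_add R_uminus R_mult is_idealD(2,3,4,6,7) by auto
  let ?M = "core J"
  have "?M \<subseteq> A" if "is_ideal A" "P \<subset> A" for A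
    using core_subset[OF J] that unfolding J_def by blast
  moreover have "P \<subseteq> ?M"
  proof (rule ccontr)
    assume "\<not> P \<subseteq> ?M"
    then obtain a where a: "a \<in> P" "a \<notin> ?M" by blast
    obtain w ga b where w: "ga \<noteq> []" "wpath w ga w" "\<forall>e\<in>set ga. q (tail E e) {e} \<in> P"
      "b \<in> P" "b \<notin> ?M" "V w * b = b" "b * V w = b"
      by (rule reduction[OF P is_ideal_core[OF J] core_mono[OF \<open>P \<subseteq> J\<close>] a])
    have wv: "w \<in> verts E" using wpath_verts w(2) by blast
    have "V w \<notin> ?M"
    proof
      assume "V w \<in> ?M"
      then have "V w * b \<in> ?M" using is_idealD(7)[OF is_ideal_core[OF J]] w(4) is_idealD(1)[OF P] by blast
      then show False using w by simp
    qed
    then have "V w \<notin> J" using V_in_core wv by blast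
    then have "V w \<notin> P" using \<open>P \<subseteq> J\<close> by blast
    have "ga \<noteq> [] \<and> wpath w ga w \<and> no_exit P ga" using w by (simp add: no_exit_def)
    then obtain c where c: "c \<noteq> []" "wpath w c w" "no_exit P c"
      and c_min: "\<And>c'. c' \<noteq> [] \<Longrightarrow> wpath w c' w \<Longrightarrow> no_exit P c' \<Longrightarrow> length c \<le> length c'"
      using ex_has_least_nat[of "\<lambda>c. c \<noteq> [] \<and> wpath w c w \<and> no_exit P c" ga length] by blast
    have "b \<notin> core P" using w(5) core_mono[OF \<open>P \<subseteq> J\<close>] by blast
    have "V w \<in> A" if "is_ideal A" "P \<subset> A" for A
      by (rule vertex_in_larger_ideal[OF P \<open>V w \<notin> P\<close> c _ is_prime w(4) \<open>b \<notin> core P\<close> w(6,7) that])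
        (rule c_min)
    then have "V w \<in> J" using generators_in_R(1)[OF wv] by (simp add: J_def)
    then show False using \<open>V w \<notin> J\<close> by blast
  qed
  ultimately show ?thesis using pure_core[OF J] by blast
qed

sublocale pure_ideals_in R
  by unfold_locales (fact pure_R prime_has_pure_cover)+

end

section \<open>Linear endomorphisms of the free algebra\<close>

text \<open>A quotient \<open>K\<langle>X\<rangle> / N\<close> is not the universe of a type. It embeds into the endomorphism ring below:
  with a linear projection \<open>pr\<close> that kills \<open>N\<close>, let \<open>p\<close> act as \<open>y \<mapsto> pr (p * pr y)\<close>.\<close>

abbreviation const :: "'k::field \<Rightarrow> ('x, 'k) free_elem" where
  "const k \<equiv> Poly_Mapping.single 0 k"

lemma poly_mapping_eq_sum:
  "p = (\<Sum>w\<in>Poly_Mapping.keys p. Poly_Mapping.single w (Poly_Mapping.lookup p w))"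
  by (rule poly_mapping_eqI)
    (auto simp: lookup_sum lookup_single when_def sum.delta not_in_keys_iff_lookup_eq_zero)

lemma const_central: "const k * p = p * const k"
proof -
  have "const k * (\<Sum>w\<in>Poly_Mapping.keys p. Poly_Mapping.single w (Poly_Mapping.lookup p w)) =
      (\<Sum>w\<in>Poly_Mapping.keys p. Poly_Mapping.single w (Poly_Mapping.lookup p w)) * const k"
    unfolding sum_distrib_left sum_distrib_right
    by (intro sum.cong refl) (simp add: mult_single mult.commute)
  then show ?thesis by (simp add: poly_mapping_eq_sum[symmetric])
qed

lemma vector_space_free_elem: "vector_space (\<lambda>k p. const k * p)"
  by unfold_locales (simp_all add: distrib_left single_add distrib_right mult.assoc[symmetric] mult_single)

definition lin :: "(('x, 'k::field) free_elem \<Rightarrow> ('x, 'k) free_elem) \<Rightarrow> bool" where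
  "lin f \<longleftrightarrow> (\<forall>p q. f (p + q) = f p + f q) \<and> (\<forall>k p. f (const k * p) = const k * f p)"

lemma linD: "lin f \<Longrightarrow> f (p + q) = f p + f q" "lin f \<Longrightarrow> f (const k * p) = const k * f p"
  by (auto simp: lin_def)

lemma lin_0: "lin f \<Longrightarrow> f 0 = 0"
  using linD(1)[of f 0 0] by simp

lemma lin_minus: "lin f \<Longrightarrow> f (- p) = - f p"
  using linD(1)[of f p "- p"] lin_0[of f] by (simp add: eq_neg_iff_add_eq_0 add.commute)

lemma lin_diff: "lin f \<Longrightarrow> f (p - q) = f p - f q"
  using linD(1)[of f p "- q"] lin_minus[of f q] by simp

typedef (overloaded) ('x, 'k) lin_end = "{f :: ('x, 'k::field) free_elem \<Rightarrow> ('x, 'k) free_elem. lin f}"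
  morphisms app Lin_end
  by (rule exI[of _ "\<lambda>_. 0"]) (simp add: lin_def)

lemma lin_app: "lin (app f)"
  using app by auto

lemma app_Lin_end: "lin f \<Longrightarrow> app (Lin_end f) = f"
  by (simp add: Lin_end_inverse)

lemma lin_end_eqI: "(\<And>p. app f p = app g p) \<Longrightarrow> f = g"
  by (auto simp: app_inject[symmetric])

instantiation lin_end :: (type, field) ring_1
begin

definition "0 = Lin_end (\<lambda>_. 0)"
definition "1 = Lin_end (\<lambda>p. p)"
definition "f + g = Lin_end (\<lambda>p. app f p + app g p)"
definition "f - g = Lin_end (\<lambda>p. app f p - app g p)"
definition "- f = Lin_end (\<lambda>p. - app f p)"
definition "f * g = Lin_end (\<lambda>p. app f (app g p))"

lemma app_simps:
  "app 0 p = 0" "app 1 p = p" "app (f + g) p = app f p + app g p" "app (f - g) p = app f p - app g p"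
  "app (- f) p = - app f p" "app (f * g) p = app f (app g p)"
  unfolding zero_lin_end_def one_lin_end_def plus_lin_end_def minus_lin_end_def uminus_lin_end_def
    times_lin_end_def
  by (subst app_Lin_end; simp add: lin_def linD[OF lin_app] algebra_simps)+

instance
proof
  have "app 0 1 \<noteq> app (1 :: ('a, 'b) lin_end) 1" by (simp add: app_simps)
  then show "(0 :: ('a, 'b) lin_end) \<noteq> 1" by auto
qed (rule lin_end_eqI, simp add: app_simps linD[OF lin_app])+

end

definition scl_end :: "'k::field \<Rightarrow> ('x, 'k) lin_end \<Rightarrow> ('x, 'k) lin_end" where
  "scl_end k f = Lin_end (\<lambda>p. const k * app f p)"

lemma const_left_commute: "const k * (const l * q) = const l * (const k * q)"
  by (simp add: mult.assoc[symmetric] mult_single mult.commute)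

lemma app_scl_end: "app (scl_end k f) p = const k * app f p"
  unfolding scl_end_def
  by (subst app_Lin_end) (simp_all add: lin_def linD[OF lin_app] distrib_left const_left_commute)

lemma vector_space_scl_end: "vector_space (scl_end :: 'k::field \<Rightarrow> ('x, 'k) lin_end \<Rightarrow> _)"
  by unfold_locales
    (rule lin_end_eqI, simp add: app_scl_end app_simps distrib_left single_add distrib_right
      mult.assoc[symmetric] mult_single)+

lemma scl_end_mult: "scl_end k f * g = scl_end k (f * g)" "f * scl_end k g = scl_end k (f * g)"
  by (rule lin_end_eqI, simp add: app_scl_end app_simps linD[OF lin_app])+

text \<open>A basis of \<open>N\<close> is extended to one of \<open>C\<close> and then to one of
  the whole space; \<open>pr\<close> keeps the vectors added in the middle step and kills the rest.
  This is a linear choice of representatives of \<open>C\<close> modulo \<open>N\<close>.\<close>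

lemma linear_projection:
  fixes N C :: "('x, 'k::field) free_elem set"
  assumes N: "module.subspace (\<lambda>k p. const k * p) N" and C: "module.subspace (\<lambda>k p. const k * p) C"
    and NC: "N \<subseteq> C"
  obtains pr where "lin pr" "\<And>p. pr p \<in> C" "\<And>p. p \<in> C \<Longrightarrow> pr p - p \<in> N" "\<And>p. p \<in> N \<Longrightarrow> pr p = 0"
proof -
  interpret vs: vector_space "\<lambda>k (p :: ('x, 'k) free_elem). const k * p"
    by (rule vector_space_free_elem)
  interpret vp: vector_space_pair "\<lambda>k (p :: ('x, 'k) free_elem). const k * p"
    "\<lambda>k (p :: ('x, 'k) free_elem). const k * p" ..
  obtain B1 where B1: "B1 \<subseteq> N" "vs.independent B1" "N \<subseteq> vs.span B1"
    using vs.maximal_independent_subset[of N] by blast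
  obtain B2 where B2: "B1 \<subseteq> B2" "B2 \<subseteq> C" "vs.independent B2" "C \<subseteq> vs.span B2"
    using vs.maximal_independent_subset_extend[OF subset_trans[OF B1(1) NC] B1(2)] .
  obtain B3 where B3: "B2 \<subseteq> B3" "vs.independent B3" "UNIV \<subseteq> vs.span B3"
    using vs.maximal_independent_subset_extend[OF subset_UNIV B2(3)] .
  obtain pr where pr: "Vector_Spaces.linear (\<lambda>k p. const k * p) (\<lambda>k p. const k * p) pr"
    "\<forall>b\<in>B3. pr b = (if b \<in> B2 - B1 then b else 0)"
    using vp.linear_independent_extend[OF B3(2), of "\<lambda>b. if b \<in> B2 - B1 then b else 0"] by blast
  interpret l: Vector_Spaces.linear "\<lambda>k p. const k * p" "\<lambda>k p. const k * p" pr by (rule pr(1))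
  show thesis
  proof (rule that)
    show "lin pr" by (simp add: lin_def l.add l.scale)
    show "pr p \<in> C" for p
    proof -
      have "p \<in> vs.span B3" using B3(3) by blast
      then show ?thesis
      proof (induction rule: vs.span_induct_alt)
        case base
        then show ?case using vs.subspace_0[OF C] by (simp add: l.zero)
      next
        case (step k b p)
        have "pr b \<in> C" using pr(2) step(1) B2(2) vs.subspace_0[OF C] by auto
        then show ?case
          using step vs.subspace_add[OF C] vs.subspace_scale[OF C] by (simp add: l.add l.scale)
      qed
    qed
    show "pr p - p \<in> N" if "p \<in> C" for p
    proof -
      have "p \<in> vs.span B2" using B2(4) that by blast
      then show ?thesis
      proof (induction rule: vs.span_induct_alt)
        case base
        then show ?case using vs.subspace_0[OF N] by (simp add: l.zero)
      next
        case (step k b p)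
        have "pr b = (if b \<in> B1 then 0 else b)" using pr(2) step(1) B3(1) by auto
        then have "pr b - b \<in> N"
          using B1(1) vs.subspace_0[OF N] vs.subspace_neg[OF N, of b] by auto
        then have "const k * (pr b - b) + (pr p - p) \<in> N"
          using step vs.subspace_add[OF N] vs.subspace_scale[OF N] by blast
        then show ?case by (simp add: l.add l.scale algebra_simps)
      qed
    qed
    show "pr p = 0" if "p \<in> N" for p
    proof -
      have "p \<in> vs.span B1" using B1(3) that by blast
      then show ?thesis
      proof (induction rule: vs.span_induct_alt)
        case (step k b p)
        have "pr b = 0" using pr(2) step(1) B2(1) B3(1) by auto
        then show ?case using step by (simp add: l.add l.scale)
      qed (simp add: l.zero)
    qed
  qed
qed

section \<open>Representing a presented algebra by endomorphisms\<close>

locale represented_quotient =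
  fixes X :: "'x set" and N :: "('x, 'k::field) free_elem set"
    and pr :: "('x, 'k) free_elem \<Rightarrow> ('x, 'k) free_elem"
  assumes N: "ideal N (free_algebra X)"
    and lin_pr: "lin pr"
    and pr_in: "pr p \<in> carrier (free_algebra X)"
    and pr_diff: "p \<in> carrier (free_algebra X) \<Longrightarrow> pr p - p \<in> N"
    and pr_0: "p \<in> N \<Longrightarrow> pr p = 0"
begin

abbreviation "C \<equiv> carrier (free_algebra X) :: ('x, 'k) free_elem set"

interpretation F: ring "free_algebra X :: ('x, 'k) free_elem ring"
  by (rule ring_free_algebra)

interpretation N: ideal N "free_algebra X :: ('x, 'k) free_elem ring"
  by (rule N)

lemma C_closed: "p \<in> C \<Longrightarrow> p' \<in> C \<Longrightarrow> p * p' \<in> C" "p \<in> C \<Longrightarrow> p' \<in> C \<Longrightarrow> p + p' \<in> C" "1 \<in> C"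
  using F.m_closed[of p p'] F.a_closed[of p p'] F.one_closed by simp_all

lemma const_in_C: "const k \<in> C"
  by (simp add: mem_carrier_free_algebra zero_fword_def)

lemma N_mult: "n \<in> N \<Longrightarrow> p \<in> C \<Longrightarrow> p * n \<in> N" "n \<in> N \<Longrightarrow> p \<in> C \<Longrightarrow> n * p \<in> N"
  using N.I_l_closed[of n p] N.I_r_closed[of n p] by simp_all

text \<open>The inner \<open>pr\<close> brings an arbitrary argument into \<open>C\<close>, the ring
  in which \<open>N\<close> is an ideal.\<close>

definition rp :: "('x, 'k) free_elem \<Rightarrow> ('x, 'k) lin_end" where
  "rp p = Lin_end (\<lambda>y. pr (p * pr y))"

lemma app_rp: "app (rp p) y = pr (p * pr y)"
proof -
  have "p * (const k * y) = const k * (p * y)" for k y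
    by (metis const_central mult.assoc)
  then show ?thesis
    unfolding rp_def
    by (subst app_Lin_end) (simp_all add: lin_def linD[OF lin_pr] distrib_left)
qed

lemma pr_mult_pr: "p \<in> C \<Longrightarrow> z \<in> C \<Longrightarrow> pr (p * pr z) = pr (p * z)"
  using lin_diff[OF lin_pr, of "p * pr z" "p * z"] pr_0[OF N_mult(1)[OF pr_diff, of z p]]
  by (simp add: right_diff_distrib)

lemma rp_add: "rp (p + p') = rp p + rp p'"
  by (rule lin_end_eqI) (simp add: app_rp app_simps distrib_right linD[OF lin_pr])

lemma rp_uminus: "rp (- p) = - rp p"
  by (rule lin_end_eqI) (simp add: app_rp app_simps lin_minus[OF lin_pr])

lemma rp_diff: "rp (p - p') = rp p - rp p'"
  by (rule lin_end_eqI) (simp add: app_rp app_simps left_diff_distrib lin_diff[OF lin_pr])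

lemma rp_0: "rp 0 = 0"
  by (rule lin_end_eqI) (simp add: app_rp app_simps lin_0[OF lin_pr])

lemma rp_sum: "rp (\<Sum>i\<in>I. f i) = (\<Sum>i\<in>I. rp (f i))"
  by (induction I rule: infinite_finite_induct) (simp_all add: rp_0 rp_add)

lemma rp_const: "rp (const k * p) = scl_end k (rp p)"
  by (rule lin_end_eqI) (simp add: app_rp app_scl_end mult.assoc linD[OF lin_pr])

lemma rp_mult: "p \<in> C \<Longrightarrow> p' \<in> C \<Longrightarrow> rp (p * p') = rp p * rp p'"
proof (rule lin_end_eqI)
  fix y assume p: "p \<in> C" "p' \<in> C"
  then have "pr (p * pr (pr (p' * pr y))) = pr (p * (p' * pr y))"
    using pr_mult_pr pr_in C_closed(1) by simp
  then show "app (rp (p * p')) y = app (rp p * rp p') y" by (simp add: app_rp app_simps mult.assoc)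
qed

text \<open>The action is faithful modulo \<open>N\<close> because its value at 1 is
  \<open>pr p\<close>, and within \<open>C\<close> the kernel of \<open>pr\<close> is
  \<open>N\<close>.\<close>

lemma rp_eq_0_iff:
  assumes p: "p \<in> C"
  shows "rp p = 0 \<longleftrightarrow> p \<in> N"
proof
  assume "p \<in> N"
  then show "rp p = 0"
    by (intro lin_end_eqI) (simp add: app_rp app_simps pr_0 N_mult(2) pr_in)
next
  assume "rp p = 0"
  then have "pr (p * pr 1) = 0" using app_rp[of p 1] by (simp add: app_simps)
  then have "pr p = 0" using pr_mult_pr[OF p C_closed(3)] by simp
  then have "- p \<in> N" using pr_diff[OF p] by simp
  then show "p \<in> N" using N_mult(1)[of "- p" "- 1"] F.a_inv_closed[OF F.one_closed] C_closed(3)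
    by (simp add: mem_carrier_free_algebra)
qed

lemma C_uminus: "p \<in> C \<Longrightarrow> - p \<in> C"
  by (simp add: mem_carrier_free_algebra)

lemma rp_eq_iff: "p \<in> C \<Longrightarrow> p' \<in> C \<Longrightarrow> rp p = rp p' \<longleftrightarrow> p - p' \<in> N"
  using rp_eq_0_iff[of "p - p'"] C_closed(2)[of p "- p'"] C_uminus[of p'] by (simp add: rp_diff)

lemma coset_eq_iff:
  assumes "p \<in> C" "p' \<in> C"
  shows "N +>\<^bsub>free_algebra X\<^esub> p = N +>\<^bsub>free_algebra X\<^esub> p' \<longleftrightarrow> p - p' \<in> N"
proof
  assume "N +>\<^bsub>free_algebra X\<^esub> p = N +>\<^bsub>free_algebra X\<^esub> p'"
  then have "p \<in> N +>\<^bsub>free_algebra X\<^esub> p'" using N.a_rcos_self[OF assms(1)] by simp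
  then show "p - p' \<in> N" by (auto simp: a_r_coset_def')
next
  assume "p - p' \<in> N"
  then have "p \<in> N +>\<^bsub>free_algebra X\<^esub> p'" by (force simp: a_r_coset_def')
  then show "N +>\<^bsub>free_algebra X\<^esub> p = N +>\<^bsub>free_algebra X\<^esub> p'"
    using N.a_repr_independence'[OF _ assms(2)] by simp
qed

text \<open>The choice of representative does not matter: equal cosets and equal values of
  \<open>rp\<close> both mean that the difference lies in \<open>N\<close>.\<close>

definition coset_rp :: "('x, 'k) free_elem set \<Rightarrow> ('x, 'k) lin_end" where
  "coset_rp c = rp (SOME p. p \<in> C \<and> c = N +>\<^bsub>free_algebra X\<^esub> p)"

lemma coset_rp: 
  assumes "p \<in> C"
  shows "coset_rp (N +>\<^bsub>free_algebra X\<^esub> p) = rp p"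
proof -
  define p' where "p' = (SOME p'. p' \<in> C \<and> N +>\<^bsub>free_algebra X\<^esub> p = N +>\<^bsub>free_algebra X\<^esub> p')"
  have "p' \<in> C \<and> N +>\<^bsub>free_algebra X\<^esub> p = N +>\<^bsub>free_algebra X\<^esub> p'"
    unfolding p'_def by (rule someI[of _ p]) (use assms in simp)
  then have "rp p = rp p'" using coset_eq_iff rp_eq_iff assms by blast
  then show ?thesis by (simp add: coset_rp_def p'_def)
qed

text \<open>Shaped so that for the Leavitt relations it unfolds to the same record as
  \<open>leavitt_path_algebra E\<close>.\<close>

definition quotient_aug :: "('x, 'k) free_elem set ring" where
  "quotient_aug = (free_algebra X Quot N)
     \<lparr>carrier := (\<lambda>p. N +>\<^bsub>free_algebra X\<^esub> p) ` free_augmentation X\<rparr>"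

abbreviation "aug \<equiv> free_augmentation X :: ('x, 'k) free_elem set"

lemma aug_subset: "p \<in> aug \<Longrightarrow> p \<in> C"
  by (simp add: free_augmentation_def)

lemma aug_0_notin_keys: "p \<in> aug \<Longrightarrow> 0 \<notin> Poly_Mapping.keys p"
  unfolding free_augmentation_def in_keys_iff by blast

lemma aug_closed: "0 \<in> aug" "p \<in> aug \<Longrightarrow> p' \<in> aug \<Longrightarrow> p + p' \<in> aug"
  "p \<in> aug \<Longrightarrow> - p \<in> aug" "p \<in> aug \<Longrightarrow> p' \<in> C \<Longrightarrow> p' * p \<in> aug"
proof -
  show "0 \<in> aug" by (simp add: free_augmentation_def mem_carrier_free_algebra)
  show "p \<in> aug \<Longrightarrow> p' \<in> aug \<Longrightarrow> p + p' \<in> aug"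
    using C_closed(2) by (simp add: free_augmentation_def lookup_add)
  show "p \<in> aug \<Longrightarrow> - p \<in> aug" by (simp add: free_augmentation_def mem_carrier_free_algebra)
  show "p' * p \<in> aug" if "p \<in> aug" "p' \<in> C"
  proof -
    have "0 \<notin> Poly_Mapping.keys (p' * p)"
    proof
      assume "0 \<in> Poly_Mapping.keys (p' * p)"
      then obtain a b where "0 = a + b" "b \<in> Poly_Mapping.keys p"
        using Poly_Mapping.keys_mult[of p' p] by blast
      then have "0 \<in> Poly_Mapping.keys p" by (cases b) (simp add: zero_fword_def plus_fword_def)
      then show False using aug_0_notin_keys[OF that(1)] by contradiction
    qed
    then have "Poly_Mapping.lookup (p' * p) 0 = 0" by (simp only: in_keys_iff not_not)
    then show ?thesis using C_closed(1)[OF that(2) aug_subset[OF that(1)]] by (simp add: free_augmentation_def)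
  qed
qed

lemma rp_aug_closed:
  "0 \<in> rp ` aug" "a \<in> rp ` aug \<Longrightarrow> b \<in> rp ` aug \<Longrightarrow> a + b \<in> rp ` aug"
  "a \<in> rp ` aug \<Longrightarrow> - a \<in> rp ` aug" "a \<in> rp ` aug \<Longrightarrow> b \<in> rp ` aug \<Longrightarrow> a * b \<in> rp ` aug"
  "a \<in> rp ` aug \<Longrightarrow> scl_end k a \<in> rp ` aug"
proof -
  show "0 \<in> rp ` aug" by (rule image_eqI[of _ _ 0]) (simp_all add: rp_0 aug_closed)
  assume "a \<in> rp ` aug"
  then obtain p where p: "a = rp p" "p \<in> aug" by blast
  show "- a \<in> rp ` aug" by (rule image_eqI[of _ _ "- p"]) (simp_all add: p rp_uminus aug_closed)
  show "scl_end k a \<in> rp ` aug"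
    by (rule image_eqI[of _ _ "const k * p"]) (simp_all add: p rp_const aug_closed const_in_C)
  assume "b \<in> rp ` aug"
  then obtain p' where p': "b = rp p'" "p' \<in> aug" by blast
  show "a + b \<in> rp ` aug"
    by (rule image_eqI[of _ _ "p + p'"]) (simp_all add: p p' rp_add aug_closed)
  show "a * b \<in> rp ` aug"
    by (rule image_eqI[of _ _ "p * p'"]) (simp_all add: p p' rp_mult aug_closed aug_subset)
qed

lemma ring_image_coset_rp: "ring_image (rp ` aug) quotient_aug coset_rp"
proof unfold_locales
  show "0 \<in> rp ` aug" by (rule rp_aug_closed)
  show "x + y \<in> rp ` aug" if "x \<in> rp ` aug" "y \<in> rp ` aug" for x y
    using that by (rule rp_aug_closed)
  show "- x \<in> rp ` aug" if "x \<in> rp ` aug" for x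
    using that by (rule rp_aug_closed)
  show "x * y \<in> rp ` aug" if "x \<in> rp ` aug" "y \<in> rp ` aug" for x y
    using that by (rule rp_aug_closed)
  have carrier: "carrier quotient_aug = (\<lambda>p. N +>\<^bsub>free_algebra X\<^esub> p) ` aug"
    by (simp add: quotient_aug_def)
  have ops: "\<zero>\<^bsub>quotient_aug\<^esub> = N +>\<^bsub>free_algebra X\<^esub> 0"
    "(N +>\<^bsub>free_algebra X\<^esub> p) \<oplus>\<^bsub>quotient_aug\<^esub> (N +>\<^bsub>free_algebra X\<^esub> p') = N +>\<^bsub>free_algebra X\<^esub> (p + p')"
    "(N +>\<^bsub>free_algebra X\<^esub> p) \<otimes>\<^bsub>quotient_aug\<^esub> (N +>\<^bsub>free_algebra X\<^esub> p') = N +>\<^bsub>free_algebra X\<^esub> (p * p')"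
    if "p \<in> C" "p' \<in> C" for p p'
    using N.a_rcos_sum[OF that] N.rcoset_mult_add[OF that]
    by (auto simp: quotient_aug_def FactRing_def a_r_coset_def')
  show "inj_on coset_rp (carrier quotient_aug)"
  proof (rule inj_onI)
    fix x y assume "x \<in> carrier quotient_aug" "y \<in> carrier quotient_aug" and eq: "coset_rp x = coset_rp y"
    then obtain p p' where p: "x = N +>\<^bsub>free_algebra X\<^esub> p" "y = N +>\<^bsub>free_algebra X\<^esub> p'" "p \<in> C" "p' \<in> C"
      using aug_subset unfolding carrier by blast
    then have "rp p = rp p'" using eq by (simp add: coset_rp)
    then show "x = y" using p coset_eq_iff rp_eq_iff by blast
  qed
  show "coset_rp ` carrier quotient_aug = rp ` aug"
    unfolding carrier image_image by (intro image_cong refl) (simp add: coset_rp aug_subset)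
  show "\<zero>\<^bsub>quotient_aug\<^esub> \<in> carrier quotient_aug" "coset_rp \<zero>\<^bsub>quotient_aug\<^esub> = 0"
    using ops(1)[OF const_in_C const_in_C] aug_closed(1) coset_rp[OF aug_subset[OF aug_closed(1)]] rp_0
    unfolding carrier by auto
  fix x y assume "x \<in> carrier quotient_aug" "y \<in> carrier quotient_aug"
  then obtain p p' where p: "x = N +>\<^bsub>free_algebra X\<^esub> p" "y = N +>\<^bsub>free_algebra X\<^esub> p'" "p \<in> aug" "p' \<in> aug"
    unfolding carrier by blast
  then have C: "p \<in> C" "p' \<in> C" using aug_subset by auto
  show "x \<oplus>\<^bsub>quotient_aug\<^esub> y \<in> carrier quotient_aug" "x \<otimes>\<^bsub>quotient_aug\<^esub> y \<in> carrier quotient_aug"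
    unfolding p(1,2) ops(2,3)[OF C] carrier using aug_closed(2)[OF p(3,4)] aug_closed(4)[OF p(4) C(1)]
    by (auto intro: imageI)
  show "coset_rp (x \<oplus>\<^bsub>quotient_aug\<^esub> y) = coset_rp x + coset_rp y"
    "coset_rp (x \<otimes>\<^bsub>quotient_aug\<^esub> y) = coset_rp x * coset_rp y"
    unfolding p(1,2) ops(2,3)[OF C]
    using C C_closed(1,2)[OF C] by (simp_all add: coset_rp rp_add rp_mult)
qed

lemma gen_in_C: "x \<in> X \<Longrightarrow> gen x \<in> C"
  by (simp add: mem_carrier_free_algebra gen_def)

text \<open>Elements without constant term are combinations of nonempty words, so sums, products and
  scalars reach all of them from the generators.\<close>

lemma rp_aug_subset:
  assumes Y: "\<And>x. x \<in> X \<Longrightarrow> rp (gen x) \<in> Y" and Y0: "0 \<in> Y"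
    and add: "\<And>a b. a \<in> Y \<Longrightarrow> b \<in> Y \<Longrightarrow> a + b \<in> Y" and mult: "\<And>a b. a \<in> Y \<Longrightarrow> b \<in> Y \<Longrightarrow> a * b \<in> Y"
    and scale: "\<And>k a. a \<in> Y \<Longrightarrow> scl_end k a \<in> Y"
  shows "rp ` aug \<subseteq> Y"
proof -
  have word: "Poly_Mapping.single (FWord ls) 1 \<in> C \<and>
      (ls \<noteq> [] \<longrightarrow> rp (Poly_Mapping.single (FWord ls) 1) \<in> Y)" if "set ls \<subseteq> X" for ls
    using that
  proof (induction ls)
    case (Cons x ls)
    let ?s = "Poly_Mapping.single (FWord ls) 1 :: ('x, 'k) free_elem"
    have eq: "Poly_Mapping.single (FWord (x # ls)) 1 = gen x * ?s"
      by (simp add: gen_def mult_single plus_fword_def)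
    have IH: "?s \<in> C" "ls \<noteq> [] \<longrightarrow> rp ?s \<in> Y" and x: "x \<in> X" using Cons by auto
    have "rp (gen x * ?s) \<in> Y"
    proof (cases "ls = []")
      case True
      \<comment> \<open>After a single letter the remaining word is the unit, whose image need not
        lie in \<open>Y\<close>.\<close>
      then have "?s = 1" by (simp add: single_one[symmetric] zero_fword_def del: single_one)
      then show ?thesis using Y[OF x] by simp
    next
      case False
      then show ?thesis using IH Y[OF x] mult rp_mult[OF gen_in_C[OF x] IH(1)] by simp
    qed
    then show ?case using eq C_closed(1)[OF gen_in_C[OF x] IH(1)] by simp
  qed (simp add: mem_carrier_free_algebra)
  have sum: "(\<Sum>i\<in>I. f i) \<in> Y" if "\<And>i. i \<in> I \<Longrightarrow> f i \<in> Y" for I and f :: "'x fword \<Rightarrow> _"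
    using that by (induction I rule: infinite_finite_induct) (auto simp: Y0 add)
  have "rp p \<in> Y" if p: "p \<in> aug" for p
  proof -
    have "rp (Poly_Mapping.single w (Poly_Mapping.lookup p w)) \<in> Y" if w: "w \<in> Poly_Mapping.keys p" for w
    proof -
      obtain ls where ls: "w = FWord ls" by (cases w)
      have "set (letters w) \<subseteq> X"
        using aug_subset[OF p] w unfolding mem_carrier_free_algebra by blast
      then have "set ls \<subseteq> X" using ls by simp
      moreover have "ls \<noteq> []"
        using aug_0_notin_keys[OF p] w ls by (auto simp: zero_fword_def)
      ultimately have "rp (Poly_Mapping.single w 1) \<in> Y" using word ls by blast
      then have "rp (const (Poly_Mapping.lookup p w) * Poly_Mapping.single w 1) \<in> Y"
        unfolding rp_const by (rule scale)
      then show ?thesis by (simp add: mult_single)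
    qed
    then have "rp (\<Sum>w\<in>Poly_Mapping.keys p. Poly_Mapping.single w (Poly_Mapping.lookup p w)) \<in> Y"
      unfolding rp_sum by (rule sum)
    then show ?thesis by (simp add: poly_mapping_eq_sum[symmetric])
  qed
  then show ?thesis by blast
qed

end

locale represented_lpa =
  represented_quotient "lpa_gens E" "genideal (free_algebra (lpa_gens E)) (lpa_relations E)" pr +
  wf_digraph E
  for E :: "('v, 'e) pre_digraph" and pr :: "(('v, 'e) lpa_gen, 'k::field) free_elem \<Rightarrow> _"
begin

lemma gens [simp]: "Vertex v \<in> lpa_gens E \<longleftrightarrow> v \<in> verts E" "Edge e \<in> lpa_gens E \<longleftrightarrow> e \<in> arcs E"
  "Ghost e \<in> lpa_gens E \<longleftrightarrow> e \<in> arcs E"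
  by (auto simp: lpa_gens_def)

lemma relation_rp:
  assumes "p \<in> lpa_relations E"
  shows "rp p = 0"
proof -
  have sub: "lpa_relations E \<subseteq> C"
    using lpa_relations_subset_augmentation[OF wf_digraph_axioms] by (auto simp: free_augmentation_def)
  then have "p \<in> genideal (free_algebra (lpa_gens E)) (lpa_relations E)"
    using ring.genideal_self[OF ring_free_algebra sub] assms by blast
  then show ?thesis using rp_eq_0_iff sub assms by blast
qed

lemma rp_gen_mult: "x \<in> lpa_gens E \<Longrightarrow> y \<in> lpa_gens E \<Longrightarrow> rp (gen x * gen y) = rp (gen x) * rp (gen y)"
  by (intro rp_mult gen_in_C)

sublocale ck: ck_family E scl_end "\<lambda>v. rp (vtx v)" "\<lambda>e. rp (edg e)" "\<lambda>e. rp (gst e)"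
proof -
  interpret vector_space "scl_end :: 'k \<Rightarrow> (('v, 'e) lpa_gen, 'k) lin_end \<Rightarrow> _"
    by (rule vector_space_scl_end)
  note R = lpa_relations.intros[THEN relation_rp]
  show "ck_family E scl_end (\<lambda>v. rp (vtx v)) (\<lambda>e. rp (edg e)) (\<lambda>e. rp (gst e))"
  proof unfold_locales
    fix v w assume v: "v \<in> verts E"
    show "rp (vtx v) * rp (vtx v) = rp (vtx v)" using R(1)[OF v] v by (simp add: rp_diff rp_gen_mult)
    show "rp (vtx v) * rp (vtx w) = 0" if "w \<in> verts E" "v \<noteq> w"
      using R(2)[OF v that] v that by (simp add: rp_gen_mult)
  next
    fix e assume e: "e \<in> arcs E"
    then have v: "tail E e \<in> verts E" "head E e \<in> verts E" by auto
    show "rp (vtx (tail E e)) * rp (edg e) = rp (edg e)"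
      using R(3)[OF e] e v by (simp add: rp_diff rp_gen_mult)
    show "rp (edg e) * rp (vtx (head E e)) = rp (edg e)"
      using R(4)[OF e] e v by (simp add: rp_diff rp_gen_mult)
    show "rp (vtx (head E e)) * rp (gst e) = rp (gst e)"
      using R(5)[OF e] e v by (simp add: rp_diff rp_gen_mult)
    show "rp (gst e) * rp (vtx (tail E e)) = rp (gst e)"
      using R(6)[OF e] e v by (simp add: rp_diff rp_gen_mult)
    show "rp (gst e) * rp (edg e) = rp (vtx (head E e))"
      using R(7)[OF e] e v by (simp add: rp_diff rp_gen_mult)
    show "rp (gst e) * rp (edg f) = 0" if "f \<in> arcs E" "e \<noteq> f" for f
      using R(8)[OF e that] e that by (simp add: rp_gen_mult)
  qed (simp_all add: scl_end_mult)
qed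

text \<open>Both sides are the nonunital algebra generated by the images of vertices, edges and
  ghost edges.\<close>

lemma ck_R_eq: "ck.R = rp ` aug"
proof
  have gen: "gen x \<in> aug" if "x \<in> lpa_gens E" for x
    using gen_in_C[OF that] by (simp add: free_augmentation_def gen_def lookup_single zero_fword_def)
  have sub: "ck.subspace (rp ` aug)"
    unfolding ck.subspace_def using rp_aug_closed(1,2,5) by (intro conjI ballI allI)
  have pe: "ck.pe u es \<in> rp ` aug" if "ck.wpath u es v" for u es v
    using that by (induction es arbitrary: u) (auto intro!: rp_aug_closed(4) imageI gen)
  have gh: "ck.gh u es \<in> rp ` aug" if "ck.wpath u es v" for u es v
    using that by (induction es arbitrary: u) (auto intro!: rp_aug_closed(4) imageI gen)
  show "ck.R \<subseteq> rp ` aug"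
    unfolding ck.R_eq_span
  proof (rule ck.span_minimal[OF subsetI sub])
    fix a assume "a \<in> {ck.pe u es * ck.gh v fs | u es v fs x. ck.wpath u es x \<and> ck.wpath v fs x}"
    then show "a \<in> rp ` aug" by (elim CollectE exE conjE) (simp only: rp_aug_closed(4) pe gh)
  qed
  show "rp ` aug \<subseteq> ck.R"
  proof (rule rp_aug_subset)
    show "rp (gen x) \<in> ck.R" if "x \<in> lpa_gens E" for x
      using that ck.generators_in_R(1-3) by (auto simp: lpa_gens_def)
  qed (auto intro: ck.R_zero ck.R_add ck.R_mult ck.R_scale)
qed

sublocale pure_ring_image ck.R quotient_aug coset_rp
  unfolding pure_ring_image_def
  using ring_image_coset_rp[folded ck_R_eq] ck.pure_ideals_in_axioms by (rule conjI)

end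

theorem theorem3p12:
  fixes E :: "('v, 'e) pre_digraph"
    and I :: "('v, 'e, 'k::field) lpa_elem set"
    and P Q :: "nat \<Rightarrow> ('v, 'e, 'k) lpa_elem set"
    and r s :: "nat \<Rightarrow> nat"
    and m n :: nat
  assumes "wf_digraph E"
    and "two_sided_ideal I (leavitt_path_algebra E)"
    and "prime_power_rep (leavitt_path_algebra E) I m P r"
    and "prime_power_rep (leavitt_path_algebra E) I n Q s"
  shows "m = n \<and>
    (\<lambda>i. ideal_power (leavitt_path_algebra E) (P i) (r i)) ` {1..m} =
    (\<lambda>j. ideal_power (leavitt_path_algebra E) (Q j) (s j)) ` {1..n}"
proof -
  let ?F = "free_algebra (lpa_gens E) :: (('v, 'e) lpa_gen, 'k) free_elem ring"
  let ?N = "genideal ?F (lpa_relations E)"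
  interpret F: ring ?F by (rule ring_free_algebra)
  have N: "ideal ?N ?F"
    using lpa_relations_subset_augmentation[OF assms(1)]
    by (intro F.genideal_ideal) (auto simp: free_augmentation_def)
  interpret N: ideal ?N ?F by (rule N)
  interpret vs: vector_space "\<lambda>k (p :: (('v, 'e) lpa_gen, 'k) free_elem). const k * p"
    by (rule vector_space_free_elem)
  have const: "const k \<in> carrier ?F" for k
    by (simp add: mem_carrier_free_algebra zero_fword_def)
  \<comment> \<open>Ideals of the free algebra are subspaces because the constants belong to
    it.\<close>
  have "vs.subspace ?N"
    using N.zero_closed N.a_closed N.I_l_closed[OF _ const] by (simp add: vs.subspace_def)
  moreover have "vs.subspace (carrier ?F)"
    using F.zero_closed F.a_closed F.m_closed[OF const] by (simp add: vs.subspace_def)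
  moreover have "?N \<subseteq> carrier ?F" using N.Icarr by blast
  ultimately obtain pr where pr: "lin pr" "\<And>p. pr p \<in> carrier ?F"
    "\<And>p. p \<in> carrier ?F \<Longrightarrow> pr p - p \<in> ?N" "\<And>p. p \<in> ?N \<Longrightarrow> pr p = 0"
    by (rule linear_projection) blast
  interpret represented_lpa E pr
    unfolding represented_lpa_def represented_quotient_def
    using N pr assms(1) by (intro conjI allI impI)
  have L: "leavitt_path_algebra E = quotient_aug"
    by (simp only: leavitt_path_algebra_def nonunital_presentation_def Let_def quotient_aug_def)
  show ?thesis
    unfolding L by (rule prime_power_rep_unique[OF assms(3,4)[unfolded L]])
qed

end
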